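(* Let $T>0$, $t\in[0,T]$, let $B^H$ be a fractional Brownian motion with Hurst parameter $H\in\left(\frac12,1\right)$, let $S(t)=e^{B^H(t)}$ be the corresponding geometric fractional Brownian motion, and for $s\in[0,T]$ put $$G(s)=\exp\left(\frac1T\int_0^s \log S(u)\,du\right)S(s)^{\frac{T-s}{T}}.$$ Let $f:\mathbb{R}\to\mathbb{R}$ be a convex function with left derivative $f'_-$. Then it holds almost surely that $$f\left(\exp\left(\frac1T\int_0^t B^H(s)\,ds\right)S(t)^{\frac{T-t}{T}}\right)=f(S(0))+\int_0^t\frac{T-s}{T}f'_-\left(G(s)\right)G(s)\,dB^H(s),$$ where the stochastic integral on the right side is understood in the sense of the generalized Lebesgue-Stieltjes integral.
   Context: Setting: $(\Omega,\mathcal{F},(\mathcal{F}_t)_{t\ge0},\mathbb{P})$ is a complete filtered probability space. Fractional Brownian motion $(B^H(t))_{t\ge0}$ is a Gaussian process with $\mathbb{E}B^H(t)=B^H(0)$ (a constant) and $\mathrm{Cov}(B^H(t),B^H(s))=\frac12\left(t^{2H}+s^{2H}-|t-s|^{2H}\right)$; its trajectories on $[0,T]$ belong almost surely to the space $W_1^\beta([0,T])$ defined below for every $0<\beta<H$ (in particular they are continuous). Fractional Besov spaces: for $\beta\in(0,1)$ and measurable $f:[0,T]\to\mathbb{R}$, $f\in W_1^\beta([0,T])$ iff $\|f\|_{1,\beta}=\sup_{0\le s<t\le T}\left(\frac{|f(t)-f(s)|}{(t-s)^\beta}+\int_s^t\frac{|f(u)-f(s)|}{(u-s)^{\beta+1}}du\right)<\infty$,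 and $f\in W_2^\beta([0,T])$ iff $\|f\|_{2,\beta}=\int_0^T\frac{|f(t)|}{t^\beta}dt+\int_0^T\int_0^t\frac{|f(t)-f(s)|}{(t-s)^{\beta+1}}ds\,dt<\infty$. Fractional derivatives on $[0,t]$: for $\alpha\in(0,1)$, $(D^\alpha_{0+}f)(x)=\frac{1}{\Gamma(1-\alpha)}\frac{d}{dx}\int_0^x f(s)(x-s)^{-\alpha}ds$ and $(D^\alpha_{t-}f)(x)=\frac{-1}{\Gamma(1-\alpha)}\frac{d}{dx}\int_x^t f(s)(s-x)^{-\alpha}ds$. Generalized Lebesgue-Stieltjes integral: if for some $\beta\in(0,1)$ one has $f\in W_2^\beta([0,T])$ and $g\in W_1^{1-\beta}([0,T])$, then for $t\in(0,T]$ the Lebesgue integral $\int_0^t f\,dg:=\int_0^t (D^\beta_{0+}f)(x)\,(D^{1-\beta}_{t-}g_{t-})(x)\,dx$, with $g_{t-}(x)=g(t-)-g(x)$, exists and is called the generalized Lebesgue-Stieltjes integral of $f$ with respect to $g$; its value is the same for all admissible $\beta$. For $t=0$ the integral is $0$. Stochastic integrals with respect to $B^H$ are taken pathwise in this sense. *)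

theory Defs
  imports "HOL-Probability.Probability"
begin

section \<open>Probabilistic setting\<close>

text \<open>Completeness of the filtration: every null set already belongs to the initial
  sigma-algebra. Only time indices \<open>t \<ge> 0\<close> are relevant.\<close>

locale complete_filtered_prob_space = prob_space M + complete_measure M
  for M :: "'a measure" and F :: "real \<Rightarrow> 'a measure" +
  assumes subalgebra_filtration: "\<And>t. 0 \<le> t \<Longrightarrow> subalgebra M (F t)"
    and filtration_mono: "\<And>s t. 0 \<le> s \<Longrightarrow> s \<le> t \<Longrightarrow> sets (F s) \<subseteq> sets (F t)"
    and filtration_complete: "null_sets M \<subseteq> sets (F 0)"

text \<open>Degenerate (almost surely constant) random variables count as Gaussian.\<close>

definition gaussian_rv :: "'a measure \<Rightarrow> ('a \<Rightarrow> real) \<Rightarrow> bool" where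
  "gaussian_rv M X \<longleftrightarrow> X \<in> borel_measurable M \<and>
     ((\<exists>\<mu>. AE \<omega> in M. X \<omega> = \<mu>) \<or>
      (\<exists>\<mu> \<sigma>. 0 < \<sigma> \<and> distributed M lborel X (normal_density \<mu> \<sigma>)))"

text \<open>All finite-dimensional distributions are (possibly degenerate) multivariate Gaussian,
  i.e. every finite linear combination is Gaussian.\<close>

definition gaussian_process :: "'a measure \<Rightarrow> (real \<Rightarrow> 'a \<Rightarrow> real) \<Rightarrow> bool" where
  "gaussian_process M X \<longleftrightarrow>
     (\<forall>J a. finite J \<longrightarrow> J \<subseteq> {0..} \<longrightarrow> gaussian_rv M (\<lambda>\<omega>. \<Sum>t\<in>J. a t * X t \<omega>))"


section \<open>Fractional Besov spaces\<close>

text \<open>The norms take values in \<open>[0, \<infinity>]\<close>. The integrands are only relevant off the diagonal,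
  a null set, where Isabelle's convention \<open>x / 0 = 0\<close> applies.\<close>

definition W1_norm :: "real \<Rightarrow> real \<Rightarrow> (real \<Rightarrow> real) \<Rightarrow> ennreal" where
  "W1_norm \<beta> T f =
     (SUP (s, t) \<in> {(s, t). 0 \<le> s \<and> s < t \<and> t \<le> T}.
        ennreal (\<bar>f t - f s\<bar> / (t - s) powr \<beta>) +
        (\<integral>\<^sup>+u\<in>{s..t}. ennreal (\<bar>f u - f s\<bar> / (u - s) powr (\<beta> + 1)) \<partial>lebesgue))"

definition W2_norm :: "real \<Rightarrow> real \<Rightarrow> (real \<Rightarrow> real) \<Rightarrow> ennreal" where
  "W2_norm \<beta> T f =
     (\<integral>\<^sup>+t\<in>{0..T}. ennreal (\<bar>f t\<bar> / t powr \<beta>) \<partial>lebesgue) +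
     (\<integral>\<^sup>+t\<in>{0..T}. (\<integral>\<^sup>+s\<in>{0..t}. ennreal (\<bar>f t - f s\<bar> / (t - s) powr (\<beta> + 1)) \<partial>lebesgue)
        \<partial>lebesgue)"

definition W1 :: "real \<Rightarrow> real \<Rightarrow> (real \<Rightarrow> real) set" where
  "W1 \<beta> T = {f. f \<in> borel_measurable (lebesgue_on {0..T}) \<and> W1_norm \<beta> T f < \<infinity>}"

definition W2 :: "real \<Rightarrow> real \<Rightarrow> (real \<Rightarrow> real) set" where
  "W2 \<beta> T = {f. f \<in> borel_measurable (lebesgue_on {0..T}) \<and> W2_norm \<beta> T f < \<infinity>}"


section \<open>Generalized Lebesgue-Stieltjes integral\<close>

definition frac_deriv_left :: "real \<Rightarrow> (real \<Rightarrow> real) \<Rightarrow> real \<Rightarrow> real" where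
  "frac_deriv_left \<alpha> f x =
     1 / Gamma (1 - \<alpha>) * deriv (\<lambda>y. LINT s:{0..y}|lebesgue. f s * (y - s) powr (- \<alpha>)) x"

definition frac_deriv_right :: "real \<Rightarrow> real \<Rightarrow> (real \<Rightarrow> real) \<Rightarrow> real \<Rightarrow> real" where
  "frac_deriv_right \<alpha> t f x =
     - 1 / Gamma (1 - \<alpha>) * deriv (\<lambda>y. LINT s:{y..t}|lebesgue. f s * (s - y) powr (- \<alpha>)) x"

definition gls_integrand ::
    "real \<Rightarrow> (real \<Rightarrow> real) \<Rightarrow> (real \<Rightarrow> real) \<Rightarrow> real \<Rightarrow> real \<Rightarrow> real" where
  "gls_integrand \<beta> f g t x =
     frac_deriv_left \<beta> f x * frac_deriv_right (1 - \<beta>) t (\<lambda>y. Lim (at_left t) g - g y) x"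

text \<open>\<open>has_gls_integral T f g t I\<close>: the integral of \<open>f\<close> with respect to \<open>g\<close> over \<open>[0, t]\<close>
  exists, with \<open>f\<close> and \<open>g\<close> considered on \<open>[0, T]\<close>, and equals \<open>I\<close>. As the value does not depend
  on the admissible \<open>\<beta>\<close>, any witness \<open>\<beta>\<close> determines it.\<close>

definition has_gls_integral ::
    "real \<Rightarrow> (real \<Rightarrow> real) \<Rightarrow> (real \<Rightarrow> real) \<Rightarrow> real \<Rightarrow> real \<Rightarrow> bool" where
  "has_gls_integral T f g t I \<longleftrightarrow>
     (\<exists>\<beta>. 0 < \<beta> \<and> \<beta> < 1 \<and> f \<in> W2 \<beta> T \<and> g \<in> W1 (1 - \<beta>) T \<and>
        (if t = 0 then I = 0
         else set_integrable lebesgue {0..t} (gls_integrand \<beta> f g t) \<and>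
              I = (LINT x:{0..t}|lebesgue. gls_integrand \<beta> f g t x)))"


section \<open>Fractional Brownian motion and derived processes\<close>

text \<open>The initial value is an arbitrary constant. The last clause selects, as usual, a version
  with regular paths; it is not implied by the finite-dimensional distributions.\<close>

definition fractional_brownian_motion ::
    "'a measure \<Rightarrow> real \<Rightarrow> (real \<Rightarrow> 'a \<Rightarrow> real) \<Rightarrow> bool" where
  "fractional_brownian_motion M H B \<longleftrightarrow>
     gaussian_process M B \<and>
     (\<exists>c. (AE \<omega> in M. B 0 \<omega> = c) \<and> (\<forall>t\<ge>0. (LINT \<omega>|M. B t \<omega>) = c)) \<and>
     (\<forall>t\<ge>0. \<forall>s\<ge>0.
        (LINT \<omega>|M. (B t \<omega> - (LINT \<omega>'|M. B t \<omega>')) * (B s \<omega> - (LINT \<omega>'|M. B s \<omega>')))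
          = (t powr (2 * H) + s powr (2 * H) - \<bar>t - s\<bar> powr (2 * H)) / 2) \<and>
     (\<forall>T>0. \<forall>\<beta>. 0 < \<beta> \<longrightarrow> \<beta> < H \<longrightarrow> (AE \<omega> in M. (\<lambda>t. B t \<omega>) \<in> W1 \<beta> T))"

definition geometric_process :: "(real \<Rightarrow> 'a \<Rightarrow> real) \<Rightarrow> real \<Rightarrow> 'a \<Rightarrow> real" where
  "geometric_process B t \<omega> = exp (B t \<omega>)"

definition geometric_average :: "real \<Rightarrow> (real \<Rightarrow> 'a \<Rightarrow> real) \<Rightarrow> real \<Rightarrow> 'a \<Rightarrow> real" where
  "geometric_average T S s \<omega> =
     exp (1 / T * (LINT u:{0..s}|lebesgue. ln (S u \<omega>))) * S s \<omega> powr ((T - s) / T)"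

definition left_deriv :: "(real \<Rightarrow> real) \<Rightarrow> real \<Rightarrow> real" where
  "left_deriv f x = (THE D. (f has_real_derivative D) (at_left x))"

end

theory Submission
  imports Defs "HOL-Real_Asymp.Real_Asymp"
begin

text \<open>
  Everything is done for the exponent \<open>\<beta> = 1/2\<close>. Let \<open>c(x) = x powr (-1/2)\<close> for \<open>x > 0\<close> and
  \<open>c(x) = 0\<close> otherwise, so that \<open>c * c\<close> is \<open>\<pi>\<close> times the Heaviside function. For a bounded
  \<open>h\<close> with finite \<open>W2\<close> norm the convolution \<open>c * h\<close> is the indefinite integral of the
  Marchaud derivative \<open>w\<close> of \<open>h\<close>, which is therefore the fractional derivative almost
  everywhere, and Abel inversion gives \<open>\<pi> h = c * w\<close>. With Fubini's theorem this identifies the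
  generalized Lebesgue-Stieltjes integral of \<open>h\<close> with respect to a Hoelder function \<open>g\<close> of exponent
  above \<open>1/2\<close> as the limit of \<open>\<integral> h(x) (g(x + e) - g(x)) / e dx\<close>, for \<open>e\<close> tending to \<open>0\<close> from
  either side. The chain rule then needs no approximation of \<open>f\<close>: integrating the subgradient
  inequality \<open>f(G(x + e)) - f(G(x)) \<ge> f'(G(x)) (G(x + e) - G(x))\<close> and dividing by \<open>e > 0\<close> and by
  \<open>e < 0\<close> gives the two inequalities between the integral and \<open>f(G(t)) - f(G(0))\<close>.

  Probability enters only in showing that the integrand is almost surely in \<open>W2\<close>. Because the
  covariances of \<open>B\<close> are nonnegative, the law of \<open>ln G(t)\<close> has a density at most
  \<open>T / ((T - t) t\<^sup>H)\<close>; the factor \<open>(T - t) / T\<close> of the integrand cancels the singularity at \<open>T\<close>.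
\<close>

section \<open>Convolution with the Abel kernel\<close>

text \<open>The obstacle is the irregularity of the integrand: \<open>left_deriv f\<close> may jump
  on a dense set of points, so no modulus of continuity passes from the path to the integrand, and
  finiteness of its \<open>W2\<close> norm depends on how much time \<open>ln G\<close> spends near
  the jumps. A density bound controls this because the increments of a bounded monotone function
  over distance \<epsilon> have Lebesgue integral of order \<epsilon>. Expectations cannot be
  estimated with the random Hoelder constant and the random bound of the path inside; both are
  replaced by an integer \<open>n\<close>. The estimate holds for all \<open>n\<close> outside one
  null set, and \<open>n\<close> is chosen path by path only at the end.

  The exponent 1/2 is admissible for every \<open>H\<close> above 1/2, and it gives both fractional
  derivatives the same kernel and the same constant \<open>Gamma (1/2) = sqrt pi\<close>. Hence one
  study of convolution with this kernel serves the integrand directly and the integrator after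
  reflection at \<open>t\<close>.

  Linearizing the exponential and the time average leaves a remainder of order
  \<open>\<bar>e\<bar> powr (2 * \<gamma>)\<close>, where \<gamma> lies strictly between 1/2 and
  \<open>H\<close>; it vanishes after division by \<open>e\<close> because 2 \<gamma> exceeds
  1.\<close>

definition half_kernel :: "real \<Rightarrow> real" where
  "half_kernel x = (if 0 < x then x powr (-1/2) else 0)"

definition step :: "real \<Rightarrow> real" where
  "step x = (if 0 < x then 1 else 0)"

text \<open>The Bochner integral is 0 where the product is not integrable, so the identities below
  are accompanied by integrability statements.\<close>

definition conv :: "(real \<Rightarrow> real) \<Rightarrow> (real \<Rightarrow> real) \<Rightarrow> real \<Rightarrow> real" where
  "conv f g z = (LINT y|lborel. f (z - y) * g y)"

lemma half_kernel_measurable [measurable]: "half_kernel \<in> borel_measurable borel"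
  unfolding half_kernel_def by measurable

lemma step_measurable [measurable]: "step \<in> borel_measurable borel"
  unfolding step_def by measurable

lemma half_kernel_nonneg [simp]: "0 \<le> half_kernel x"
  by (simp add: half_kernel_def)

lemma step_nonneg [simp]: "0 \<le> step x"
  by (simp add: step_def)

lemma conv_measurable [measurable]:
  assumes [measurable]: "f \<in> borel_measurable borel" "g \<in> borel_measurable borel"
  shows "conv f g \<in> borel_measurable borel"
  unfolding conv_def by measurable

lemma conv_shift: "(LINT y|lborel. f (z - y) * g (y - x)) = conv f g (z - x)"
proof -
  have "conv f g (z - x) = (LINT y|lborel. f (z - x - (- x + 1 * y)) * g (- x + 1 * y))"
    unfolding conv_def by (subst lborel_integral_real_affine[of 1 _ "-x"]) auto
  then show ?thesis by (simp add: algebra_simps)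
qed

lemma conv_integrable_shift:
  fixes f g :: "real \<Rightarrow> real"
  assumes "integrable lborel (\<lambda>y. f (z - x - y) * g y)"
  shows "integrable lborel (\<lambda>y. f (z - y) * g (y - x))"
  using lborel_integrable_real_affine[OF assms, of 1 "-x"] by (simp add: algebra_simps)

lemma conv_commute: "conv f g z = conv g f z"
proof -
  have "conv f g z = \<bar>-1\<bar> *\<^sub>R (LINT y|lborel. f (z - (z + (-1) * y)) * g (z + (-1) * y))"
    unfolding conv_def by (rule lborel_integral_real_affine) simp
  then show ?thesis by (simp add: conv_def mult.commute)
qed

lemma conv_integrable_commute:
  fixes f g :: "real \<Rightarrow> real"
  assumes "integrable lborel (\<lambda>y. f (z - y) * g y)"
  shows "integrable lborel (\<lambda>y. g (z - y) * f y)"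
  using lborel_integrable_real_affine[OF assms, of "-1" z] by (simp add: mult.commute)

text \<open>Fubini for \<open>f (z - y) * g (y - x) * k x\<close>. Since \<open>f\<close> and
  \<open>g\<close> are nonnegative, integrating the absolute value over \<open>y\<close> gives
  exactly \<open>conv f g (z - x) * \<bar>k x\<bar>\<close>, so \<open>int2\<close> is the absolute
  integrability that Fubini asks for, while \<open>k\<close> may change sign.\<close>

lemma conv_assoc:
  assumes [measurable]: "f \<in> borel_measurable borel" "g \<in> borel_measurable borel"
      "k \<in> borel_measurable borel"
    and nonneg: "\<And>x. 0 \<le> f x" "\<And>x. 0 \<le> g x"
    and int1: "\<And>z. integrable lborel (\<lambda>y. f (z - y) * g y)"
    and int2: "integrable lborel (\<lambda>x. conv f g (z - x) * k x)"
  shows "conv f (conv g k) z = conv (conv f g) k z"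
    and "integrable lborel (\<lambda>y. f (z - y) * conv g k y)"
proof -
  define P where "P = (\<lambda>(x, y). f (z - y) * g (y - x) * k x)"
  have [measurable]: "P \<in> borel_measurable (lborel \<Otimes>\<^sub>M lborel)"
    unfolding P_def by measurable
  have inner: "(LINT y|lborel. \<bar>P (x, y)\<bar>) = \<bar>conv f g (z - x) * k x\<bar>" for x
  proof -
    have "(LINT y|lborel. \<bar>P (x, y)\<bar>) = (LINT y|lborel. f (z - y) * g (y - x)) * \<bar>k x\<bar>"
      by (simp add: P_def abs_mult nonneg)
    also have "\<dots> = \<bar>conv f g (z - x) * k x\<bar>"
      by (simp add: conv_shift abs_mult conv_def nonneg)
    finally show ?thesis .
  qed
  have P: "integrable (lborel \<Otimes>\<^sub>M lborel) P"
  proof (rule lborel_pair.Fubini_integrable)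
    show "integrable lborel (\<lambda>x. LINT y|lborel. norm (P (x, y)))"
      using int2 by (simp add: inner)
    show "AE x in lborel. integrable lborel (\<lambda>y. P (x, y))"
      using conv_integrable_shift[OF int1] by (simp add: P_def)
  qed simp
  have eq: "(LINT x|lborel. P (x, y)) = f (z - y) * conv g k y" for y
    by (simp add: P_def conv_def mult.assoc)
  have "conv f (conv g k) z = (LINT y|lborel. LINT x|lborel. P (x, y))"
    by (subst conv_def) (simp add: eq)
  also have "\<dots> = (LINT x|lborel. LINT y|lborel. P (x, y))"
    using lborel_pair.Fubini_integral[of "\<lambda>x y. P (x, y)"] P by simp
  also have "\<dots> = conv (conv f g) k z"
    by (simp add: conv_def[of "conv f g"] P_def conv_shift)
  finally show "conv f (conv g k) z = conv (conv f g) k z" .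
  have "integrable lborel (\<lambda>y. LINT x|lborel. P (x, y))"
    using lborel_pair.integrable_snd[of "\<lambda>x y. P (x, y)"] P by simp
  then show "integrable lborel (\<lambda>y. f (z - y) * conv g k y)"
    by (simp add: eq)
qed

lemma has_bochner_integral_powr_from_0:
  assumes "-1 < a" "0 \<le> c"
  shows "has_bochner_integral lborel (\<lambda>x::real. indicator {0<..<c} x * x powr a)
           (c powr (a + 1) / (a + 1))"
proof (rule has_bochner_integral_nn_integral)
  have "((\<lambda>x. x powr a) has_integral (c powr (a + 1) / (a + 1))) {0..c}"
    using assms has_integral_powr_from_0 by blast
  then have "((\<lambda>x. indicator {0..c} x * x powr a) has_integral (c powr (a + 1) / (a + 1))) UNIV"
    by (subst (asm) has_integral_restrict_UNIV[symmetric])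
      (simp add: indicator_def if_distrib if_distribR of_bool_def cong: if_cong)
  then have "(\<integral>\<^sup>+x. indicator {0..c} x * x powr a \<partial>lborel) = ennreal (c powr (a + 1) / (a + 1))"
    by (intro nn_integral_has_integral_lborel) auto
  moreover have "(\<integral>\<^sup>+x. indicator {0..c} x * x powr a \<partial>lborel) =
      (\<integral>\<^sup>+x. indicator {0<..<c} x * x powr a \<partial>lborel)"
    by (intro nn_integral_cong_AE AE_I'[of "{0, c}"])
      (auto simp: indicator_def intro: finite_imp_null_set_lborel)
  ultimately show "(\<integral>\<^sup>+x. ennreal (indicator {0<..<c} x * x powr a) \<partial>lborel) =
      ennreal (c powr (a + 1) / (a + 1))"
    by simp
qed (use assms in auto)

lemma conv_step_half_kernel:
  shows "integrable lborel (\<lambda>y. step (z - y) * half_kernel y)"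
    and "conv step half_kernel z = (if 0 < z then 2 * z powr (1/2) else 0)"
proof -
  have eq: "step (z - y) * half_kernel y = indicator {0<..<max 0 z} y * y powr (-1/2)" for y
    by (auto simp: step_def half_kernel_def indicator_def)
  have "has_bochner_integral lborel (\<lambda>y. step (z - y) * half_kernel y)
      (max 0 z powr (-1/2 + 1) / (-1/2 + 1))"
    unfolding eq by (rule has_bochner_integral_powr_from_0) auto
  then show "integrable lborel (\<lambda>y. step (z - y) * half_kernel y)"
    and "conv step half_kernel z = (if 0 < z then 2 * z powr (1/2) else 0)"
    by (auto simp: has_bochner_integral_iff conv_def max_def)
qed

text \<open>Scaling by \<open>z\<close> reduces the integral to \<open>z = 1\<close>, where it is
  \<open>Beta (1/2) (1/2) = pi\<close>; the powers of \<open>z\<close> cancel because the two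
  exponents -1/2 and the Jacobian add up to 0.\<close>

lemma conv_half_kernel_half_kernel:
  shows "integrable lborel (\<lambda>y. half_kernel (z - y) * half_kernel y)"
    and "conv half_kernel half_kernel z = pi * step z"
proof -
  have "has_bochner_integral lborel (\<lambda>y. half_kernel (z - y) * half_kernel y) (pi * step z)"
  proof (cases "0 < z")
    case True
    have "((\<lambda>t::real. t powr (1/2 - 1) * (1 - t) powr (1/2 - 1)) has_integral Beta (1/2) (1/2)) {0..1}"
      by (rule has_integral_Beta_real) auto
    also have "Beta (1/2) (1/2 :: real) = pi"
      by (simp add: Beta_def Gamma_one_half_real)
    finally have "((\<lambda>t::real. indicator {0..1} t * (t powr (-1/2) * (1 - t) powr (-1/2))) has_integral pi) UNIV"
      by (subst (asm) has_integral_restrict_UNIV[symmetric])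
        (simp add: indicator_def if_distrib if_distribR of_bool_def cong: if_cong)
    then have "(\<integral>\<^sup>+t. ennreal (indicator {0..1} t * (t powr (-1/2) * (1 - t) powr (-1/2))) \<partial>lborel) = ennreal pi"
      by (intro nn_integral_has_integral_lborel) auto
    moreover have "(\<integral>\<^sup>+t. ennreal (indicator {0..1} t * (t powr (-1/2) * (1 - t) powr (-1/2))) \<partial>lborel) =
      (\<integral>\<^sup>+t. half_kernel (1 - t) * half_kernel t \<partial>lborel)"
      by (intro nn_integral_cong_AE AE_I'[of "{0, 1}"])
        (auto simp: indicator_def half_kernel_def mult.commute intro: finite_imp_null_set_lborel)
    ultimately have "has_bochner_integral lborel (\<lambda>t. half_kernel (1 - t) * half_kernel t) pi"
      by (intro has_bochner_integral_nn_integral) auto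
    then have "has_bochner_integral lborel (\<lambda>t. half_kernel (1 - (0 + (1/z) * t)) * half_kernel (0 + (1/z) * t)) (pi /\<^sub>R \<bar>1/z\<bar>)"
      by (subst lborel_has_bochner_integral_real_affine_iff[symmetric]) (use True in auto)
    then have "has_bochner_integral lborel (\<lambda>t. (1 / z) * (half_kernel (1 - t / z) * half_kernel (t / z))) ((1/z) * (z * pi))"
      by (intro has_bochner_integral_mult_right) (use True in auto)
    moreover have "(1 / z) * (half_kernel (1 - t / z) * half_kernel (t / z)) = half_kernel (z - t) * half_kernel t" for t
    proof -
      have "(1 - t / z) powr (- 1/2) = z powr (1/2) * (z - t) powr (- 1/2)" if "t < z"
      proof -
        have "(1 - t / z) = (z - t) / z" using True by (simp add: field_simps)
        then show ?thesis
          using that True by (simp add: powr_divide powr_minus_divide)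
      qed
      moreover have "(t / z) powr (- 1/2) = z powr (1/2) * t powr (- 1/2)" if "0 < t"
        using that True by (simp add: powr_divide powr_minus_divide)
      moreover have "z powr (1/2) * z powr (1/2) = z"
        using True by (simp flip: powr_add)
      ultimately show ?thesis
        using True by (auto simp: half_kernel_def field_simps)
    qed
    ultimately show ?thesis
      using True by (simp add: step_def)
  next
    case False
    then have "half_kernel (z - y) * half_kernel y = 0" for y
      by (auto simp: half_kernel_def)
    then have "(\<lambda>y. half_kernel (z - y) * half_kernel y) = (\<lambda>y. 0)"
      by blast
    then show ?thesis using False
      by (simp only: step_def if_False mult_zero_right has_bochner_integral_zero)
  qed
  then show "integrable lborel (\<lambda>y. half_kernel (z - y) * half_kernel y)"
    and "conv half_kernel half_kernel z = pi * step z"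
    by (auto simp: has_bochner_integral_iff conv_def)
qed

section \<open>The Marchaud derivative\<close>

definition marchaud_inc :: "(real \<Rightarrow> real) \<Rightarrow> real \<Rightarrow> real \<Rightarrow> real" where
  "marchaud_inc h x s = indicator {0<..<x} s * ((h x - h s) * (x - s) powr (-3/2))"

text \<open>The classical Marchaud form of the derivative of order 1/2 without its factor
  \<open>1 / Gamma (1/2)\<close>, cut off outside \<open>(0, b)\<close> so that it can be integrable
  on the whole line.\<close>

definition marchaud :: "real \<Rightarrow> (real \<Rightarrow> real) \<Rightarrow> real \<Rightarrow> real" where
  "marchaud b h x = indicator {0<..<b} x *
     (h x * x powr (-1/2) + 1 / 2 * (LINT s|lborel. marchaud_inc h x s))"

text \<open>The kernel capped at height \<open>\<delta> powr (-1/2)\<close>, which removes its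
  singularity. On the positive axis \<open>trunc_deriv \<delta>\<close> is minus its derivative, so
  \<open>trunc_kernel \<delta>\<close> is a multiple of \<open>step\<close> minus an indefinite
  integral.\<close>

definition trunc_kernel :: "real \<Rightarrow> real \<Rightarrow> real" where
  "trunc_kernel \<delta> x = (if 0 < x then max x \<delta> powr (-1/2) else 0)"

definition trunc_deriv :: "real \<Rightarrow> real \<Rightarrow> real" where
  "trunc_deriv \<delta> x = (if \<delta> < x then 1 / 2 * x powr (-3/2) else 0)"

lemma marchaud_inc_measurable [measurable]:
  assumes [measurable]: "h \<in> borel_measurable borel"
  shows "(\<lambda>(x, s). marchaud_inc h x s) \<in> borel_measurable (borel \<Otimes>\<^sub>M borel)"
proof -
  have eq: "(\<lambda>(x, s). marchaud_inc h x s) =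
      (\<lambda>(x, s). if 0 < s \<and> s < x then (h x - h s) * (x - s) powr (-3/2) else 0)"
    by (auto simp: marchaud_inc_def fun_eq_iff)
  show ?thesis unfolding eq by measurable
qed

lemma trunc_kernel_measurable [measurable]: "trunc_kernel \<delta> \<in> borel_measurable borel"
  unfolding trunc_kernel_def by measurable

lemma trunc_deriv_measurable [measurable]: "trunc_deriv \<delta> \<in> borel_measurable borel"
  unfolding trunc_deriv_def by measurable

lemma trunc_deriv_nonneg [simp]: "0 \<le> trunc_deriv \<delta> x"
  by (simp add: trunc_deriv_def)

lemma marchaud_measurable [measurable]:
  assumes [measurable]: "h \<in> borel_measurable borel"
  shows "marchaud b h \<in> borel_measurable borel"
  unfolding marchaud_def
  by measurable

lemma conv_step_trunc_deriv:
  assumes "0 < \<delta>"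
  shows "integrable lborel (\<lambda>y. step (z - y) * trunc_deriv \<delta> y)"
    and "conv step (trunc_deriv \<delta>) z = \<delta> powr (-1/2) * step z - trunc_kernel \<delta> z"
proof -
  have "has_bochner_integral lborel (\<lambda>y. step (z - y) * trunc_deriv \<delta> y)
      (\<delta> powr (-1/2) * step z - trunc_kernel \<delta> z)"
  proof (cases "\<delta> < z")
    case True
    have "has_bochner_integral lborel (\<lambda>x. 1 / 2 * x powr (-3/2) * indicator {\<delta>..z} x)
        (- (z powr (-1/2)) - (- (\<delta> powr (-1/2))))"
    proof (rule has_bochner_integral_FTC_Icc_nonneg)
      show "((\<lambda>x. - (x powr (-1/2))) has_real_derivative 1 / 2 * x powr (-3/2)) (at x)"
        if "x \<in> {\<delta>..z}" for x
        using that assms by (auto intro!: derivative_eq_intros)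
    qed (use True in auto)
    then have "has_bochner_integral lborel (\<lambda>x. 1 / 2 * x powr (-3/2) * indicator {\<delta>..z} x)
        (\<delta> powr (-1/2) * step z - trunc_kernel \<delta> z)"
      using True assms by (simp add: step_def trunc_kernel_def max_def)
    then show ?thesis
    proof (rule has_bochner_integralI_AE)
      show "AE x in lborel. 1 / 2 * x powr (-3/2) * indicator {\<delta>..z} x = step (z - x) * trunc_deriv \<delta> x"
        by (rule AE_I'[of "{\<delta>, z}"])
         (auto simp: step_def trunc_deriv_def indicator_def intro: finite_imp_null_set_lborel)
    qed simp
  next
    case False
    then have "step (z - y) * trunc_deriv \<delta> y = 0" for y
      by (auto simp: step_def trunc_deriv_def)
    moreover have "\<delta> powr (-1/2) * step z - trunc_kernel \<delta> z = 0"
      using False assms by (auto simp: step_def trunc_kernel_def max_def)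
    ultimately show ?thesis
      by (simp only: has_bochner_integral_zero)
  qed
  then show "integrable lborel (\<lambda>y. step (z - y) * trunc_deriv \<delta> y)"
    and "conv step (trunc_deriv \<delta>) z = \<delta> powr (-1/2) * step z - trunc_kernel \<delta> z"
    by (auto simp: has_bochner_integral_iff conv_def)
qed

lemma trunc_kernel_bounds:
  assumes "0 < \<delta>"
  shows "0 \<le> trunc_kernel \<delta> x" "trunc_kernel \<delta> x \<le> half_kernel x"
  using assms by (auto simp: trunc_kernel_def half_kernel_def intro: powr_mono2')

lemma trunc_kernel_tendsto:
  "(\<lambda>n. trunc_kernel (1 / Suc n) x) \<longlonglongrightarrow> half_kernel x"
proof (cases "0 < x")
  case True
  have "(\<lambda>n. 1 / real (Suc n)) \<longlonglongrightarrow> 0"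
    using LIMSEQ_inverse_real_of_nat by (simp add: inverse_eq_divide)
  then have "\<forall>\<^sub>F n in sequentially. 1 / real (Suc n) < x"
    using True by (rule order_tendstoD)
  then have "\<forall>\<^sub>F n in sequentially. trunc_kernel (1 / Suc n) x = half_kernel x"
    by eventually_elim (use True in \<open>simp add: trunc_kernel_def half_kernel_def max_def\<close>)
  then show ?thesis by (rule tendsto_eventually)
qed (simp add: trunc_kernel_def half_kernel_def)

text \<open>The last assumption is finiteness of the double integral of the \<open>W2\<close> norm
  at exponent 1/2. It compares only points of \<open>(0, b)\<close>, so the extension of
  \<open>h\<close> by 0 contributes no jump to it.\<close>

locale besov_function =
  fixes b M :: real and h :: "real \<Rightarrow> real"
  assumes b_pos: "0 < b"
    and h_measurable [measurable]: "h \<in> borel_measurable borel"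
    and h_bounded: "\<And>x. \<bar>h x\<bar> \<le> M"
    and h_support: "\<And>x. x \<notin> {0<..<b} \<Longrightarrow> h x = 0"
    and inc_integrable:
      "integrable (lborel \<Otimes>\<^sub>M lborel) (\<lambda>(x, s). indicator {0<..<b} x * marchaud_inc h x s)"
begin

lemma M_nonneg: "0 \<le> M"
  using h_bounded[of 0] by linarith

lemma h_integrable: "integrable lborel h"
proof (rule Bochner_Integration.integrable_bound)
  show "integrable lborel (\<lambda>x. M * indicator {0<..<b} x)"
    using b_pos by (intro integrable_mult_right integrable_real_indicator) auto
  show "AE x in lborel. norm (h x) \<le> norm (M * indicator {0<..<b} x)"
    using h_bounded h_support M_nonneg by (intro AE_I2) (auto simp: indicator_def)
qed simp

lemma AE_inc_integrable: "AE x in lborel. x \<in> {0<..<b} \<longrightarrow> integrable lborel (marchaud_inc h x)"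
  using lborel_pair.AE_integrable_fst'[OF inc_integrable]
  by eventually_elim auto

lemma abs_inc_integrable:
  "integrable lborel (\<lambda>x. indicator {0<..<b} x * (LINT s|lborel. \<bar>marchaud_inc h x s\<bar>))"
proof -
  have "integrable lborel (\<lambda>x. LINT s|lborel. norm (case (x, s) of (x, s) \<Rightarrow> indicator {0<..<b} x * marchaud_inc h x s))"
    by (rule lborel_pair.integrable_fst'[OF integrable_norm[OF inc_integrable]])
  then show ?thesis by (simp add: abs_mult)
qed

text \<open>A common integrable majorant of \<open>marchaud b h\<close> and of all its truncations,
  made for dominated convergence.\<close>

definition bound :: "real \<Rightarrow> real" where
  "bound x = M * (indicator {0<..<b} x * x powr (-1/2)) +
     1 / 2 * (indicator {0<..<b} x * (LINT s|lborel. \<bar>marchaud_inc h x s\<bar>))"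

lemma bound_integrable: "integrable lborel bound"
proof -
  have "integrable lborel (\<lambda>x::real. indicator {0<..<b} x * x powr (-1/2))"
    using has_bochner_integral_powr_from_0[of "-1/2" b] b_pos by (simp add: has_bochner_integral_iff)
  then show ?thesis
    unfolding bound_def [abs_def]
    by (intro Bochner_Integration.integrable_add integrable_mult_right abs_inc_integrable)
qed

lemma marchaud_integrable: "integrable lborel (marchaud b h)"
proof (rule Bochner_Integration.integrable_bound[OF bound_integrable])
  show "AE x in lborel. norm (marchaud b h x) \<le> norm (bound x)"
  proof (rule AE_I2)
    fix x :: real
    have 1: "\<bar>LINT s|lborel. marchaud_inc h x s\<bar> \<le> (LINT s|lborel. \<bar>marchaud_inc h x s\<bar>)"
      by (rule integral_abs_bound)
    have 2: "\<bar>h x * x powr (-1/2)\<bar> \<le> M * x powr (-1/2)"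
      unfolding abs_mult using h_bounded by (intro mult_mono) (auto simp: M_nonneg)
    have "\<bar>h x * x powr (-1/2) + 1 / 2 * (LINT s|lborel. marchaud_inc h x s)\<bar> \<le>
        \<bar>M * x powr (-1/2) + 1 / 2 * (LINT s|lborel. \<bar>marchaud_inc h x s\<bar>)\<bar>"
      using 1 2 by linarith
    then show "norm (marchaud b h x) \<le> norm (bound x)"
      unfolding marchaud_def bound_def by (cases "x \<in> {0<..<b}") simp_all
  qed
qed simp

lemma half_kernel_times_integrable: "integrable lborel (\<lambda>x. half_kernel (y - x) * h x)"
proof (rule Bochner_Integration.integrable_bound)
  show "integrable lborel (\<lambda>x. M * (half_kernel (y - x) * step x))"
    by (intro integrable_mult_right conv_integrable_commute[OF conv_step_half_kernel(1)])
  show "AE x in lborel. norm (half_kernel (y - x) * h x) \<le> norm (M * (half_kernel (y - x) * step x))"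
  proof (rule AE_I2)
    fix x
    have "\<bar>h x\<bar> \<le> M * step x"
      using h_bounded[of x] h_support[of x] by (auto simp: step_def)
    then have "half_kernel (y - x) * \<bar>h x\<bar> \<le> half_kernel (y - x) * (M * step x)"
      by (intro mult_left_mono) auto
    then show "norm (half_kernel (y - x) * h x) \<le> norm (M * (half_kernel (y - x) * step x))"
      using M_nonneg by (simp add: abs_mult mult_ac)
  qed
qed simp

definition trunc_marchaud :: "real \<Rightarrow> real \<Rightarrow> real" where
  "trunc_marchaud \<delta> x = indicator {0<..<b} x *
     (h x * trunc_kernel \<delta> x + 1 / 2 * (LINT s|lborel. indicator {..<x - \<delta>} s * marchaud_inc h x s))"

lemma trunc_marchaud_measurable [measurable]: "trunc_marchaud \<delta> \<in> borel_measurable borel"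
proof -
  have eq: "(LINT s|lborel. indicator {..<x - \<delta>} s * marchaud_inc h x s) =
     (LINT s|lborel. (if s < x - \<delta> then marchaud_inc h x s else 0))" for x
    by (intro Bochner_Integration.integral_cong) auto
  show ?thesis unfolding trunc_marchaud_def eq by measurable
qed

lemma trunc_deriv_times_integrable:
  assumes "0 < \<delta>" shows "integrable lborel (\<lambda>s. trunc_deriv \<delta> (x - s) * h s)"
proof (rule Bochner_Integration.integrable_bound)
  show "integrable lborel (\<lambda>s. (1 / 2 * \<delta> powr (-3/2)) * h s)"
    by (intro integrable_mult_right h_integrable)
  show "AE s in lborel. norm (trunc_deriv \<delta> (x - s) * h s) \<le> norm ((1 / 2 * \<delta> powr (-3/2)) * h s)"
    using assms by (intro AE_I2)
      (auto simp: trunc_deriv_def abs_mult intro!: mult_right_mono powr_mono2')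
qed simp

text \<open>Away from the diagonal the difference \<open>h x - h s\<close> may be split into two
  convergent integrals. The one with \<open>h x\<close> is explicit by
  \<open>conv_step_trunc_deriv\<close>; it contributes
  \<open>h x * (\<delta> powr (-1/2) - trunc_kernel \<delta> x)\<close>, whose second part cancels
  the boundary term.\<close>

lemma trunc_marchaud_eq:
  assumes "0 < \<delta>" "x < b"
  shows "trunc_marchaud \<delta> x = \<delta> powr (-1/2) * h x - conv (trunc_deriv \<delta>) h x"
proof (cases "0 < x")
  case True
  have 1: "trunc_kernel \<delta> x = \<delta> powr (-1/2) - conv (trunc_deriv \<delta>) step x"
    using True by (subst conv_commute) (simp add: conv_step_trunc_deriv(2)[OF assms(1)] step_def)
  have 2: "h x * conv (trunc_deriv \<delta>) step x - conv (trunc_deriv \<delta>) h x =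
      (LINT s|lborel. h x * (trunc_deriv \<delta> (x - s) * step s) - trunc_deriv \<delta> (x - s) * h s)"
    unfolding conv_def
    by (subst Bochner_Integration.integral_diff)
      (auto intro!: trunc_deriv_times_integrable assms conv_integrable_commute[OF conv_step_trunc_deriv(1)])
  have 3: "h x * (trunc_deriv \<delta> (x - s) * step s) - trunc_deriv \<delta> (x - s) * h s =
      1 / 2 * (indicator {..<x - \<delta>} s * marchaud_inc h x s)" for s
    using assms h_support[of s]
    by (auto simp: trunc_deriv_def step_def marchaud_inc_def indicator_def algebra_simps)
  have "(LINT s|lborel. h x * (trunc_deriv \<delta> (x - s) * step s) - trunc_deriv \<delta> (x - s) * h s) =
      1 / 2 * (LINT s|lborel. indicator {..<x - \<delta>} s * marchaud_inc h x s)"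
    unfolding 3 by simp
  with 1 2 show ?thesis
    using True assms by (simp add: trunc_marchaud_def right_diff_distrib mult.commute)
next
  case False
  then have "(\<lambda>s. trunc_deriv \<delta> (x - s) * h s) = (\<lambda>s. 0)"
    using assms h_support by (auto simp: trunc_deriv_def fun_eq_iff)
  then have "conv (trunc_deriv \<delta>) h x = 0"
    by (simp only: conv_def Bochner_Integration.integral_zero)
  then show ?thesis
    using False h_support[of x] by (simp add: trunc_marchaud_def)
qed

text \<open>Both sides equal \<open>step\<close> convolved with
  \<open>\<delta> powr (-1/2) * h - conv (trunc_deriv \<delta>) h\<close>, by associativity. The
  restriction \<open>y \<le> b\<close> reflects the cut-off in
  \<open>trunc_marchaud\<close>.\<close>

lemma conv_trunc_kernel:
  assumes "0 < \<delta>" "y \<le> b"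
  shows "conv (trunc_kernel \<delta>) h y = conv step (trunc_marchaud \<delta>) y"
proof -
  have step_int: "integrable lborel (\<lambda>x. step (y - x) * h x)"
    by (rule Bochner_Integration.integrable_bound[OF h_integrable])
      (auto simp: step_def)
  have trunc_int: "integrable lborel (\<lambda>x. trunc_kernel \<delta> (y - x) * h x)"
  proof (rule Bochner_Integration.integrable_bound)
    show "integrable lborel (\<lambda>x. half_kernel (y - x) * h x)"
      by (rule half_kernel_times_integrable)
    show "AE x in lborel. norm (trunc_kernel \<delta> (y - x) * h x) \<le> norm (half_kernel (y - x) * h x)"
      using trunc_kernel_bounds[OF assms(1)]
      by (auto intro!: AE_I2 mult_right_mono simp: abs_mult)
  qed simp
  have int2: "integrable lborel (\<lambda>x. conv step (trunc_deriv \<delta>) (y - x) * h x)"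
    unfolding conv_step_trunc_deriv(2)[OF assms(1)]
    using step_int trunc_int by (simp add: left_diff_distrib mult.assoc)
  note assoc = conv_assoc[OF _ _ _ _ _ conv_step_trunc_deriv(1)[OF assms(1)] int2]
  have "conv step (trunc_marchaud \<delta>) y =
      (LINT x|lborel. \<delta> powr (-1/2) * (step (y - x) * h x) - step (y - x) * conv (trunc_deriv \<delta>) h x)"
    unfolding conv_def[of step]
    by (intro Bochner_Integration.integral_cong)
     (use assms trunc_marchaud_eq in \<open>auto simp: step_def algebra_simps\<close>)
  also have "\<dots> = \<delta> powr (-1/2) * conv step h y - conv step (conv (trunc_deriv \<delta>) h) y"
    using step_int assoc(2) by (simp add: conv_def[of step])
  also have "conv step (conv (trunc_deriv \<delta>) h) y = conv (conv step (trunc_deriv \<delta>)) h y"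
    by (rule assoc(1)) auto
  also have "\<delta> powr (-1/2) * conv step h y - conv (conv step (trunc_deriv \<delta>)) h y =
     conv (trunc_kernel \<delta>) h y"
    unfolding conv_def[of _ h] conv_step_trunc_deriv(2)[OF assms(1)]
    using step_int trunc_int by (simp add: left_diff_distrib mult.assoc)
  finally show ?thesis ..
qed

text \<open>Passage to the limit in \<open>conv_trunc_kernel\<close>. The truncation is needed
  because without it \<open>h x\<close> and \<open>h s\<close> cannot be separated: each part of the
  Marchaud integral may diverge on the diagonal.\<close>

theorem conv_half_kernel_eq:
  assumes "y \<le> b"
  shows "conv half_kernel h y = conv step (marchaud b h) y"
proof -
  have "(\<lambda>n. conv (trunc_kernel (1 / Suc n)) h y) \<longlonglongrightarrow> conv half_kernel h y"
    unfolding conv_def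
  proof (rule integral_dominated_convergence[where w="\<lambda>x. \<bar>half_kernel (y - x) * h x\<bar>"])
    show "AE x in lborel. (\<lambda>n. trunc_kernel (1 / Suc n) (y - x) * h x) \<longlonglongrightarrow> half_kernel (y - x) * h x"
      by (intro AE_I2 tendsto_mult trunc_kernel_tendsto tendsto_const)
    show "AE x in lborel. norm (trunc_kernel (1 / Suc n) (y - x) * h x) \<le> \<bar>half_kernel (y - x) * h x\<bar>" for n
      using trunc_kernel_bounds[of "1 / Suc n"]
      by (auto intro!: AE_I2 mult_right_mono simp: abs_mult)
  qed (use half_kernel_times_integrable in auto)
  moreover have "(\<lambda>n. conv step (trunc_marchaud (1 / Suc n)) y) \<longlonglongrightarrow> conv step (marchaud b h) y"
    unfolding conv_def
  proof (rule integral_dominated_convergence[where w=bound])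
    show "integrable lborel bound" by (rule bound_integrable)
    show "AE x in lborel. (\<lambda>n. step (y - x) * trunc_marchaud (1 / Suc n) x) \<longlonglongrightarrow>
        step (y - x) * marchaud b h x"
      using AE_inc_integrable
    proof eventually_elim
      case (elim x)
      show ?case
      proof (cases "x \<in> {0<..<b}")
        case True
        have "(\<lambda>n. LINT s|lborel. indicator {..<x - 1 / Suc n} s * marchaud_inc h x s) \<longlonglongrightarrow>
            (LINT s|lborel. marchaud_inc h x s)"
        proof (rule integral_dominated_convergence[where w="\<lambda>s. \<bar>marchaud_inc h x s\<bar>"])
          show "integrable lborel (\<lambda>s. \<bar>marchaud_inc h x s\<bar>)" using elim True by simp
          show "AE s in lborel. (\<lambda>n. indicator {..<x - 1 / Suc n} s * marchaud_inc h x s)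
              \<longlonglongrightarrow> marchaud_inc h x s"
          proof (rule AE_I2)
            fix s
            show "(\<lambda>n. indicator {..<x - 1 / Suc n} s * marchaud_inc h x s) \<longlonglongrightarrow> marchaud_inc h x s"
            proof (cases "s < x")
              case True
              have "(\<lambda>n. 1 / real (Suc n)) \<longlonglongrightarrow> 0"
                using LIMSEQ_inverse_real_of_nat by (simp add: inverse_eq_divide)
              then have "\<forall>\<^sub>F n in sequentially. 1 / real (Suc n) < x - s"
                using True by (intro order_tendstoD) auto
              then have "\<forall>\<^sub>F n in sequentially.
                  indicator {..<x - 1 / Suc n} s * marchaud_inc h x s = marchaud_inc h x s"
                by (rule eventually_mono) (simp add: indicator_def field_simps)
              then show ?thesis
                by (rule tendsto_eventually)
            qed (simp add: marchaud_inc_def)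
          qed
        qed (auto simp: indicator_def)
        then show ?thesis
          unfolding trunc_marchaud_def marchaud_def
          using trunc_kernel_tendsto[of x] True
          by (auto intro!: tendsto_eq_intros simp: half_kernel_def)
      qed (simp add: trunc_marchaud_def marchaud_def)
    qed
    show "AE x in lborel. norm (step (y - x) * trunc_marchaud (1 / Suc n) x) \<le> bound x" for n
      using AE_inc_integrable
    proof eventually_elim
      case (elim x)
      show ?case
      proof (cases "x \<in> {0<..<b}")
        case True
        have "\<bar>LINT s|lborel. indicator {..<x - 1 / Suc n} s * marchaud_inc h x s\<bar> \<le>
          (LINT s|lborel. \<bar>indicator {..<x - 1 / Suc n} s * marchaud_inc h x s\<bar>)"
          by (rule integral_abs_bound)
        also have "\<dots> \<le> (LINT s|lborel. \<bar>marchaud_inc h x s\<bar>)"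
        proof (rule integral_mono)
          show "integrable lborel (\<lambda>s. \<bar>marchaud_inc h x s\<bar>)" using elim True by simp
          then show "integrable lborel (\<lambda>s. \<bar>indicator {..<x - 1 / Suc n} s * marchaud_inc h x s\<bar>)"
            by (rule Bochner_Integration.integrable_bound) (auto simp: indicator_def)
        qed (auto simp: indicator_def)
        finally have 1: "\<bar>LINT s|lborel. indicator {..<x - 1 / Suc n} s * marchaud_inc h x s\<bar> \<le>
            (LINT s|lborel. \<bar>marchaud_inc h x s\<bar>)" .
        have 2: "\<bar>h x * trunc_kernel (1 / Suc n) x\<bar> \<le> M * x powr (-1/2)"
          unfolding abs_mult using h_bounded[of x] trunc_kernel_bounds[of "1 / Suc n" x] True M_nonneg
          by (intro mult_mono) (auto simp: half_kernel_def)
        have "\<bar>trunc_marchaud (1 / Suc n) x\<bar> \<le> bound x"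
          using True 1 2 unfolding trunc_marchaud_def bound_def by simp
        then show ?thesis by (auto simp: step_def)
      qed (simp add: trunc_marchaud_def bound_def)
    qed
  qed auto
  ultimately show ?thesis
    using conv_trunc_kernel[OF _ assms] by (auto intro: LIMSEQ_unique)
qed

end

section \<open>Abel inversion\<close>

lemma conv_step_diff:
  assumes w: "integrable lborel w" and "x \<le> y"
  shows "conv step w y - conv step w x = integral {x..y} w"
proof -
  have int: "integrable lborel (\<lambda>s. step (z - s) * w s)" for z
    by (rule Bochner_Integration.integrable_bound[OF w])
      (use borel_measurable_integrable[OF w] in \<open>auto simp: step_def\<close>)
  have [measurable]: "w \<in> borel_measurable lborel"
    using w by simp
  have "conv step w y - conv step w x = (LINT s|lborel. step (y - s) * w s - step (x - s) * w s)"
    unfolding conv_def using int by simp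
  also have "\<dots> = (LINT s|lborel. indicator {x..y} s *\<^sub>R w s)"
  proof (rule integral_cong_AE)
    show "AE s in lborel. step (y - s) * w s - step (x - s) * w s = indicator {x..y} s *\<^sub>R w s"
      by (rule AE_I'[of "{x, y}"])
        (use \<open>x \<le> y\<close> in \<open>auto simp: step_def indicator_def intro: finite_imp_null_set_lborel\<close>)
  qed (measurable; simp)+
  also have "\<dots> = integral {x..y} w"
    using set_borel_integral_eq_integral(2)[of "{x..y}" w] integrable_mult_indicator[OF _ w, of "{x..y}"]
    by (simp add: set_lebesgue_integral_def set_integrable_def)
  finally show ?thesis .
qed

text \<open>Lebesgue differentiation. The version applied here treats averages over
  \<open>[x, x + h]\<close>; applying it to \<open>w (- x)\<close> as well supplies the averages to
  the left of \<open>x\<close>, and the two exceptional sets are joined.\<close>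

theorem AE_conv_step_has_derivative:
  assumes w: "integrable lborel w"
  shows "AE x in lborel. (conv step w has_real_derivative w x) (at x)"
proof -
  have 1: "w integrable_on cbox a b" for a b :: real
    using integrable_on_lborel[OF w] integrable_on_subcbox by blast
  have "integrable lborel (\<lambda>x. w (- x))"
    using lborel_integrable_real_affine[OF w, of "-1" 0] by simp
  then have 2: "(\<lambda>x. w (- x)) integrable_on cbox a b" for a b :: real
    using integrable_on_lborel integrable_on_subcbox by blast
  obtain N where N: "negligible N" "\<And>x e. \<lbrakk>x \<notin> N; 0 < e\<rbrakk> \<Longrightarrow> \<exists>d>0. \<forall>h. 0 < h \<and> h < d \<longrightarrow>
      norm (integral (cbox x (x + h *\<^sub>R One)) w /\<^sub>R h ^ DIM(real) - w x) < e"
    using integrable_ccontinuous_explicit[OF 1] by blast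
  obtain N' where N': "negligible N'" "\<And>x e. \<lbrakk>x \<notin> N'; 0 < e\<rbrakk> \<Longrightarrow> \<exists>d>0. \<forall>h. 0 < h \<and> h < d \<longrightarrow>
      norm (integral (cbox x (x + h *\<^sub>R One)) (\<lambda>x. w (- x)) /\<^sub>R h ^ DIM(real) - w (- x)) < e"
    using integrable_ccontinuous_explicit[OF 2] by blast
  have "negligible (uminus ` N')"
    by (rule negligible_differentiable_image_negligible[OF _ N'(1)])
      (auto intro!: derivative_intros differentiable_on_minus)
  then have "N \<union> uminus ` N' \<in> null_sets lebesgue"
    using N(1) negligible_Un negligible_iff_null_sets by blast
  then have "AE x in lborel. x \<notin> N \<union> uminus ` N'"
    by (metis AE_completion_iff AE_not_in)
  then show ?thesis
  proof eventually_elim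
    case (elim x)
    then have x: "x \<notin> N" "- x \<notin> N'" by force+
    show ?case
      unfolding DERIV_def
    proof (rule LIM_I)
      fix r :: real assume "0 < r"
      from N(2)[OF x(1) this] obtain d1 where d1: "d1 > 0"
        "\<And>h. \<lbrakk>0 < h; h < d1\<rbrakk> \<Longrightarrow> \<bar>integral {x..x + h} w / h - w x\<bar> < r"
        by (auto simp: divide_inverse mult.commute)
      from N'(2)[OF x(2) \<open>0 < r\<close>] obtain d2 where d2: "d2 > 0"
        "\<And>h. \<lbrakk>0 < h; h < d2\<rbrakk> \<Longrightarrow> \<bar>integral {- x..- x + h} (\<lambda>x. w (- x)) / h - w x\<bar> < r"
        by (auto simp: divide_inverse mult.commute)
      have "\<bar>(conv step w (x + h) - conv step w x) / h - w x\<bar> < r" if "h \<noteq> 0" "\<bar>h\<bar> < min d1 d2" for h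
      proof (cases "0 < h")
        case True
        then show ?thesis
          using d1(2)[of h] conv_step_diff[OF w, of x "x + h"] that by simp
      next
        case False
        have "integral {- x..- (x + h)} (\<lambda>x. w (- x)) = integral {x + h..x} w"
          by (rule Henstock_Kurzweil_Integration.integral_reflect_real)
        also have "\<dots> = - (conv step w (x + h) - conv step w x)"
          using conv_step_diff[OF w, of "x + h" x] False by simp
        finally have "integral {- x..- x + (- h)} (\<lambda>x. w (- x)) = - (conv step w (x + h) - conv step w x)"
          by simp
        then show ?thesis
          using d2(2)[of "- h"] that False by (simp add: diff_divide_distrib)
      qed
      then show "\<exists>s>0. \<forall>h. h \<noteq> 0 \<and> norm (h - 0) < s \<longrightarrow>
          norm ((conv step w (x + h) - conv step w x) / h - w x) < r"
        using d1(1) d2(1) by (intro exI[of _ "min d1 d2"]) auto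
    qed
  qed
qed

lemma AE_eq_0_if_conv_step_eq_0:
  assumes u: "integrable lborel u" and zero: "\<And>z. z < b \<Longrightarrow> conv step u z = 0"
  shows "AE z in lborel. z < b \<longrightarrow> u z = 0"
  using AE_conv_step_has_derivative[OF u]
proof eventually_elim
  case (elim z)
  show ?case
  proof
    assume "z < b"
    then have "((\<lambda>_. 0) has_real_derivative u z) (at z)"
      using elim zero
      by (auto intro: has_field_derivative_transform_within_open[of _ _ _ "{..<b}"])
    then show "u z = 0"
      using DERIV_const DERIV_unique by blast
  qed
qed

text \<open>Allows an identity known only up to \<open>b\<close>, such as
  \<open>conv_half_kernel_eq\<close>, to be substituted inside a convolution evaluated at a point
  below \<open>b\<close>.\<close>

lemma conv_causal:
  assumes "\<And>x. x \<le> 0 \<Longrightarrow> f x = 0" "\<And>y. y \<le> z \<Longrightarrow> g y = g' y"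
  shows "conv f g z = conv f g' z"
  unfolding conv_def
proof (rule Bochner_Integration.integral_cong)
  show "f (z - y) * g y = f (z - y) * g' y" for y
    using assms(1)[of "z - y"] assms(2)[of y] by (cases "y \<le> z") auto
qed simp

lemma step_half_kernel_le:
  assumes "x \<ge> 0"
  shows "conv step half_kernel (z - x) \<le> 2 * \<bar>z\<bar> powr (1/2)"
  using assms by (auto simp: conv_step_half_kernel intro!: powr_mono2)

context besov_function begin

lemma marchaud_support: "x \<notin> {0<..<b} \<Longrightarrow> marchaud b h x = 0"
  by (simp add: marchaud_def)

lemma step_half_kernel_marchaud_integrable:
  "integrable lborel (\<lambda>x. conv step half_kernel (z - x) * marchaud b h x)"
proof (rule Bochner_Integration.integrable_bound)
  show "integrable lborel (\<lambda>x. (2 * \<bar>z\<bar> powr (1/2)) * marchaud b h x)"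
    by (intro integrable_mult_right marchaud_integrable)
  show "AE x in lborel. norm (conv step half_kernel (z - x) * marchaud b h x) \<le>
      norm ((2 * \<bar>z\<bar> powr (1/2)) * marchaud b h x)"
  proof (rule AE_I2)
    fix x
    show "norm (conv step half_kernel (z - x) * marchaud b h x) \<le>
      norm ((2 * \<bar>z\<bar> powr (1/2)) * marchaud b h x)"
    proof (cases "x \<in> {0<..<b}")
      case True
      have "0 \<le> conv step half_kernel (z - x)"
        by (simp add: conv_step_half_kernel)
      with True show ?thesis
        using step_half_kernel_le[of x z] by (auto simp: abs_mult intro!: mult_right_mono)
    qed (simp add: marchaud_support)
  qed
qed simp

text \<open>Both iterated convolutions equal the convolution with
  \<open>conv step half_kernel\<close>, whose kernel is bounded where it meets the support of the
  integrable Marchaud derivative.\<close>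

lemma conv_step_conv_half_kernel_marchaud:
  shows "conv step (conv half_kernel (marchaud b h)) z = conv half_kernel (conv step (marchaud b h)) z"
    and "integrable lborel (\<lambda>y. step (z - y) * conv half_kernel (marchaud b h) y)"
proof -
  have commute: "conv half_kernel step = conv step half_kernel"
    using conv_commute by blast
  have "conv step (conv half_kernel (marchaud b h)) z = conv (conv step half_kernel) (marchaud b h) z"
    by (rule conv_assoc)
      (auto intro: conv_step_half_kernel step_half_kernel_marchaud_integrable)
  also have "\<dots> = conv (conv half_kernel step) (marchaud b h) z"
    by (simp add: commute)
  also have "\<dots> = conv half_kernel (conv step (marchaud b h)) z"
    by (rule conv_assoc(1)[symmetric])
      (use conv_integrable_commute[OF conv_step_half_kernel(1)] step_half_kernel_marchaud_integrable
        in \<open>auto simp: commute\<close>)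
  finally show "conv step (conv half_kernel (marchaud b h)) z = conv half_kernel (conv step (marchaud b h)) z" .
  show "integrable lborel (\<lambda>y. step (z - y) * conv half_kernel (marchaud b h) y)"
    by (rule conv_assoc)
      (auto intro: conv_step_half_kernel step_half_kernel_marchaud_integrable)
qed

lemma step_h_integrable: "integrable lborel (\<lambda>x. step (y - x) * h x)"
  by (rule Bochner_Integration.integrable_bound[OF h_integrable]) (auto simp: step_def)

text \<open>With \<open>c\<close> the kernel and \<open>w\<close> the Marchaud derivative,
  integrating once gives \<open>step * (c * w) = c * (step * w) = c * (c * h) = pi * (step *
  h)\<close> as convolutions below \<open>b\<close>. Differentiation almost everywhere removes
  \<open>step\<close>.\<close>

lemma abel_inversion:
  "AE z in lborel. z < b \<longrightarrow> conv half_kernel (marchaud b h) z = pi * h z"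
proof -
  \<comment> \<open>The factor \<open>step (b - z)\<close> makes \<open>u\<close> integrable: beyond
    \<open>b\<close> the convolution of the kernel with a function supported in
    \<open>(0, b)\<close> decays in general only like the inverse square root.\<close>
  define u where "u z = step (b - z) * (pi * h z - conv half_kernel (marchaud b h) z)" for z
  have u: "integrable lborel u"
    unfolding u_def right_diff_distrib
    using conv_step_conv_half_kernel_marchaud(2)[of b] step_h_integrable[of b]
    by (auto simp: mult.left_commute[of _ pi])
  have "conv step u z = 0" if "z < b" for z
  proof -
    have "conv step u z = (LINT y|lborel. pi * (step (z - y) * h y) - step (z - y) * conv half_kernel (marchaud b h) y)"
      unfolding conv_def[of step] u_def
      by (rule Bochner_Integration.integral_cong) (use that in \<open>auto simp: step_def algebra_simps\<close>)
    also have "\<dots> = pi * conv step h z - conv step (conv half_kernel (marchaud b h)) z"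
      unfolding conv_def[of step] using step_h_integrable conv_step_conv_half_kernel_marchaud(2)
      by simp
    also have "conv step (conv half_kernel (marchaud b h)) z = conv half_kernel (conv step (marchaud b h)) z"
      by (rule conv_step_conv_half_kernel_marchaud)
    also have "\<dots> = conv half_kernel (conv half_kernel h) z"
      by (rule conv_causal) (use that conv_half_kernel_eq in \<open>auto simp: half_kernel_def\<close>)
    also have "\<dots> = conv (conv half_kernel half_kernel) h z"
      by (rule conv_assoc) (use conv_half_kernel_half_kernel step_h_integrable in \<open>auto simp: mult.assoc\<close>)
    also have "\<dots> = pi * conv step h z"
      by (simp add: conv_def[of _ h] conv_half_kernel_half_kernel mult.assoc)
    finally show ?thesis by simp
  qed
  then have "AE z in lborel. z < b \<longrightarrow> u z = 0"
    by (rule AE_eq_0_if_conv_step_eq_0[OF u])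
  then show ?thesis
    by eventually_elim (auto simp: u_def step_def)
qed

lemma AE_conv_half_kernel_has_derivative:
  "AE x in lborel. x < b \<longrightarrow> (conv half_kernel h has_real_derivative marchaud b h x) (at x)"
  using AE_conv_step_has_derivative[OF marchaud_integrable]
proof eventually_elim
  case (elim x)
  show ?case
  proof
    assume "x < b"
    then show "(conv half_kernel h has_real_derivative marchaud b h x) (at x)"
      using elim conv_half_kernel_eq
      by (auto intro: has_field_derivative_transform_within_open[of "conv step (marchaud b h)" _ _ "{..<b}"])
  qed
qed

end

section \<open>Integration against a Hoelder function\<close>

lemma lborel_shift_reflect:
  fixes f :: "real \<Rightarrow> real"
  shows "(LINT x|lborel. f x) = (LINT x|lborel. f (t - x))"
  using lborel_integral_real_affine[of "-1" f t] by simp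

lemma has_bochner_integral_powr_reflect:
  fixes x :: real
  assumes "-1 < a"
  shows "has_bochner_integral lborel (\<lambda>s. indicator {0<..<x} s * (x - s) powr a)
           (max 0 x powr (a + 1) / (a + 1))"
proof -
  have "has_bochner_integral lborel (\<lambda>s. indicator {0<..<max 0 x} s * s powr a) (max 0 x powr (a + 1) / (a + 1))"
    by (rule has_bochner_integral_powr_from_0) (use assms in auto)
  then have "has_bochner_integral lborel (\<lambda>s. indicator {0<..<max 0 x} (x + (-1) * s) * (x + (-1) * s) powr a)
      ((max 0 x powr (a + 1) / (a + 1)) /\<^sub>R \<bar>-1\<bar>)"
    by (subst lborel_has_bochner_integral_real_affine_iff[symmetric]) auto
  moreover have eq: "indicator {0<..<max 0 x} (x + (-1) * s) * (x + (-1) * s) powr a =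
      indicator {0<..<x} s * (x - s) powr a" for s
    by (auto simp: indicator_def)
  ultimately show ?thesis unfolding eq by simp
qed

lemma AE_lborel_reflect:
  assumes "AE x in lborel. P (x :: real)"
  shows "AE x in lborel. P (t - x)"
proof -
  obtain N where N: "{x \<in> space lborel. \<not> P x} \<subseteq> N" "N \<in> null_sets lborel"
    using assms unfolding eventually_ae_filter by blast
  then have [measurable]: "N \<in> sets borel" by auto
  have "AE x in lborel. t + - 1 * x \<notin> N"
    by (rule AE_borel_affine[OF _ _ AE_not_in[OF N(2)]]) auto
  then show ?thesis
    by eventually_elim (use N(1) in auto)
qed

lemma marchaud_inc_hoelder:
  assumes hoelder: "\<And>x y. x \<in> {0<..<b} \<Longrightarrow> y \<in> {0<..<b} \<Longrightarrow> \<bar>h x - h y\<bar> \<le> C * \<bar>x - y\<bar> powr \<gamma>"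
    and x: "x \<in> {0<..<b}"
  shows "\<bar>marchaud_inc h x s\<bar> \<le> C * (indicator {0<..<x} s * (x - s) powr (\<gamma> - 3/2))"
proof (cases "s \<in> {0<..<x}")
  case True
  have "\<bar>h x - h s\<bar> * (x - s) powr (-3/2) \<le> (C * (x - s) powr \<gamma>) * (x - s) powr (-3/2)"
    using hoelder[of x s] True x by (intro mult_right_mono) auto
  also have "\<dots> = C * (x - s) powr (\<gamma> - 3/2)"
    by (simp flip: powr_add)
  finally show ?thesis using True by (simp add: marchaud_inc_def abs_mult)
qed (simp add: marchaud_inc_def)

text \<open>The majorant \<open>(x - s) powr (\<gamma> - 3/2)\<close> has exponent above -1, and its
  integral over \<open>s\<close> is bounded for \<open>x\<close> in \<open>(0, b)\<close>. The
  Hoelder case thus yields a uniform bound and not only integrability.\<close>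

lemma
  assumes [measurable]: "h \<in> borel_measurable borel"
    and hoelder: "\<And>x y. x \<in> {0<..<b} \<Longrightarrow> y \<in> {0<..<b} \<Longrightarrow> \<bar>h x - h y\<bar> \<le> C * \<bar>x - y\<bar> powr \<gamma>"
    and \<gamma>: "1/2 < \<gamma>" and b: "0 < b"
  shows marchaud_inc_hoelder_integrable:
      "integrable (lborel \<Otimes>\<^sub>M lborel) (\<lambda>(x, s). indicator {0<..<b} x * marchaud_inc h x s)"
    and marchaud_inc_hoelder_bound: "x \<in> {0<..<b} \<Longrightarrow>
      (LINT s|lborel. \<bar>marchaud_inc h x s\<bar>) \<le> C * (b powr (\<gamma> - 1/2) / (\<gamma> - 1/2))"
proof -
  have C: "0 \<le> C"
  proof -
    have "0 \<le> \<bar>h (b/2) - h (b/4)\<bar>" by simp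
    also have "\<dots> \<le> C * \<bar>b/2 - b/4\<bar> powr \<gamma>" using b by (intro hoelder) auto
    finally show ?thesis using b by (auto simp: zero_le_mult_iff)
  qed
  have maj: "has_bochner_integral lborel (\<lambda>s. indicator {0<..<x} s * (x - s) powr (\<gamma> - 3/2))
      (max 0 x powr (\<gamma> - 1/2) / (\<gamma> - 1/2))" for x
    using has_bochner_integral_powr_reflect[of "\<gamma> - 3/2" x] \<gamma> by (simp add: algebra_simps)
  have int: "integrable lborel (marchaud_inc h x)" if "x \<in> {0<..<b}" for x
  proof (rule Bochner_Integration.integrable_bound)
    show "integrable lborel (\<lambda>s. C * (indicator {0<..<x} s * (x - s) powr (\<gamma> - 3/2)))"
      using maj[of x] by (intro integrable_mult_right) (simp add: has_bochner_integral_iff)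
    show "AE s in lborel. norm (marchaud_inc h x s) \<le>
        norm (C * (indicator {0<..<x} s * (x - s) powr (\<gamma> - 3/2)))"
      using marchaud_inc_hoelder[OF hoelder that] by (intro AE_I2) (auto intro: order_trans[OF _ abs_ge_self])
  qed simp
  show le: "(LINT s|lborel. \<bar>marchaud_inc h x s\<bar>) \<le> C * (b powr (\<gamma> - 1/2) / (\<gamma> - 1/2))" if "x \<in> {0<..<b}" for x
  proof -
    have "(LINT s|lborel. \<bar>marchaud_inc h x s\<bar>) \<le>
        (LINT s|lborel. C * (indicator {0<..<x} s * (x - s) powr (\<gamma> - 3/2)))"
      using int[OF that] maj[of x] marchaud_inc_hoelder[OF hoelder that]
      by (intro integral_mono) (auto simp: has_bochner_integral_iff)
    also have "\<dots> = C * (x powr (\<gamma> - 1/2) / (\<gamma> - 1/2))"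
      using maj[of x] that by (simp add: has_bochner_integral_iff)
    also have "\<dots> \<le> C * (b powr (\<gamma> - 1/2) / (\<gamma> - 1/2))"
      using that \<gamma> C by (intro mult_left_mono divide_right_mono powr_mono2) auto
    finally show ?thesis .
  qed
  show "integrable (lborel \<Otimes>\<^sub>M lborel) (\<lambda>(x, s). indicator {0<..<b} x * marchaud_inc h x s)"
  proof (rule lborel_pair.Fubini_integrable)
    show "integrable lborel (\<lambda>x. LINT s|lborel. norm (case (x, s) of (x, s) \<Rightarrow> indicator {0<..<b} x * marchaud_inc h x s))"
    proof (rule Bochner_Integration.integrable_bound)
      show "integrable lborel (\<lambda>x. indicator {0<..<b} x * (C * (b powr (\<gamma> - 1/2) / (\<gamma> - 1/2))))"
        using b by (intro integrable_mult_left integrable_real_indicator) auto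
      show "AE x in lborel. norm (LINT s|lborel. norm (case (x, s) of (x, s) \<Rightarrow> indicator {0<..<b} x * marchaud_inc h x s)) \<le>
          norm (indicator {0<..<b} x * (C * (b powr (\<gamma> - 1/2) / (\<gamma> - 1/2))))"
        using le C \<gamma> by (intro AE_I2) (auto simp: indicator_def abs_mult)
    qed simp
    show "AE x in lborel. integrable lborel (\<lambda>s. case (x, s) of (x, s) \<Rightarrow> indicator {0<..<b} x * marchaud_inc h x s)"
      using int by (auto simp: indicator_def)
  qed simp
qed

lemma conv_step_lipschitz:
  assumes w: "integrable lborel w" and bound: "\<And>x. \<bar>w x\<bar> \<le> L"
  shows "\<bar>conv step w y - conv step w x\<bar> \<le> L * \<bar>y - x\<bar>"
proof -
  have *: "\<bar>conv step w y - conv step w x\<bar> \<le> L * (y - x)" if "x \<le> y" for x y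
  proof -
    have "w integrable_on {x..y}"
      using integrable_on_lborel[OF w] integrable_on_subcbox[of w UNIV x y] by auto
    then have "norm (integral {x..y} w) \<le> integral {x..y} (\<lambda>_. L)"
      by (rule integral_norm_bound_integral) (use bound in auto)
    then show ?thesis
      using that by (simp add: conv_step_diff[OF w that] mult.commute)
  qed
  show ?thesis
    using *[of x y] *[of y x] by (cases "x \<le> y") auto
qed

text \<open>In the application \<open>k x\<close> is \<open>g t - g x\<close>, continued by 0 to the
  right of \<open>t\<close> so that shifted arguments make sense. A single constant \<open>C\<close>
  serves as bound and as Hoelder constant.\<close>

locale hoelder_integrator = besov_function t M h for t M h +
  fixes k :: "real \<Rightarrow> real" and C \<gamma> :: real
  assumes \<gamma>: "1/2 < \<gamma>"
    and k_zero: "\<And>x. t \<le> x \<Longrightarrow> k x = 0"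
    and k_bounded: "\<And>x. \<bar>k x\<bar> \<le> C"
    and k_hoelder: "\<And>x y. \<bar>k x - k y\<bar> \<le> C * \<bar>x - y\<bar> powr \<gamma>"
    and k_measurable [measurable]: "k \<in> borel_measurable borel"
begin

text \<open>Reflection at \<open>t\<close> turns the right-sided derivative into a left-sided one.
  The interval has length \<open>t + 1\<close> rather than \<open>t\<close> so that the arguments
  \<open>t - y - e\<close> with \<open>\<bar>e\<bar> < 1\<close> stay in the range where
  \<open>conv_half_kernel_eq\<close> applies.\<close>

definition reflected :: "real \<Rightarrow> real" where
  "reflected x = indicator {0<..<t + 1} x * k (t - x)"

lemma C_nonneg: "0 \<le> C" using k_bounded[of 0] by linarith

lemma reflected_measurable [measurable]: "reflected \<in> borel_measurable borel"
  unfolding reflected_def by measurable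

lemma reflected_hoelder: "x \<in> {0<..<t + 1} \<Longrightarrow> y \<in> {0<..<t + 1} \<Longrightarrow> \<bar>reflected x - reflected y\<bar> \<le> C * \<bar>x - y\<bar> powr \<gamma>"
  using k_hoelder[of "t - x" "t - y"] by (simp add: reflected_def abs_minus_commute)

lemma reflected_eq: "x < t + 1 \<Longrightarrow> reflected x = k (t - x)"
  using k_zero[of "t - x"] by (auto simp: reflected_def indicator_def)

sublocale reflected: besov_function "t + 1" C reflected
proof
  show "0 < t + 1" using b_pos by simp
  show "\<bar>reflected x\<bar> \<le> C" for x using k_bounded[of "t - x"] C_nonneg by (auto simp: reflected_def indicator_def)
  show "integrable (lborel \<Otimes>\<^sub>M lborel) (\<lambda>(x, s). indicator {0<..<t + 1} x * marchaud_inc reflected x s)"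
    by (rule marchaud_inc_hoelder_integrable[OF _ reflected_hoelder \<gamma>]) (use b_pos in auto)
qed (auto simp: reflected_def)

definition L :: real where
  "L = C * (t + 1) powr (\<gamma> - 1/2) + 1 / 2 * (C * ((t + 1) powr (\<gamma> - 1/2) / (\<gamma> - 1/2)))"

lemma L_nonneg: "0 \<le> L"
  using C_nonneg \<gamma> by (simp add: L_def)

text \<open>Since \<open>reflected\<close> vanishes at 0, the Hoelder condition beats the singular
  factor \<open>x powr (-1/2)\<close> as well. Boundedness makes
  \<open>conv half_kernel reflected\<close> Lipschitz up to \<open>t + 1\<close>.\<close>

lemma marchaud_reflected_bounded: "\<bar>marchaud (t + 1) reflected x\<bar> \<le> L"
proof (cases "x \<in> {0<..<t + 1}")
  case True
  have 1: "\<bar>LINT s|lborel. marchaud_inc reflected x s\<bar> \<le> C * ((t + 1) powr (\<gamma> - 1/2) / (\<gamma> - 1/2))"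
    by (rule order_trans[OF integral_abs_bound marchaud_inc_hoelder_bound[OF _ reflected_hoelder \<gamma> _ True]])
      (use b_pos in auto)
  have "\<bar>reflected x * x powr (-1/2)\<bar> \<le> (C * x powr \<gamma>) * x powr (-1/2)"
    unfolding abs_mult using k_hoelder[of "t - x" t] True k_zero[of t]
    by (intro mult_mono) (auto simp: reflected_eq C_nonneg)
  also have "\<dots> = C * x powr (\<gamma> - 1/2)"
    by (simp flip: powr_add)
  also have "\<dots> \<le> C * (t + 1) powr (\<gamma> - 1/2)"
    using True C_nonneg \<gamma> by (intro mult_left_mono powr_mono2) auto
  finally have 2: "\<bar>reflected x * x powr (-1/2)\<bar> \<le> C * (t + 1) powr (\<gamma> - 1/2)" .
  have "\<bar>reflected x * x powr (-1/2) + 1 / 2 * (LINT s|lborel. marchaud_inc reflected x s)\<bar> \<le> L"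
    using 1 2 unfolding L_def by linarith
  then show ?thesis
    using True by (simp add: marchaud_def)
qed (simp add: marchaud_def L_nonneg)

lemma conv_reflected_lipschitz:
  assumes "x \<le> t + 1" "y \<le> t + 1"
  shows "\<bar>conv half_kernel reflected y - conv half_kernel reflected x\<bar> \<le> L * \<bar>y - x\<bar>"
  using conv_step_lipschitz[OF reflected.marchaud_integrable marchaud_reflected_bounded, of y x] assms
  by (simp add: reflected.conv_half_kernel_eq)

text \<open>What the difference quotient of \<open>k\<close> becomes when Fubini moves it onto the
  kernel. After reflection it is a difference quotient of \<open>conv half_kernel reflected\<close>,
  up to \<open>rest\<close>.\<close>

definition quot :: "real \<Rightarrow> real \<Rightarrow> real" where
  "quot e y = (LINT x|lborel. step (t - x) * half_kernel (x - y) * (k x - k (x + e))) / e"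

text \<open>For negative \<open>e\<close> the shift carries the boundary point \<open>t\<close> into
  the domain; this is the strip between old and new boundary. For positive \<open>e\<close> the
  strip is empty.\<close>

definition rest :: "real \<Rightarrow> real \<Rightarrow> real" where
  "rest e y = (LINT x|lborel. indicator {0<..- e} x * (half_kernel (t - y - e - x) * reflected x))"

text \<open>On the strip \<open>reflected\<close> is at most
  \<open>C * \<bar>e\<bar> powr \<gamma>\<close>, because it vanishes at 0, and the kernel has mass
  at most \<open>2 * \<bar>e\<bar> powr (1/2)\<close>. The total exponent exceeds 1, so the strip
  does not influence the limit of the quotients.\<close>

lemma rest_bound:
  assumes y: "y < t" and e: "- 1 < e" "e < 1"
  shows "\<bar>rest e y\<bar> \<le> 2 * C * \<bar>e\<bar> powr (\<gamma> + 1/2)"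
proof (cases "e < 0")
  case True
  have maj: "has_bochner_integral lborel (\<lambda>x. indicator {0<..<- e} x * (- e - x) powr (-1/2)) (2 * \<bar>e\<bar> powr (1/2))"
    using has_bochner_integral_powr_reflect[of "-1/2" "-e"] True by (simp add: mult.commute)
  have "\<bar>rest e y\<bar> \<le> (LINT x|lborel. \<bar>indicator {0<..- e} x * (half_kernel (t - y - e - x) * reflected x)\<bar>)"
    unfolding rest_def by (rule integral_abs_bound)
  also have "\<dots> \<le> (LINT x|lborel. (C * \<bar>e\<bar> powr \<gamma>) * (indicator {0<..<- e} x * (- e - x) powr (-1/2)))"
  proof (rule integral_mono_AE)
    show "integrable lborel (\<lambda>x. (C * \<bar>e\<bar> powr \<gamma>) * (indicator {0<..<- e} x * (- e - x) powr (-1/2)))"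
      using maj by (intro integrable_mult_right) (simp add: has_bochner_integral_iff)
    have "integrable lborel (\<lambda>x. indicator {0<..- e} x *\<^sub>R (half_kernel (t - y - e - x) * reflected x))"
      by (rule integrable_mult_indicator[OF _ reflected.half_kernel_times_integrable]) auto
    then show "integrable lborel (\<lambda>x. \<bar>indicator {0<..- e} x * (half_kernel (t - y - e - x) * reflected x)\<bar>)"
      by simp
    have "AE x in lborel. x \<noteq> - e"
      by (rule AE_I'[of "{-e}"]) (auto intro: finite_imp_null_set_lborel)
    then show "AE x in lborel. \<bar>indicator {0<..- e} x * (half_kernel (t - y - e - x) * reflected x)\<bar> \<le>
        (C * \<bar>e\<bar> powr \<gamma>) * (indicator {0<..<- e} x * (- e - x) powr (-1/2))"
    proof eventually_elim
      case (elim x)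
      show ?case
      proof (cases "x \<in> {0<..<- e}")
        case True
        have "\<bar>reflected x\<bar> \<le> C * x powr \<gamma>"
          using k_hoelder[of "t - x" t] True k_zero[of t] e b_pos by (simp add: reflected_eq)
        also have "\<dots> \<le> C * \<bar>e\<bar> powr \<gamma>"
          using True C_nonneg \<gamma> by (intro mult_left_mono powr_mono2) auto
        finally have 1: "\<bar>reflected x\<bar> \<le> C * \<bar>e\<bar> powr \<gamma>" .
        have 2: "half_kernel (t - y - e - x) \<le> (- e - x) powr (-1/2)"
          using True y by (auto simp: half_kernel_def intro!: powr_mono2')
        have "\<bar>reflected x\<bar> * half_kernel (t - y - e - x) \<le> (C * \<bar>e\<bar> powr \<gamma>) * (- e - x) powr (-1/2)"
          using 1 2 by (intro mult_mono) (use C_nonneg in auto)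
        then show ?thesis using True by (simp add: abs_mult mult.commute)
      qed (use elim in auto)
    qed
  qed
  also have "\<dots> = (C * \<bar>e\<bar> powr \<gamma>) * (2 * \<bar>e\<bar> powr (1/2))"
    using maj by (simp add: has_bochner_integral_iff)
  also have "\<dots> = 2 * C * \<bar>e\<bar> powr (\<gamma> + 1/2)"
    by (simp add: powr_add)
  finally show ?thesis .
next
  case False
  then have "{0<..- e} = {}" by simp
  then show ?thesis using C_nonneg by (simp add: rest_def)
qed

lemma quot_eq:
  assumes y: "0 < y" "y < t" and e: "- 1 < e" "e < 1"
  shows "quot e y = (conv half_kernel reflected (t - y) - conv half_kernel reflected (t - y - e) + rest e y) / e"
proof -
  have eq1: "step x * half_kernel (t - y - x) * k (t - x) = half_kernel (t - y - x) * reflected x" for x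
    using y reflected_eq[of x] k_zero[of "t - x"]
    by (cases "x < t + 1") (auto simp: step_def half_kernel_def)
  \<comment> \<open>\<open>step x\<close> demands that the shifted argument \<open>x - e\<close>
    exceed \<open>- e\<close>. The subtracted term removes the arguments in \<open>(0, - e]\<close>;
    for arguments below 0 \<open>reflected\<close> vanishes already.\<close>
  have eq2: "step x * half_kernel (t - y - x) * k (t - x + e) =
     half_kernel (t - y - x) * reflected (x - e) -
     indicator {0<..- e} (x - e) * (half_kernel (t - y - x) * reflected (x - e))" for x
  proof (cases "half_kernel (t - y - x) = 0")
    case False
    then have "x < t - y" by (simp add: half_kernel_def split: if_splits)
    then have *: "reflected (x - e) = k (t - x + e)"
      using y e by (subst reflected_eq) (auto simp: algebra_simps)
    show ?thesis
    proof (cases "0 < - e + x")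
      case True
      then show ?thesis using y e k_zero[of "t - x + e"] by (auto simp: * step_def algebra_simps indicator_def)
    next
      case False
      then show ?thesis
        using k_zero[of "t - x + e"] by (simp add: *)
    qed
  qed simp
  have i1: "integrable lborel (\<lambda>x. half_kernel (z - x) * reflected x)" for z
    by (rule reflected.half_kernel_times_integrable)
  have i2: "integrable lborel (\<lambda>x. indicator {0<..- e} x * (half_kernel (t - y - e - x) * reflected x))"
    using integrable_mult_indicator[OF _ i1, of "{0<..- e}" "t - y - e"] by simp
  define q where "q x = half_kernel (t - y - e - x) * reflected x -
      indicator {0<..- e} x * (half_kernel (t - y - e - x) * reflected x)" for x
  have q: "integrable lborel q" "(LINT x|lborel. q x) = conv half_kernel reflected (t - y - e) - rest e y"
    unfolding q_def rest_def conv_def using i1 i2 by auto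
  have q': "integrable lborel (\<lambda>x. q (- e + 1 * x))"
    by (rule lborel_integrable_real_affine[OF q(1)]) simp
  have q'': "(LINT x|lborel. q (- e + 1 * x)) = (LINT x|lborel. q x)"
    using lborel_integral_real_affine[of 1 q "-e"] by simp
  have "(LINT x|lborel. step (t - x) * half_kernel (x - y) * (k x - k (x + e))) =
      (LINT x|lborel. step x * half_kernel (t - y - x) * (k (t - x) - k (t - x + e)))"
    by (subst lborel_shift_reflect[of _ t]) (simp add: algebra_simps)
  also have "\<dots> = (LINT x|lborel. half_kernel (t - y - x) * reflected x - q (- e + 1 * x))"
  proof (intro Bochner_Integration.integral_cong refl)
    fix x
    have "q (- e + 1 * x) = step x * half_kernel (t - y - x) * k (t - x + e)"
    proof -
      have r: "- e + 1 * x = x - e" "t - y - e - (x - e) = t - y - x" by simp_all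
      show ?thesis unfolding eq2 q_def r ..
    qed
    then show "step x * half_kernel (t - y - x) * (k (t - x) - k (t - x + e)) =
        half_kernel (t - y - x) * reflected x - q (- e + 1 * x)"
      by (simp only: eq1[symmetric] right_diff_distrib)
  qed
  also have "\<dots> = conv half_kernel reflected (t - y) - (conv half_kernel reflected (t - y - e) - rest e y)"
    using i1 q' q q'' by (simp add: conv_def)
  finally show ?thesis by (simp add: quot_def)
qed

text \<open>The uniform bound for dominated convergence: the Lipschitz constant \<open>L\<close> for
  the quotient itself, and \<open>2 * C\<close> for \<open>rest\<close>, since
  \<open>\<bar>e\<bar> powr (\<gamma> + 1/2) \<le> \<bar>e\<bar>\<close> when
  \<open>\<bar>e\<bar> < 1\<close>.\<close>

lemma quot_bound:
  assumes y: "0 < y" "y < t" and e: "- 1 < e" "e < 1" "e \<noteq> 0"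
  shows "\<bar>quot e y\<bar> \<le> L + 2 * C"
proof -
  have "\<bar>rest e y\<bar> \<le> 2 * C * \<bar>e\<bar> powr (\<gamma> + 1/2)"
    using rest_bound y e by blast
  also have "\<dots> \<le> 2 * C * \<bar>e\<bar> powr 1"
    using e \<gamma> C_nonneg by (intro mult_left_mono powr_mono') auto
  finally have "\<bar>rest e y\<bar> \<le> 2 * C * \<bar>e\<bar>" using e by simp
  moreover have "\<bar>conv half_kernel reflected (t - y) - conv half_kernel reflected (t - y - e)\<bar> \<le> L * \<bar>e\<bar>"
    using conv_reflected_lipschitz[of "t - y - e" "t - y"] y e by simp
  ultimately have "\<bar>conv half_kernel reflected (t - y) - conv half_kernel reflected (t - y - e) + rest e y\<bar> \<le> (L + 2 * C) * \<bar>e\<bar>"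
    by (simp add: algebra_simps)
  then show ?thesis
    using e by (simp add: quot_eq[OF y e(1,2)] field_simps)
qed

lemma AE_quot_tendsto:
  "AE y in lborel. y \<in> {0<..<t} \<longrightarrow> ((\<lambda>e. quot e y) \<longlongrightarrow> marchaud (t + 1) reflected (t - y)) (at 0)"
proof -
  have "AE y in lborel. t - y < t + 1 \<longrightarrow>
      (conv half_kernel reflected has_real_derivative marchaud (t + 1) reflected (t - y)) (at (t - y))"
    by (rule AE_lborel_reflect[OF reflected.AE_conv_half_kernel_has_derivative])
  then show ?thesis
  proof eventually_elim
    case (elim y)
    show ?case
    proof
      assume y: "y \<in> {0<..<t}"
      then have D: "(conv half_kernel reflected has_real_derivative marchaud (t + 1) reflected (t - y)) (at (t - y))"
        using elim by simp
      have "((\<lambda>e. (conv half_kernel reflected (t - y + e) - conv half_kernel reflected (t - y)) / e) \<longlongrightarrow>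
          marchaud (t + 1) reflected (t - y)) (at 0)"
        using D by (simp add: DERIV_def)
      then have "((\<lambda>e. (conv half_kernel reflected (t - y + (- e)) - conv half_kernel reflected (t - y)) / (- e)) \<longlongrightarrow>
          marchaud (t + 1) reflected (t - y)) (at 0)"
        by (rule filterlim_compose) (auto simp: filterlim_at intro!: tendsto_eq_intros simp: eventually_at_filter)
      moreover have "((\<lambda>e. rest e y / e) \<longlongrightarrow> 0) (at 0)"
      proof (rule Lim_null_comparison)
        show "((\<lambda>e. 2 * C * \<bar>e\<bar> powr (\<gamma> - 1/2)) \<longlongrightarrow> 0) (at 0)"
          using \<gamma> by (auto intro!: tendsto_eq_intros)
        have "\<forall>\<^sub>F e in at (0::real). e \<in> {-1<..<1} - {0}"
          by (rule eventually_at_in_open) auto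
        then show "\<forall>\<^sub>F e in at 0. norm (rest e y / e) \<le> 2 * C * \<bar>e\<bar> powr (\<gamma> - 1/2)"
        proof eventually_elim
          case (elim e)
          then have "\<bar>rest e y\<bar> \<le> 2 * C * \<bar>e\<bar> powr (\<gamma> + 1/2)"
            using rest_bound y by simp
          also have "\<bar>e\<bar> powr (\<gamma> + 1/2) = \<bar>e\<bar> powr (\<gamma> - 1/2) * \<bar>e\<bar>"
            using elim powr_add[of "\<bar>e\<bar>" "\<gamma> - 1/2" 1] by (simp add: add.commute)
          finally show ?case
            using elim by (simp add: pos_divide_le_eq mult.assoc)
        qed
      qed
      ultimately have "((\<lambda>e. (conv half_kernel reflected (t - y + (- e)) - conv half_kernel reflected (t - y)) / (- e) + rest e y / e)
          \<longlongrightarrow> marchaud (t + 1) reflected (t - y) + 0) (at 0)"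
        by (rule tendsto_add)
      moreover have "\<forall>\<^sub>F e in at (0::real). e \<in> {-1<..<1} - {0}"
        by (rule eventually_at_in_open) auto
      then have "\<forall>\<^sub>F e in at 0. (conv half_kernel reflected (t - y + (- e)) - conv half_kernel reflected (t - y)) / (- e) + rest e y / e = quot e y"
        by eventually_elim (use y in \<open>simp add: quot_eq field_simps\<close>)
      ultimately show "((\<lambda>e. quot e y) \<longlongrightarrow> marchaud (t + 1) reflected (t - y)) (at 0)"
        by (simp add: tendsto_cong)
    qed
  qed
qed

text \<open>\<open>h\<close> is replaced by \<open>1 / pi\<close> times the convolution of the
  kernel with its Marchaud derivative, and Fubini then transfers the increments of \<open>k\<close>
  from \<open>h\<close> to the kernel.\<close>

lemma integral_increment_eq:
  shows "(LINT x|lborel. h x * (k x - k (x + e))) / e = 1 / pi * (LINT y|lborel. marchaud t h y * quot e y)"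
proof -
  define P where "P = (\<lambda>(y, x). marchaud t h y * (step (t - x) * half_kernel (x - y) * (k x - k (x + e))))"
  have [measurable]: "P \<in> borel_measurable (lborel \<Otimes>\<^sub>M lborel)"
    unfolding P_def by measurable
  have maj: "integrable lborel (\<lambda>x. step (t - x) * half_kernel (x - y))" for y
    by (rule conv_integrable_shift[OF conv_step_half_kernel(1)])
  have P_le: "\<bar>P (y, x)\<bar> \<le> 2 * C * (\<bar>marchaud t h y\<bar> * (step (t - x) * half_kernel (x - y)))" for x y
  proof -
    have "\<bar>k x - k (x + e)\<bar> \<le> 2 * C"
      using k_bounded[of x] k_bounded[of "x + e"] by linarith
    then have "\<bar>k x - k (x + e)\<bar> * (\<bar>marchaud t h y\<bar> * (step (t - x) * half_kernel (x - y))) \<le>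
        2 * C * (\<bar>marchaud t h y\<bar> * (step (t - x) * half_kernel (x - y)))"
      by (intro mult_right_mono) auto
    then show ?thesis by (simp add: P_def abs_mult mult_ac)
  qed
  have P_int: "integrable lborel (\<lambda>x. P (y, x))" for y
    by (rule Bochner_Integration.integrable_bound[of _ "\<lambda>x. 2 * C * (\<bar>marchaud t h y\<bar> * (step (t - x) * half_kernel (x - y)))"])
      (use maj[of y] P_le in \<open>auto intro!: AE_I2 order_trans[OF _ abs_ge_self]\<close>)
  have "integrable (lborel \<Otimes>\<^sub>M lborel) P"
  proof (rule lborel_pair.Fubini_integrable)
    show "integrable lborel (\<lambda>y. LINT x|lborel. norm (P (y, x)))"
    proof (rule Bochner_Integration.integrable_bound)
      show "integrable lborel (\<lambda>y. 2 * C * \<bar>conv step half_kernel (t - y) * marchaud t h y\<bar>)"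
        by (intro integrable_mult_right integrable_abs step_half_kernel_marchaud_integrable)
      show "AE y in lborel. norm (LINT x|lborel. norm (P (y, x))) \<le>
          norm (2 * C * \<bar>conv step half_kernel (t - y) * marchaud t h y\<bar>)"
      proof (rule AE_I2)
        fix y
        have "(LINT x|lborel. \<bar>P (y, x)\<bar>) \<le> (LINT x|lborel. 2 * C * (\<bar>marchaud t h y\<bar> * (step (t - x) * half_kernel (x - y))))"
          using P_int[of y] maj[of y] P_le by (intro integral_mono) auto
        also have "\<dots> = 2 * C * (\<bar>marchaud t h y\<bar> * conv step half_kernel (t - y))"
          by (simp add: conv_shift)
        also have "\<dots> = 2 * C * \<bar>conv step half_kernel (t - y) * marchaud t h y\<bar>"
          by (simp add: conv_step_half_kernel abs_mult mult_ac)
        finally show "norm (LINT x|lborel. norm (P (y, x))) \<le>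
          norm (2 * C * \<bar>conv step half_kernel (t - y) * marchaud t h y\<bar>)"
          by simp
      qed
    qed simp
    show "AE y in lborel. integrable lborel (\<lambda>x. P (y, x))"
      using P_int by simp
  qed simp
  then have "(LINT x|lborel. LINT y|lborel. P (y, x)) = (LINT y|lborel. LINT x|lborel. P (y, x))"
    using lborel_pair.Fubini_integral[of "\<lambda>y x. P (y, x)"] by simp
  moreover have "(LINT x|lborel. P (y, x)) = marchaud t h y * (quot e y * e)" for y
    by (cases "e = 0") (simp_all add: P_def quot_def)
  moreover have "(LINT y|lborel. P (y, x)) = step (t - x) * (conv half_kernel (marchaud t h) x * (k x - k (x + e)))" for x
  proof -
    have "P (y, x) = (step (t - x) * (k x - k (x + e))) * (half_kernel (x - y) * marchaud t h y)" for y
      by (simp add: P_def)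
    then show ?thesis by (simp add: conv_def)
  qed
  \<comment> \<open>Abel inversion holds only to the left of \<open>t\<close>. The factor
    \<open>step\<close> discards the convolution from \<open>t\<close> on, where \<open>h\<close> is
    0.\<close>
  moreover have "(LINT x|lborel. step (t - x) * (conv half_kernel (marchaud t h) x * (k x - k (x + e)))) =
      (LINT x|lborel. pi * (h x * (k x - k (x + e))))"
  proof (rule integral_cong_AE)
    show "AE x in lborel. step (t - x) * (conv half_kernel (marchaud t h) x * (k x - k (x + e))) = pi * (h x * (k x - k (x + e)))"
      using abel_inversion
    proof eventually_elim
      case (elim x)
      then show ?case
        using h_support[of x] by (cases "x < t") (auto simp: step_def)
    qed
  qed auto
  ultimately have "pi * (LINT x|lborel. h x * (k x - k (x + e))) = (LINT y|lborel. marchaud t h y * quot e y) * e"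
    by (simp add: mult.assoc flip: integral_mult_right_zero integral_mult_left_zero)
  then have "(LINT x|lborel. h x * (k x - k (x + e))) = 1 / pi * (LINT y|lborel. marchaud t h y * quot e y) * e"
    by (simp add: field_simps)
  then show ?thesis by (cases "e = 0") (simp_all add: quot_def)
qed

lemma quot_measurable [measurable]: "quot e \<in> borel_measurable borel"
  unfolding quot_def by measurable

text \<open>The quotients converge only almost everywhere, but they are uniformly bounded and are
  weighted by an integrable function. The sequence may have either sign, which the chain rule
  exploits.\<close>

theorem integral_increment_tendsto:
  assumes e: "\<And>n. e n \<noteq> 0" "\<And>n. \<bar>e n\<bar> < 1" "e \<longlonglongrightarrow> 0"
  shows "(\<lambda>n. (LINT x|lborel. h x * (k x - k (x + e n))) / e n) \<longlonglongrightarrow>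
    1 / pi * (LINT x|lborel. marchaud t h x * marchaud (t + 1) reflected (t - x))"
  unfolding integral_increment_eq
proof (intro tendsto_mult tendsto_const integral_dominated_convergence)
  show "integrable lborel (\<lambda>x. \<bar>marchaud t h x\<bar> * (L + 2 * C))"
    by (intro integrable_mult_left integrable_abs marchaud_integrable)
  have lim: "filterlim e (at 0) sequentially"
    using e by (simp add: filterlim_at)
  show "AE x in lborel. (\<lambda>n. marchaud t h x * quot (e n) x) \<longlonglongrightarrow>
      marchaud t h x * marchaud (t + 1) reflected (t - x)"
    using AE_quot_tendsto
  proof eventually_elim
    case (elim x)
    show ?case
    proof (cases "x \<in> {0<..<t}")
      case True
      with elim have "(\<lambda>n. quot (e n) x) \<longlonglongrightarrow> marchaud (t + 1) reflected (t - x)"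
        using filterlim_compose[OF _ lim] by blast
      then show ?thesis by (intro tendsto_mult tendsto_const)
    qed (simp add: marchaud_support)
  qed
  show "AE x in lborel. norm (marchaud t h x * quot (e n) x) \<le> \<bar>marchaud t h x\<bar> * (L + 2 * C)" for n
  proof (rule AE_I2)
    fix x
    show "norm (marchaud t h x * quot (e n) x) \<le> \<bar>marchaud t h x\<bar> * (L + 2 * C)"
      using quot_bound[of x "e n"] e(1,2)[of n]
      by (cases "x \<in> {0<..<t}") (auto simp: marchaud_support abs_mult intro!: mult_left_mono)
  qed
qed auto

end

text \<open>The fractional derivatives are defined through \<open>deriv\<close>, whose values are
  unspecified where no derivative exists. Completeness of Lebesgue measure makes agreement almost
  everywhere with a Borel function sufficient.\<close>

lemma lebesgue_measurable_AE_eq: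
  fixes f g :: "real \<Rightarrow> real"
  assumes ae: "AE x in lborel. f x = g x" and g: "g \<in> borel_measurable borel"
  shows "f \<in> borel_measurable lebesgue"
proof (rule measurableI)
  fix A :: "real set" assume A: "A \<in> sets borel"
  have "g -` A \<in> sets lebesgue"
    using measurable_sets[OF g A] by simp
  moreover have "AE x in lebesgue. x \<in> g -` A \<longleftrightarrow> x \<in> f -` A"
    using AE_completion[OF ae] by eventually_elim auto
  ultimately show "f -` A \<inter> space lebesgue \<in> sets lebesgue"
    using completion.in_sets_AE[of "g -` A" "f -` A" lborel] by simp
qed simp

lemma lebesgue_integral_AE_eq:
  fixes f g :: "real \<Rightarrow> real"
  assumes ae: "AE x in lborel. f x = g x" and g: "integrable lborel g"
  shows "integrable lebesgue f" "(LINT x|lebesgue. f x) = (LINT x|lborel. g x)"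
proof -
  have [measurable]: "g \<in> borel_measurable borel" using g by simp
  have f: "f \<in> borel_measurable lebesgue"
    using lebesgue_measurable_AE_eq[OF ae] by simp
  have g': "g \<in> borel_measurable lebesgue" by (rule measurable_completion) simp
  have "integrable lebesgue g" using g by (simp add: integrable_completion)
  then show "integrable lebesgue f"
    using integrable_cong_AE[OF f g' AE_completion[OF ae]] by blast
  show "(LINT x|lebesgue. f x) = (LINT x|lborel. g x)"
    using integral_cong_AE[OF f g' AE_completion[OF ae]] by (simp add: integral_completion)
qed

section \<open>Identification with the fractional derivatives of the definition\<close>

context hoelder_integrator begin

lemma frac_deriv_left_eq:
  assumes hh: "\<And>x. x \<in> {0<..<t} \<Longrightarrow> hh x = h x"
  shows "AE x in lborel. x \<in> {0<..<t} \<longrightarrow> frac_deriv_left (1/2) hh x = 1 / sqrt pi * marchaud t h x"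
  using AE_conv_half_kernel_has_derivative
proof eventually_elim
  case (elim x)
  have eq: "conv half_kernel h y = (LINT s:{0..y}|lebesgue. hh s * (y - s) powr (- (1/2)))" if "y \<in> {0<..<t}" for y
  proof -
    have "conv half_kernel h y = (LINT s|lebesgue. half_kernel (y - s) * h s)"
      unfolding conv_def by (rule integral_completion[symmetric]) measurable
    \<comment> \<open>The point 0 is exempted because \<open>h\<close> vanishes there while
      \<open>hh\<close> need not.\<close>
    also have "\<dots> = (LINT s:{0..y}|lebesgue. hh s * (y - s) powr (- (1/2)))"
      unfolding set_lebesgue_integral_def
      by (rule integral_discrete_difference[of "{0}"])
        (use that hh h_support in \<open>auto simp: half_kernel_def indicator_def\<close>)
    finally show ?thesis .
  qed
  show ?case
  proof
    assume x: "x \<in> {0<..<t}"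
    then have "(conv half_kernel h has_real_derivative marchaud t h x) (at x)"
      using elim by simp
    then have "((\<lambda>y. LINT s:{0..y}|lebesgue. hh s * (y - s) powr (- (1/2))) has_real_derivative marchaud t h x) (at x)"
      by (rule has_field_derivative_transform_within_open[of _ _ _ "{0<..<t}"]) (use x eq in auto)
    then show "frac_deriv_left (1/2) hh x = 1 / sqrt pi * marchaud t h x"
      unfolding frac_deriv_left_def by (simp add: DERIV_imp_deriv Gamma_one_half_real)
  qed
qed

lemma frac_deriv_right_eq:
  assumes kk: "\<And>x. x \<in> {0<..t} \<Longrightarrow> kk x = k x"
  shows "AE x in lborel. x \<in> {0<..<t} \<longrightarrow>
    frac_deriv_right (1/2) t kk x = 1 / sqrt pi * marchaud (t + 1) reflected (t - x)"
  using AE_lborel_reflect[OF reflected.AE_conv_half_kernel_has_derivative, of t]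
proof eventually_elim
  case (elim x)
  have eq: "conv half_kernel reflected (t - y) = (LINT s:{y..t}|lebesgue. kk s * (s - y) powr (- (1/2)))" if "y \<in> {0<..<t}" for y
  proof -
    have "conv half_kernel reflected (t - y) = (LINT s|lborel. half_kernel (t - y - (t - s)) * reflected (t - s))"
      unfolding conv_def by (rule lborel_shift_reflect)
    also have "\<dots> = (LINT s|lebesgue. half_kernel (t - y - (t - s)) * reflected (t - s))"
      by (rule integral_completion[symmetric]) measurable
    also have "\<dots> = (LINT s:{y..t}|lebesgue. kk s * (s - y) powr (- (1/2)))"
      unfolding set_lebesgue_integral_def
      by (rule Bochner_Integration.integral_cong)
        (use that kk k_zero in \<open>auto simp: half_kernel_def indicator_def reflected_def\<close>)
    finally show ?thesis .
  qed
  show ?case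
  proof
    assume x: "x \<in> {0<..<t}"
    then have D: "(conv half_kernel reflected has_real_derivative marchaud (t + 1) reflected (t - x)) (at (t - x))"
      using elim by simp
    \<comment> \<open>The inner derivative -1 of the reflection cancels the minus sign in
      \<open>frac_deriv_right\<close>.\<close>
    have "((\<lambda>y. conv half_kernel reflected (t - y)) has_real_derivative marchaud (t + 1) reflected (t - x) * (-1)) (at x)"
      by (rule DERIV_chain2[where g="\<lambda>y. t - y", OF D]) (auto intro!: derivative_eq_intros)
    then have "((\<lambda>y. LINT s:{y..t}|lebesgue. kk s * (s - y) powr (- (1/2))) has_real_derivative - marchaud (t + 1) reflected (t - x)) (at x)"
      by (subst (asm) mult_minus1_right, elim has_field_derivative_transform_within_open[of _ _ _ "{0<..<t}"]) (use x eq in auto)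
    then show "frac_deriv_right (1/2) t kk x = 1 / sqrt pi * marchaud (t + 1) reflected (t - x)"
      unfolding frac_deriv_right_def by (simp add: DERIV_imp_deriv Gamma_one_half_real)
  qed
qed

text \<open>The two factors \<open>1 / Gamma (1/2) = 1 / sqrt pi\<close> combine to
  \<open>1 / pi\<close>, so the value is precisely the limit found in
  \<open>integral_increment_tendsto\<close>.\<close>

theorem gls_integral_eq:
  assumes hh: "\<And>x. x \<in> {0<..<t} \<Longrightarrow> hh x = h x"
    and g: "\<And>x. x \<in> {0<..t} \<Longrightarrow> k x = g t - g x"
    and lim: "(g \<longlongrightarrow> g t) (at_left t)"
  shows "set_integrable lebesgue {0..t} (gls_integrand (1/2) hh g t)"
    and "(LINT x:{0..t}|lebesgue. gls_integrand (1/2) hh g t x) =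
      1 / pi * (LINT x|lborel. marchaud t h x * marchaud (t + 1) reflected (t - x))"
proof -
  define v where "v x = 1 / pi * (marchaud t h x * marchaud (t + 1) reflected (t - x))" for x
  have Lim: "Lim (at_left t) g = g t"
    using lim by (intro tendsto_Lim) (auto simp: trivial_limit_at_left_real)
  have v: "integrable lborel v"
  proof -
    have "integrable lborel (\<lambda>x. marchaud t h x * marchaud (t + 1) reflected (t - x))"
    proof (rule Bochner_Integration.integrable_bound)
      show "integrable lborel (\<lambda>x. L * marchaud t h x)"
        by (intro integrable_mult_right marchaud_integrable)
      show "AE x in lborel. norm (marchaud t h x * marchaud (t + 1) reflected (t - x)) \<le> norm (L * marchaud t h x)"
        using marchaud_reflected_bounded L_nonneg
        by (auto simp: abs_mult mult.commute[of L] intro!: AE_I2 mult_left_mono)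
    qed simp
    then show ?thesis unfolding v_def by simp
  qed
  have left: "AE x in lborel. x \<in> {0<..<t} \<longrightarrow> frac_deriv_left (1/2) hh x = 1 / sqrt pi * marchaud t h x"
    by (rule frac_deriv_left_eq[OF hh])
  have right: "AE x in lborel. x \<in> {0<..<t} \<longrightarrow>
      frac_deriv_right (1/2) t (\<lambda>y. g t - g y) x = 1 / sqrt pi * marchaud (t + 1) reflected (t - x)"
    by (rule frac_deriv_right_eq) (simp add: g)
  have "AE x in lborel. x \<in> {0<..<t} \<longrightarrow> gls_integrand (1/2) hh g t x = v x"
    using left right
    by eventually_elim (auto simp: gls_integrand_def Lim v_def)
  moreover have "AE x in lborel. x \<notin> {0, t}"
    by (intro AE_not_in finite_imp_null_set_lborel) simp
  ultimately have ae: "AE x in lborel. indicator {0..t} x *\<^sub>R gls_integrand (1/2) hh g t x = v x"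
    by eventually_elim (auto simp: indicator_def v_def marchaud_support)
  show "set_integrable lebesgue {0..t} (gls_integrand (1/2) hh g t)"
    using lebesgue_integral_AE_eq(1)[OF ae v] by (simp add: set_integrable_def)
  show "(LINT x:{0..t}|lebesgue. gls_integrand (1/2) hh g t x) =
      1 / pi * (LINT x|lborel. marchaud t h x * marchaud (t + 1) reflected (t - x))"
    using lebesgue_integral_AE_eq(2)[OF ae v] by (simp add: set_lebesgue_integral_def v_def)
qed

end

section \<open>Left derivatives of convex functions\<close>

lemma slope_commute: "(f x - f y) / (x - y) = (f y - f x) / (y - x)" for f :: "real \<Rightarrow> real"
  by (metis minus_diff_eq minus_divide_divide)

lemma convex_slope_mono:
  fixes f :: "real \<Rightarrow> real"
  assumes f: "convex_on UNIV f" and yz: "y \<le> z" "y \<noteq> x" "z \<noteq> x"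
  shows "(f y - f x) / (y - x) \<le> (f z - f x) / (z - x)"
proof -
  consider "y = z" | "x < y" "y < z" | "y < x" "x < z" | "y < z" "z < x"
    using yz by linarith
  then show ?thesis
  proof cases
    case 2
    show ?thesis
      using convex_on_slope_le(1)[OF f, of x z y] 2
      unfolding slope_commute[of f y x] slope_commute[of f z x] by simp
  next
    case 3
    show ?thesis
      using convex_on_slope_le[OF f UNIV_I UNIV_I, of y x z] 3
      unfolding slope_commute[of f z x] by linarith
  next
    case 4
    show ?thesis
      using convex_on_slope_le(2)[OF f, of y x z] 4 by simp
  qed simp
qed

text \<open>Slopes through \<open>x\<close> increase, so the left derivative exists as the supremum
  of the slopes to the left of \<open>x\<close>; any slope to the right is an upper bound of these.
  This also shows that the definite description in \<open>left_deriv\<close> denotes.\<close>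

lemma
  fixes f :: "real \<Rightarrow> real"
  assumes f: "convex_on UNIV f"
  shows left_deriv_le_slope: "x < z \<Longrightarrow> left_deriv f x \<le> (f z - f x) / (z - x)"
    and left_deriv_ge_slope: "y < x \<Longrightarrow> (f y - f x) / (y - x) \<le> left_deriv f x"
proof -
  let ?S = "\<lambda>y. (f y - f x) / (y - x)"
  define D where "D = Sup (?S ` {..<x})"
  have bdd: "bdd_above (?S ` {..<x})"
    using convex_slope_mono[OF f, of _ "x + 1" x] by (intro bdd_aboveI2[where M="?S (x + 1)"]) auto
  have ge: "?S y \<le> D" if "y < x" for y
    unfolding D_def using that by (intro cSup_upper bdd) auto
  have le: "D \<le> ?S z" if "x < z" for z
    unfolding D_def
  proof (rule cSup_least)
    show "?S ` {..<x} \<noteq> {}" by (simp add: lessThan_empty_iff)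
    show "s \<le> ?S z" if "s \<in> ?S ` {..<x}" for s
      using that \<open>x < z\<close> convex_slope_mono[OF f, of _ z x] by auto
  qed
  have "(?S \<longlongrightarrow> D) (at_left x)"
  proof (rule order_tendstoI)
    fix a assume "a < D"
    then obtain y where y: "y < x" "a < ?S y"
      unfolding D_def using less_cSup_iff[OF _ bdd, of a] by (auto simp: lessThan_empty_iff)
    have "\<forall>\<^sub>F z in at_left x. z \<in> {y<..<x}"
      using y(1) by (rule eventually_at_left_real)
    then show "\<forall>\<^sub>F z in at_left x. a < ?S z"
    proof eventually_elim
      case (elim z)
      then show ?case using y convex_slope_mono[OF f, of y z x] by auto
    qed
  next
    fix a assume "D < a"
    have "\<forall>\<^sub>F z in at_left x. z \<in> {x - 1<..<x}"
      by (rule eventually_at_left_real) simp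
    then show "\<forall>\<^sub>F z in at_left x. ?S z < a"
      by eventually_elim (use ge \<open>D < a\<close> in \<open>force intro: le_less_trans\<close>)
  qed
  then have D: "(f has_real_derivative D) (at_left x)"
    by (simp add: has_field_derivative_iff)
  have "left_deriv f x = D"
    unfolding left_deriv_def
  proof (rule the_equality, rule D)
    fix E assume "(f has_real_derivative E) (at_left x)"
    with D show "E = D"
      unfolding has_field_derivative_iff
      using tendsto_unique[OF trivial_limit_at_left_real] by blast
  qed
  then show "x < z \<Longrightarrow> left_deriv f x \<le> ?S z" and "y < x \<Longrightarrow> ?S y \<le> left_deriv f x"
    using ge le by auto
qed

lemma left_deriv_subgradient:
  fixes f :: "real \<Rightarrow> real"
  assumes f: "convex_on UNIV f"
  shows "left_deriv f x * (y - x) \<le> f y - f x"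
proof -
  consider "y = x" | "x < y" | "y < x" by linarith
  then show ?thesis
    using left_deriv_le_slope[OF f, of x y] left_deriv_ge_slope[OF f, of y x]
    by cases (auto simp: field_simps)
qed

lemma left_deriv_mono:
  fixes f :: "real \<Rightarrow> real"
  assumes f: "convex_on UNIV f"
  shows "mono (left_deriv f)"
proof (rule monoI)
  fix x y :: real assume "x \<le> y"
  show "left_deriv f x \<le> left_deriv f y"
  proof (cases "x = y")
    case False
    then have "x < y" using \<open>x \<le> y\<close> by simp
    then show ?thesis
      using left_deriv_le_slope[OF f, of x y] left_deriv_ge_slope[OF f, of x y]
      unfolding slope_commute[of f y x] by linarith
  qed simp
qed

lemma continuous_on_convex_real:
  fixes f :: "real \<Rightarrow> real"
  assumes "convex_on UNIV f"
  shows "continuous_on A f"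
  using convex_on_continuous[OF open_UNIV assms] continuous_on_subset by blast

section \<open>Elementary bounds for the exponential and averaged increments\<close>

lemma abs_exp_diff_le:
  fixes u v N :: real
  assumes "u \<le> N" "v \<le> N"
  shows "\<bar>exp u - exp v\<bar> \<le> exp N * \<bar>u - v\<bar>"
proof -
  have *: "exp u - exp v \<le> exp N * (u - v)" if "v \<le> u" "u \<le> N" for u v :: real
  proof -
    have "exp u * (1 + (v - u)) \<le> exp u * exp (v - u)"
      by (intro mult_left_mono exp_ge_add_one_self) auto
    then have "exp u - exp v \<le> exp u * (u - v)"
      by (simp add: algebra_simps flip: exp_add)
    also have "\<dots> \<le> exp N * (u - v)" using that by (intro mult_right_mono) auto
    finally show ?thesis .
  qed
  show ?thesis
    using *[of v u] *[of u v] assms by (cases "v \<le> u") auto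
qed

text \<open>The tangent inequality at \<open>v\<close> gives nonnegativity of the remainder, the one
  at \<open>u\<close> bounds it by \<open>(exp u - exp v) * (u - v)\<close>, and a Lipschitz bound
  makes this quadratic.\<close>

lemma abs_exp_taylor_le:
  fixes u v N :: real
  assumes "u \<le> N" "v \<le> N"
  shows "\<bar>exp u - exp v - exp v * (u - v)\<bar> \<le> exp N * (u - v)\<^sup>2"
proof -
  have lower: "0 \<le> exp u - exp v - exp v * (u - v)"
  proof -
    have "exp v * (1 + (u - v)) \<le> exp v * exp (u - v)"
      by (intro mult_left_mono exp_ge_add_one_self) auto
    then show ?thesis by (simp add: algebra_simps flip: exp_add)
  qed
  have "exp u - exp v \<le> exp u * (u - v)"
  proof -
    have "exp u * (1 + (v - u)) \<le> exp u * exp (v - u)"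
      by (intro mult_left_mono exp_ge_add_one_self) auto
    then show ?thesis by (simp add: algebra_simps flip: exp_add)
  qed
  then have "exp u - exp v - exp v * (u - v) \<le> (exp u - exp v) * (u - v)"
    by (simp add: algebra_simps)
  also have "\<dots> \<le> \<bar>exp u - exp v\<bar> * \<bar>u - v\<bar>"
    by (metis abs_ge_self abs_mult)
  also have "\<dots> \<le> exp N * \<bar>u - v\<bar> * \<bar>u - v\<bar>"
    using abs_exp_diff_le[OF assms] by (rule mult_right_mono) simp
  also have "\<dots> = exp N * (u - v)\<^sup>2"
    by (simp add: power2_eq_square)
  finally show ?thesis using lower by simp
qed

text \<open>With a primitive \<open>P\<close> of the function the integral telescopes to
  \<open>(P (t + e) - P t) - (P e - P 0)\<close>, so only the two end points contribute to the
  limit.\<close>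

lemma integral_increment_quotient_tendsto:
  fixes \<phi> :: "real \<Rightarrow> real"
  assumes \<phi>: "continuous_on UNIV \<phi>" and t: "0 < t"
    and e: "\<And>n. e n \<noteq> 0" "\<And>n. \<bar>e n\<bar> < 1" "e \<longlonglongrightarrow> 0"
  shows "(\<lambda>n. integral {0..t} (\<lambda>x. \<phi> (x + e n) - \<phi> x) / e n) \<longlonglongrightarrow> \<phi> t - \<phi> 0"
proof -
  \<comment> \<open>The primitive starts at -1 so that 0 and its shifts by less than 1 are interior
    points.\<close>
  define P where "P z = integral {-1..z} \<phi>" for z
  have c: "continuous_on A \<phi>" for A using \<phi> continuous_on_subset by blast
  have int: "\<phi> integrable_on {a..b}" for a b by (intro integrable_continuous_real c)
  have D: "(P has_real_derivative \<phi> z) (at z)" if "z \<in> {-1<..<t + 1}" for z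
  proof -
    have "(P has_real_derivative \<phi> z) (at z within {-1..t + 1})"
      unfolding P_def using that by (intro integral_has_real_derivative c) auto
    then have "(P has_real_derivative \<phi> z) (at z within {-1<..<t + 1})"
      by (rule DERIV_subset) auto
    moreover have "at z within {-1<..<t + 1} = at z"
      by (rule at_within_open) (use that in auto)
    ultimately show ?thesis by simp
  qed
  have lim: "filterlim e (at 0) sequentially"
    using e by (simp add: filterlim_at)
  have L: "(\<lambda>n. (P (z + e n) - P z) / e n) \<longlonglongrightarrow> \<phi> z" if "z \<in> {-1<..<t + 1}" for z
    using filterlim_compose[OF _ lim, of "\<lambda>h. (P (z + h) - P z) / h"] D[OF that]
    unfolding DERIV_def by blast
  have "(\<lambda>n. (P (t + e n) - P t) / e n - (P (0 + e n) - P 0) / e n) \<longlonglongrightarrow> \<phi> t - \<phi> 0"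
    using t by (intro tendsto_diff L) auto
  moreover have "(P (t + e n) - P t) / e n - (P (0 + e n) - P 0) / e n =
      integral {0..t} (\<lambda>x. \<phi> (x + e n) - \<phi> x) / e n" for n
  proof -
    have P: "P b - P a = integral {a..b} \<phi>" if "-1 \<le> a" "a \<le> b" for a b
      unfolding P_def using Henstock_Kurzweil_Integration.integral_combine[OF that int] by simp
    have "continuous_on {0..t} (\<lambda>x. \<phi> (x + e n))"
      by (rule continuous_on_compose2[OF \<phi>]) (auto intro!: continuous_intros)
    then have "integral {0..t} (\<lambda>x. \<phi> (x + e n) - \<phi> x) = integral {0..t} (\<lambda>x. \<phi> (x + e n)) - integral {0..t} \<phi>"
      by (intro Henstock_Kurzweil_Integration.integral_diff int integrable_continuous_real)
    also have "integral {0..t} (\<lambda>x. \<phi> (x + e n)) = integral {e n..t + e n} \<phi>"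
      using integral_shift[OF c, of 0 t "e n"] by (simp add: o_def)
    also have "\<dots> = P (t + e n) - P (e n)"
      by (rule P[symmetric]) (use e(2)[of n] t in auto)
    also have "integral {0..t} \<phi> = P t - P 0"
      by (rule P[symmetric]) (use t in auto)
    finally have eq: "integral {0..t} (\<lambda>x. \<phi> (x + e n) - \<phi> x) = P (t + e n) - P (e n) - (P t - P 0)" .
    show ?thesis unfolding eq by (simp add: diff_divide_distrib)
  qed
  ultimately show ?thesis by simp
qed

section \<open>The chain rule along a Hoelder path\<close>

text \<open>The logarithm of \<open>geometric_average\<close>, written for a single path with the
  gauge integral, which agrees with the Lebesgue integral on continuous paths.\<close>

definition log_geometric_average :: "real \<Rightarrow> (real \<Rightarrow> real) \<Rightarrow> real \<Rightarrow> real" where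
  "log_geometric_average T B s = 1 / T * integral {0..s} B + (T - s) / T * B s"

locale hoelder_path =
  fixes T C \<gamma> :: real and B :: "real \<Rightarrow> real"
  assumes T_pos: "0 < T" and \<gamma>: "1/2 < \<gamma>" "\<gamma> \<le> 1"
    and hoelder: "\<And>x y. x \<in> {0..T} \<Longrightarrow> y \<in> {0..T} \<Longrightarrow> \<bar>B x - B y\<bar> \<le> C * \<bar>x - y\<bar> powr \<gamma>"
begin

abbreviation log_average :: "real \<Rightarrow> real" where
  "log_average \<equiv> log_geometric_average T B"

lemma C_nonneg: "0 \<le> C"
proof -
  have "0 \<le> \<bar>B T - B 0\<bar>" by simp
  also have "\<dots> \<le> C * \<bar>T - 0\<bar> powr \<gamma>" using T_pos by (intro hoelder) auto
  finally show ?thesis using T_pos by (auto simp: zero_le_mult_iff)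
qed

lemma continuous_on_hoelder:
  fixes F :: "real \<Rightarrow> real"
  assumes "\<And>x y. x \<in> A \<Longrightarrow> y \<in> A \<Longrightarrow> \<bar>F x - F y\<bar> \<le> D * \<bar>x - y\<bar> powr \<gamma>"
  shows "continuous_on A F"
  unfolding continuous_on_def
proof
  fix x assume x: "x \<in> A"
  have "((\<lambda>y. F y - F x) \<longlongrightarrow> 0) (at x within A)"
  proof (rule Lim_null_comparison)
    have "((\<lambda>y. D * \<bar>y - x\<bar> powr \<gamma>) \<longlongrightarrow> D * \<bar>x - x\<bar> powr \<gamma>) (at x within A)"
      using \<gamma> by (intro tendsto_intros tendsto_powr') auto
    then show "((\<lambda>y. D * \<bar>y - x\<bar> powr \<gamma>) \<longlongrightarrow> 0) (at x within A)" by simp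
    show "\<forall>\<^sub>F y in at x within A. norm (F y - F x) \<le> D * \<bar>y - x\<bar> powr \<gamma>"
      using assms x by (auto simp: eventually_at_filter)
  qed
  then show "(F \<longlongrightarrow> F x) (at x within A)" by (simp add: LIM_zero_iff)
qed

lemma B_continuous: "continuous_on {0..T} B"
  by (rule continuous_on_hoelder[OF hoelder])

lemma B_integrable: "0 \<le> a \<Longrightarrow> b \<le> T \<Longrightarrow> B integrable_on {a..b}"
  by (intro integrable_continuous_real continuous_on_subset[OF B_continuous]) auto

lemma integral_minus_endpoint_le:
  assumes ab: "0 \<le> a" "a \<le> b" "b \<le> T" and c: "c \<in> {a..b}"
  shows "\<bar>integral {a..b} B - (b - a) * B c\<bar> \<le> C * (b - a) powr (\<gamma> + 1)"
proof -
  have "integral {a..b} B - (b - a) * B c = integral {a..b} (\<lambda>u. B u - B c)"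
    using ab by (subst Henstock_Kurzweil_Integration.integral_diff) (auto intro: B_integrable)
  also have "\<bar>\<dots>\<bar> \<le> integral {a..b} (\<lambda>u. C * (b - a) powr \<gamma>)"
    unfolding real_norm_def[symmetric]
  proof (rule integral_norm_bound_integral)
    show "(\<lambda>u. B u - B c) integrable_on {a..b}"
      using ab by (intro integrable_diff B_integrable) auto
    fix u assume u: "u \<in> {a..b}"
    then have "\<bar>B u - B c\<bar> \<le> C * \<bar>u - c\<bar> powr \<gamma>"
      using ab c by (intro hoelder) auto
    also have "\<dots> \<le> C * (b - a) powr \<gamma>"
      using u c \<gamma> C_nonneg by (intro mult_left_mono powr_mono2) auto
    finally show "norm (B u - B c) \<le> C * (b - a) powr \<gamma>" by simp
  qed auto
  also have "\<dots> = C * (b - a) powr (\<gamma> + 1)"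
    using ab by (simp add: powr_add)
  finally show ?thesis .
qed

text \<open>To first order the growth of the integral cancels the loss in the factor
  \<open>T - s\<close>; what remains is the integral of \<open>B\<close> minus the length times an
  end point value. This cancellation is why the formula contains no \<open>ds\<close> term.\<close>

lemma log_average_increment:
  assumes x: "x \<in> {0..T}" and y: "y \<in> {0..T}"
  shows "\<bar>log_average y - log_average x - (T - x) / T * (B y - B x)\<bar> \<le> C / T * \<bar>y - x\<bar> powr (\<gamma> + 1)"
proof -
  have eq: "log_average y - log_average x - (T - x) / T * (B y - B x) =
      1 / T * (integral {0..y} B - integral {0..x} B - (y - x) * B y)"
    using T_pos by (simp add: log_geometric_average_def field_simps)
  have "\<bar>integral {0..y} B - integral {0..x} B - (y - x) * B y\<bar> \<le> C * \<bar>y - x\<bar> powr (\<gamma> + 1)"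
  proof (cases "x \<le> y")
    case True
    have "integral {0..x} B + integral {x..y} B = integral {0..y} B"
      by (rule Henstock_Kurzweil_Integration.integral_combine) (use x y True B_integrable in auto)
    then show ?thesis
      using integral_minus_endpoint_le[of x y y] x y True by (simp flip: diff_eq_eq)
  next
    case False
    have "integral {0..y} B + integral {y..x} B = integral {0..x} B"
      by (rule Henstock_Kurzweil_Integration.integral_combine) (use x y False B_integrable in auto)
    then have eq: "integral {0..y} B - integral {0..x} B - (y - x) * B y = - (integral {y..x} B - (x - y) * B y)"
      by (simp add: algebra_simps)
    have "\<bar>integral {y..x} B - (x - y) * B y\<bar> \<le> C * (x - y) powr (\<gamma> + 1)"
      by (rule integral_minus_endpoint_le) (use x y False in auto)
    moreover have "\<bar>y - x\<bar> = x - y" using False by simp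
    ultimately show ?thesis unfolding eq by simp
  qed
  then have "1 / T * \<bar>integral {0..y} B - integral {0..x} B - (y - x) * B y\<bar> \<le> 1 / T * (C * \<bar>y - x\<bar> powr (\<gamma> + 1))"
    using T_pos by (intro mult_left_mono) auto
  then show ?thesis
    unfolding eq using T_pos by (simp add: abs_mult)
qed

lemma log_average_hoelder:
  assumes x: "x \<in> {0..T}" and y: "y \<in> {0..T}"
  shows "\<bar>log_average x - log_average y\<bar> \<le> 2 * C * \<bar>x - y\<bar> powr \<gamma>"
proof -
  let ?d = "\<bar>x - y\<bar>"
  define v where "v = (T - y) / T * (B x - B y)"
  have "C / T * ?d powr (\<gamma> + 1) = C * ?d powr \<gamma> * (?d / T)"
    by (simp add: powr_add)
  also have "\<dots> \<le> C * ?d powr \<gamma> * 1"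
    using x y T_pos C_nonneg by (intro mult_left_mono) auto
  finally have "C / T * ?d powr (\<gamma> + 1) \<le> C * ?d powr \<gamma>" by simp
  moreover have "\<bar>v\<bar> \<le> 1 * (C * ?d powr \<gamma>)"
    unfolding abs_mult v_def using x y T_pos hoelder[OF x y] by (intro mult_mono) auto
  ultimately show ?thesis
    using log_average_increment[OF y x, folded v_def] unfolding mult.assoc[of 2] by linarith
qed

lemma log_average_continuous: "continuous_on {0..T} log_average"
  by (rule continuous_on_hoelder[OF log_average_hoelder])

definition N :: real where "N = \<bar>log_average 0\<bar> + 2 * C * T powr \<gamma>"

lemma log_average_bounded:
  assumes "x \<in> {0..T}" shows "\<bar>log_average x\<bar> \<le> N"
proof -
  have "\<bar>log_average x - log_average 0\<bar> \<le> 2 * C * \<bar>x - 0\<bar> powr \<gamma>"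
    using assms by (intro log_average_hoelder) auto
  also have "\<dots> \<le> 2 * C * T powr \<gamma>"
    using assms C_nonneg \<gamma> by (intro mult_left_mono powr_mono2) auto
  finally show ?thesis unfolding N_def by linarith
qed

text \<open>The first summand comes from the squared Hoelder bound \<open>2 * C\<close> of
  \<open>log_average\<close>, the second from \<open>log_average_increment\<close> with its exponent
  lowered to 2 \<gamma>.\<close>

definition K :: real where "K = exp N * (4 * C\<^sup>2 + C / T * T powr (1 - \<gamma>))"

lemma K_nonneg: "0 \<le> K"
  using C_nonneg T_pos by (simp add: K_def)

text \<open>A Taylor step for the exponential combined with \<open>log_average_increment\<close>.
  The order 2 \<gamma> exceeds 1, so the error disappears when increments are divided by the step
  size.\<close>

lemma exp_log_average_increment:
  assumes x: "x \<in> {0..T}" and y: "y \<in> {0..T}"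
  shows "\<bar>exp (log_average y) - exp (log_average x) - exp (log_average x) * ((T - x) / T * (B y - B x))\<bar>
    \<le> K * \<bar>y - x\<bar> powr (2 * \<gamma>)"
proof -
  let ?X = log_average and ?d = "\<bar>y - x\<bar>"
  have N: "?X x \<le> N" "?X y \<le> N"
    using log_average_bounded[OF x] log_average_bounded[OF y] by auto
  have "(?X y - ?X x)\<^sup>2 \<le> (2 * C * ?d powr \<gamma>)\<^sup>2"
    using log_average_hoelder[OF y x] by (metis abs_ge_zero power2_abs power_mono)
  also have "\<dots> = 4 * C\<^sup>2 * ?d powr (2 * \<gamma>)"
    by (simp add: power_mult_distrib power2_eq_square flip: powr_add)
  finally have "exp N * (?X y - ?X x)\<^sup>2 \<le> exp N * (4 * C\<^sup>2 * ?d powr (2 * \<gamma>))"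
    by (intro mult_left_mono) auto
  with abs_exp_taylor_le[OF N(2) N(1)]
  have 1: "\<bar>exp (?X y) - exp (?X x) - exp (?X x) * (?X y - ?X x)\<bar> \<le> exp N * (4 * C\<^sup>2 * ?d powr (2 * \<gamma>))"
    by linarith
  \<comment> \<open>As \<gamma> is at most 1, the exponent \<gamma> + 1 is at least 2 \<gamma>; the
    surplus is absorbed into a power of \<open>T\<close>.\<close>
  have "?d powr (\<gamma> + 1) = ?d powr (2 * \<gamma>) * ?d powr (1 - \<gamma>)"
    by (simp flip: powr_add)
  also have "\<dots> \<le> ?d powr (2 * \<gamma>) * T powr (1 - \<gamma>)"
    using x y \<gamma> by (intro mult_left_mono powr_mono2) auto
  finally have "C / T * ?d powr (\<gamma> + 1) \<le> C / T * (?d powr (2 * \<gamma>) * T powr (1 - \<gamma>))"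
    using C_nonneg T_pos by (intro mult_left_mono) auto
  with log_average_increment[OF x y]
  have "\<bar>?X y - ?X x - (T - x) / T * (B y - B x)\<bar> \<le> C / T * (?d powr (2 * \<gamma>) * T powr (1 - \<gamma>))"
    by linarith
  then have 2: "exp (?X x) * \<bar>?X y - ?X x - (T - x) / T * (B y - B x)\<bar> \<le>
      exp N * (C / T * (?d powr (2 * \<gamma>) * T powr (1 - \<gamma>)))"
    using N by (intro mult_mono) auto
  have "exp (?X y) - exp (?X x) - exp (?X x) * ((T - x) / T * (B y - B x)) =
     (exp (?X y) - exp (?X x) - exp (?X x) * (?X y - ?X x)) +
     exp (?X x) * (?X y - ?X x - (T - x) / T * (B y - B x))"
    by (simp only: right_diff_distrib)
  then have "\<bar>exp (?X y) - exp (?X x) - exp (?X x) * ((T - x) / T * (B y - B x))\<bar> \<le>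
     \<bar>exp (?X y) - exp (?X x) - exp (?X x) * (?X y - ?X x)\<bar> +
     exp (?X x) * \<bar>?X y - ?X x - (T - x) / T * (B y - B x)\<bar>"
    by (metis abs_exp_cancel abs_mult abs_triangle_ineq)
  also have "\<dots> \<le> exp N * (4 * C\<^sup>2 * ?d powr (2 * \<gamma>)) + exp N * (C / T * (?d powr (2 * \<gamma>) * T powr (1 - \<gamma>)))"
    using 1 2 by (rule add_mono)
  also have "\<dots> = K * ?d powr (2 * \<gamma>)"
    by (simp add: K_def algebra_simps)
  finally show ?thesis .
qed

end

section \<open>The chain rule for a convex function\<close>

locale convex_chain_rule = hoelder_path +
  fixes f :: "real \<Rightarrow> real" and t :: real
  assumes f: "convex_on UNIV f" and t: "0 < t" "t \<le> T"
begin

definition integrand :: "real \<Rightarrow> real" where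
  "integrand x = (T - x) / T * left_deriv f (exp (log_average x)) * exp (log_average x)"

text \<open>Freezes paths outside \<open>[0, t]\<close>, where nothing is assumed about
  \<open>B\<close>, so that arguments \<open>x + e\<close> can be used with either sign of
  \<open>e\<close> and the Hoelder constant is kept.\<close>

definition clip :: "real \<Rightarrow> real" where "clip x = min t (max 0 x)"

text \<open>Monotonicity bounds the left derivative on \<open>[exp (- N), exp N]\<close> by its
  values at the two ends.\<close>

definition \<Psi> :: real where
  "\<Psi> = \<bar>left_deriv f (exp N)\<bar> + \<bar>left_deriv f (exp (- N))\<bar>"

lemma clip: "clip x \<in> {0..T}" "clip x \<in> {0..t}" "\<bar>clip x - clip y\<bar> \<le> \<bar>x - y\<bar>" "x \<in> {0..t} \<Longrightarrow> clip x = x"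
  using t by (auto simp: clip_def)

lemma continuous_on_clip: "continuous_on A clip"
  unfolding clip_def by (intro continuous_intros)

lemma continuous_on_compose_clip:
  assumes "continuous_on {0..T} F" shows "continuous_on A (\<lambda>x. F (clip x))"
  by (rule continuous_on_compose2[OF assms continuous_on_clip]) (use clip in auto)

lemma left_deriv_bounded:
  assumes "x \<in> {0..T}" shows "\<bar>left_deriv f (exp (log_average x))\<bar> \<le> \<Psi>"
proof -
  have "left_deriv f (exp (log_average x)) \<le> left_deriv f (exp N)"
    "left_deriv f (exp (- N)) \<le> left_deriv f (exp (log_average x))"
    using log_average_bounded[OF assms] by (auto intro!: monoD[OF left_deriv_mono[OF f]])
  then show ?thesis unfolding \<Psi>_def by linarith
qed

lemma integrand_bounded:
  assumes "x \<in> {0..T}" shows "\<bar>integrand x\<bar> \<le> \<Psi> * exp N"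
proof -
  have "\<bar>integrand x\<bar> \<le> 1 * \<Psi> * exp N"
    unfolding integrand_def abs_mult
    using assms T_pos left_deriv_bounded[OF assms] log_average_bounded[OF assms]
    by (intro mult_mono) auto
  then show ?thesis by simp
qed

lemma left_deriv_measurable [measurable]: "left_deriv f \<in> borel_measurable borel"
  by (rule borel_measurable_mono[OF left_deriv_mono[OF f]])

lemma integrand_measurable [measurable]: "(\<lambda>x. indicator {0<..<t} x * integrand x) \<in> borel_measurable borel"
proof -
  have [measurable]: "(\<lambda>x. log_average (clip x)) \<in> borel_measurable borel"
    by (intro borel_measurable_continuous_onI continuous_on_compose_clip log_average_continuous)
  have "(\<lambda>x. indicator {0<..<t} x * integrand x) = (\<lambda>x. indicator {0<..<t} x *
      ((T - x) / T * left_deriv f (exp (log_average (clip x))) * exp (log_average (clip x))))"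
    using clip(4) by (auto simp: integrand_def indicator_def fun_eq_iff)
  then show ?thesis by simp
qed

text \<open>The subgradient inequality at \<open>exp (log_average x)\<close>, with the increment of
  the exponential replaced by its linear part in \<open>B\<close>. The remainder \<open>r\<close> is
  multiplied by a slope of modulus at most \<Psi>.\<close>

lemma increment_le:
  assumes x: "x \<in> {0..t}"
  shows "integrand x * (B (clip (x + e)) - B (clip x)) - \<Psi> * K * \<bar>e\<bar> powr (2 * \<gamma>)
    \<le> f (exp (log_average (clip (x + e)))) - f (exp (log_average (clip x)))"
proof -
  let ?X = log_average and ?y = "clip (x + e)"
  have xT: "x \<in> {0..T}" and cx: "clip x = x" using x t clip(4) by auto
  define r where "r = exp (?X ?y) - exp (?X x) - exp (?X x) * ((T - x) / T * (B ?y - B x))"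
  have "\<bar>r\<bar> \<le> K * \<bar>?y - x\<bar> powr (2 * \<gamma>)"
    unfolding r_def using exp_log_average_increment[OF xT clip(1)] .
  also have "\<dots> \<le> K * \<bar>e\<bar> powr (2 * \<gamma>)"
    using clip(3)[of "x + e" x] K_nonneg \<gamma> cx by (intro mult_left_mono powr_mono2) auto
  finally have "\<bar>left_deriv f (exp (?X x))\<bar> * \<bar>r\<bar> \<le> \<Psi> * (K * \<bar>e\<bar> powr (2 * \<gamma>))"
    using left_deriv_bounded[OF xT] by (intro mult_mono) (auto simp: \<Psi>_def)
  then have "- (\<Psi> * K * \<bar>e\<bar> powr (2 * \<gamma>)) \<le> left_deriv f (exp (?X x)) * r"
    by (simp add: abs_le_iff flip: abs_mult)
  moreover have "left_deriv f (exp (?X x)) * (exp (?X ?y) - exp (?X x)) =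
     integrand x * (B ?y - B x) + left_deriv f (exp (?X x)) * r"
  proof -
    define q where "q = (T - x) / T"
    show ?thesis unfolding r_def integrand_def q_def[symmetric] by (simp add: algebra_simps)
  qed
  moreover have "left_deriv f (exp (?X x)) * (exp (?X ?y) - exp (?X x)) \<le> f (exp (?X ?y)) - f (exp (?X x))"
    by (rule left_deriv_subgradient[OF f])
  ultimately show ?thesis unfolding cx by linarith
qed

text \<open>\<open>hh\<close> is compared with \<open>integrand\<close> only inside
  \<open>(0, t)\<close>, which lets the integrand of the theorem be inserted without change.\<close>

theorem chain_rule:
  assumes inc: "integrable (lborel \<Otimes>\<^sub>M lborel)
      (\<lambda>(x, s). indicator {0<..<t} x * marchaud_inc (\<lambda>x. indicator {0<..<t} x * integrand x) x s)"
    and hh: "\<And>x. x \<in> {0<..<t} \<Longrightarrow> hh x = integrand x"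
  shows "set_integrable lebesgue {0..t} (gls_integrand (1/2) hh B t)"
    and "(LINT x:{0..t}|lebesgue. gls_integrand (1/2) hh B t x) =
      f (exp (log_average t)) - f (exp (log_average 0))"
proof -
  define h where "h x = indicator {0<..<t} x * integrand x" for x
  define k where "k x = B t - B (clip x)" for x
  define \<phi> where "\<phi> x = f (exp (log_average (clip x)))" for x
  have \<phi>: "continuous_on UNIV \<phi>"
    unfolding \<phi>_def
    by (intro continuous_on_compose_clip continuous_on_compose2[OF continuous_on_convex_real[OF f, of UNIV]]
      continuous_intros log_average_continuous) auto
  have k_increment: "\<bar>k x - k y\<bar> \<le> C * \<bar>x - y\<bar> powr \<gamma>" for x y
  proof -
    have "\<bar>k x - k y\<bar> \<le> C * \<bar>clip x - clip y\<bar> powr \<gamma>"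
      using hoelder[OF clip(1)[of x] clip(1)[of y]] by (simp add: k_def abs_minus_commute)
    also have "\<dots> \<le> C * \<bar>x - y\<bar> powr \<gamma>"
      using clip(3)[of x y] C_nonneg \<gamma> by (intro mult_left_mono powr_mono2) auto
    finally show ?thesis .
  qed
  \<comment> \<open>\<open>C * (1 + t powr \<gamma>)\<close> dominates both the Hoelder constant
    \<open>C\<close> and the bound \<open>C * t powr \<gamma>\<close> of \<open>k\<close>.\<close>
  interpret hoelder_integrator t "\<Psi> * exp N" h k "C * (1 + t powr \<gamma>)" \<gamma>
  proof
    show "0 < t" by (rule t)
    show "h \<in> borel_measurable borel" unfolding h_def by measurable
    show "\<bar>h x\<bar> \<le> \<Psi> * exp N" for x
      using integrand_bounded[of x] t by (auto simp: h_def indicator_def \<Psi>_def)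
    show "h x = 0" if "x \<notin> {0<..<t}" for x using that by (simp add: h_def)
    show "integrable (lborel \<Otimes>\<^sub>M lborel) (\<lambda>(x, s). indicator {0<..<t} x * marchaud_inc h x s)"
      using inc unfolding h_def .
    show "1/2 < \<gamma>" by (rule \<gamma>)
    show "k x = 0" if "t \<le> x" for x using that t by (simp add: k_def clip_def)
    show "\<bar>k x\<bar> \<le> C * (1 + t powr \<gamma>)" for x
    proof -
      have "\<bar>k x\<bar> \<le> C * \<bar>t - clip x\<bar> powr \<gamma>"
        using hoelder[of t "clip x"] clip(1)[of x] t by (simp add: k_def)
      also have "\<dots> \<le> C * t powr \<gamma>"
        using clip(2)[of x] C_nonneg \<gamma> by (intro mult_left_mono powr_mono2) auto
      also have "\<dots> \<le> C * (1 + t powr \<gamma>)" using C_nonneg by (intro mult_left_mono) auto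
      finally show ?thesis .
    qed
    show "\<bar>k x - k y\<bar> \<le> C * (1 + t powr \<gamma>) * \<bar>x - y\<bar> powr \<gamma>" for x y
    proof -
      have "C * \<bar>x - y\<bar> powr \<gamma> \<le> C * (1 + t powr \<gamma>) * \<bar>x - y\<bar> powr \<gamma>"
        using C_nonneg by (intro mult_right_mono) (auto simp: algebra_simps)
      then show ?thesis using k_increment[of x y] by linarith
    qed
    show "k \<in> borel_measurable borel"
      unfolding k_def
      by (intro borel_measurable_continuous_onI continuous_intros continuous_on_compose_clip B_continuous)
  qed
  have B_lim: "(B \<longlongrightarrow> B t) (at_left t)"
  proof -
    have "(B \<longlongrightarrow> B t) (at t within {0..t})"
      using continuous_on_subset[OF B_continuous, of "{0..t}"] t by (auto simp: continuous_on_def)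
    then show ?thesis using t by (simp add: at_within_Icc_at_left)
  qed
  have hh_h: "hh x = h x" if "x \<in> {0<..<t}" for x
    using hh that by (simp add: h_def)
  have k_B: "k x = B t - B x" if "x \<in> {0<..t}" for x
    using that by (simp add: k_def clip(4))
  note gls = gls_integral_eq[OF hh_h k_B B_lim]
  show "set_integrable lebesgue {0..t} (gls_integrand (1/2) hh B t)"
    by (rule gls)
  define I where "I = 1 / pi * (LINT x|lborel. marchaud t h x * marchaud (t + 1) reflected (t - x))"
  define J where "J e = (LINT x|lborel. h x * (k x - k (x + e)))" for e
  define Q where "Q e = integral {0..t} (\<lambda>x. \<phi> (x + e) - \<phi> x)" for e
  have J_le_Q: "J e - t * \<Psi> * K * \<bar>e\<bar> powr (2 * \<gamma>) \<le> Q e" for e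
  proof -
    have cont: "continuous_on {0..t} (\<lambda>x. \<phi> (x + e) - \<phi> x)"
      by (intro continuous_on_diff continuous_on_compose2[OF \<phi>] continuous_intros) auto
    have int_Q: "integrable lborel (\<lambda>x. indicator {0..t} x *\<^sub>R (\<phi> (x + e) - \<phi> x))"
      by (rule borel_integrable_compact[OF _ cont]) simp
    have Q: "Q e = (LINT x|lborel. indicator {0..t} x *\<^sub>R (\<phi> (x + e) - \<phi> x))"
      using set_borel_integral_eq_integral(2)[of "{0..t}" "\<lambda>x. \<phi> (x + e) - \<phi> x"] int_Q
      by (simp add: Q_def set_integrable_def set_lebesgue_integral_def)
    have int_J: "integrable lborel (\<lambda>x. h x * (k x - k (x + e)))"
    proof (rule Bochner_Integration.integrable_bound)
      show "integrable lborel (\<lambda>x. (C * \<bar>e\<bar> powr \<gamma>) * h x)"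
        by (intro integrable_mult_right h_integrable)
      show "AE x in lborel. norm (h x * (k x - k (x + e))) \<le> norm ((C * \<bar>e\<bar> powr \<gamma>) * h x)"
      proof (rule AE_I2)
        fix x
        have "\<bar>k x - k (x + e)\<bar> \<le> C * \<bar>e\<bar> powr \<gamma>"
          using k_increment[of x "x + e"] by simp
        then have "\<bar>k x - k (x + e)\<bar> * \<bar>h x\<bar> \<le> C * \<bar>e\<bar> powr \<gamma> * \<bar>h x\<bar>"
          by (rule mult_right_mono) simp
        then show "norm (h x * (k x - k (x + e))) \<le> norm ((C * \<bar>e\<bar> powr \<gamma>) * h x)"
          using hoelder_path.C_nonneg[OF hoelder_path_axioms] by (simp add: abs_mult mult.commute)
      qed
    qed simp
    have int_c: "integrable lborel (\<lambda>x. indicator {0..t} x * (\<Psi> * K * \<bar>e\<bar> powr (2 * \<gamma>)))"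
      using t by (intro integrable_mult_left integrable_real_indicator) auto
    have "J e - t * \<Psi> * K * \<bar>e\<bar> powr (2 * \<gamma>) =
        (LINT x|lborel. h x * (k x - k (x + e)) - indicator {0..t} x * (\<Psi> * K * \<bar>e\<bar> powr (2 * \<gamma>)))"
      using int_J int_c t by (simp add: J_def)
    also have "\<dots> \<le> Q e"
      unfolding Q
    proof (rule integral_mono_AE)
      show "integrable lborel (\<lambda>x. h x * (k x - k (x + e)) - indicator {0..t} x * (\<Psi> * K * \<bar>e\<bar> powr (2 * \<gamma>)))"
        using int_J int_c by simp
      show "integrable lborel (\<lambda>x. indicator {0..t} x *\<^sub>R (\<phi> (x + e) - \<phi> x))" by (rule int_Q)
      have "AE x in lborel. x \<notin> {0, t}"
        by (intro AE_not_in finite_imp_null_set_lborel) simp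
      then show "AE x in lborel. h x * (k x - k (x + e)) - indicator {0..t} x * (\<Psi> * K * \<bar>e\<bar> powr (2 * \<gamma>)) \<le>
          indicator {0..t} x *\<^sub>R (\<phi> (x + e) - \<phi> x)"
      proof eventually_elim
        case (elim x)
        then show ?case
          using increment_le[of x e] by (cases "x \<in> {0..t}") (auto simp: h_def k_def \<phi>_def)
      qed
    qed
    finally show ?thesis .
  qed
  \<comment> \<open>Starting at 1/2 keeps every step strictly below 1, as the limit theorems
    require.\<close>
  define e :: "nat \<Rightarrow> real" where "e n = 1 / (2 + real n)" for n
  have e: "0 < e n" "e n < 1" for n by (auto simp: e_def)
  have e_lim: "e \<longlonglongrightarrow> 0" unfolding e_def by real_asymp
  have err: "(\<lambda>n. t * \<Psi> * K * e n powr (2 * \<gamma> - 1)) \<longlonglongrightarrow> 0"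
    using \<gamma> e e_lim by (auto intro!: tendsto_eq_intros tendsto_powr' simp: less_imp_le)
  have err_eq: "t * \<Psi> * K * \<bar>e n\<bar> powr (2 * \<gamma>) = (t * \<Psi> * K * e n powr (2 * \<gamma> - 1)) * e n" for n
    using e[of n] by (simp add: powr_diff)
  have "I \<le> \<phi> t - \<phi> 0"
  proof (rule LIMSEQ_le)
    show "(\<lambda>n. Q (e n) / e n) \<longlonglongrightarrow> \<phi> t - \<phi> 0"
      unfolding Q_def using e e_lim
      by (intro integral_increment_quotient_tendsto \<phi> t) (auto simp: less_imp_neq[symmetric] abs_less_iff intro: less_trans[of _ 0])
    show "(\<lambda>n. J (e n) / e n - t * \<Psi> * K * e n powr (2 * \<gamma> - 1)) \<longlonglongrightarrow> I"
    proof -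
      have "(\<lambda>n. J (e n) / e n) \<longlonglongrightarrow> I"
        unfolding J_def I_def using e e_lim
        by (intro integral_increment_tendsto) (auto simp: less_imp_neq[symmetric] abs_less_iff intro: less_trans[of _ 0])
      from tendsto_diff[OF this err] show ?thesis by simp
    qed
    show "\<exists>N. \<forall>n\<ge>N. J (e n) / e n - t * \<Psi> * K * e n powr (2 * \<gamma> - 1) \<le> Q (e n) / e n"
      using J_le_Q[of "e _"] e by (auto simp: err_eq pos_le_divide_eq left_diff_distrib less_imp_neq[symmetric])
  qed
  moreover have "\<phi> t - \<phi> 0 \<le> I"
  proof (rule LIMSEQ_le)
    have m: "- e n \<noteq> 0" "\<bar>- e n\<bar> < 1" for n using e[of n] by auto
    have m_lim: "(\<lambda>n. - e n) \<longlonglongrightarrow> 0" using tendsto_minus[OF e_lim] by simp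
    show "(\<lambda>n. Q (- e n) / (- e n)) \<longlonglongrightarrow> \<phi> t - \<phi> 0"
      unfolding Q_def by (rule integral_increment_quotient_tendsto[OF \<phi> t(1) m m_lim])
    have "(\<lambda>n. J (- e n) / (- e n)) \<longlonglongrightarrow> I"
      unfolding J_def I_def by (rule integral_increment_tendsto[OF m m_lim])
    from tendsto_add[OF this err] show "(\<lambda>n. J (- e n) / (- e n) + t * \<Psi> * K * e n powr (2 * \<gamma> - 1)) \<longlonglongrightarrow> I"
      by simp
    have "Q (- e n) / (- e n) \<le> J (- e n) / (- e n) + t * \<Psi> * K * e n powr (2 * \<gamma> - 1)" for n
    proof -
      have "J (- e n) - (t * \<Psi> * K * e n powr (2 * \<gamma> - 1)) * e n \<le> Q (- e n)"
        using J_le_Q[of "- e n"] err_eq[of n] by simp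
      then show ?thesis using e[of n] by (simp add: field_simps)
    qed
    then show "\<exists>N. \<forall>n\<ge>N. Q (- e n) / (- e n) \<le> J (- e n) / (- e n) + t * \<Psi> * K * e n powr (2 * \<gamma> - 1)"
      by blast
  qed
  ultimately have "I = \<phi> t - \<phi> 0" by simp
  moreover have "(LINT x:{0..t}|lebesgue. gls_integrand (1/2) hh B t x) = I"
    unfolding I_def by (rule gls(2))
  ultimately show "(LINT x:{0..t}|lebesgue. gls_integrand (1/2) hh B t x) =
      f (exp (log_average t)) - f (exp (log_average 0))"
    using t by (simp add: \<phi>_def clip_def)
qed

end

section \<open>Membership in the Besov space\<close>

text \<open>Freezing outside \<open>[- n, n]\<close> produces a bounded monotone function of total
  variation at most \<open>\<psi> n - \<psi> (- n)\<close>, whose oscillations are integrable over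
  the line.\<close>

definition truncated :: "(real \<Rightarrow> real) \<Rightarrow> nat \<Rightarrow> real \<Rightarrow> real" where
  "truncated \<psi> n x = \<psi> (max (- real n) (min (real n) x))"

definition oscillation :: "(real \<Rightarrow> real) \<Rightarrow> nat \<Rightarrow> real \<Rightarrow> real \<Rightarrow> real" where
  "oscillation \<psi> n \<epsilon> x = truncated \<psi> n (x + \<epsilon>) - truncated \<psi> n (x - \<epsilon>)"

text \<open>A majorant for the part of the increments of the integrand caused by jumps of the left
  derivative. The number \<open>n\<close> stands in for two path-dependent constants, the bound
  \<open>N\<close> and the Hoelder constant \<open>2 * C\<close>, so that an expectation can be
  taken.\<close>

definition crossing_density ::
    "real \<Rightarrow> real \<Rightarrow> (real \<Rightarrow> real) \<Rightarrow> nat \<Rightarrow> (real \<Rightarrow> real) \<Rightarrow> real \<times> real \<Rightarrow> real" where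
  "crossing_density T \<gamma> \<psi> n X = (\<lambda>(x, s). if 0 < s \<and> s < x \<and> x < T
     then (T - x) / T * oscillation \<psi> n (real n * (x - s) powr \<gamma>) (X x) * (x - s) powr (-3/2) else 0)"

lemma truncated_mono: "mono \<psi> \<Longrightarrow> mono (truncated \<psi> n)"
  unfolding truncated_def by (intro monoI) (auto elim!: monoD)

lemma truncated_measurable [measurable]: "mono \<psi> \<Longrightarrow> truncated \<psi> n \<in> borel_measurable borel"
  by (intro borel_measurable_mono truncated_mono)

lemma oscillation_nonneg: "mono \<psi> \<Longrightarrow> 0 \<le> \<epsilon> \<Longrightarrow> 0 \<le> oscillation \<psi> n \<epsilon> x"
  using monoD[OF truncated_mono, of \<psi> "x - \<epsilon>" "x + \<epsilon>" n] by (simp add: oscillation_def)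

lemma abs_diff_le_oscillation:
  assumes \<psi>: "mono \<psi>" and xy: "\<bar>x\<bar> \<le> real n" "\<bar>y\<bar> \<le> real n" "\<bar>x - y\<bar> \<le> \<epsilon>"
  shows "\<bar>\<psi> x - \<psi> y\<bar> \<le> oscillation \<psi> n \<epsilon> x"
proof -
  have t: "\<psi> x = truncated \<psi> n x" "\<psi> y = truncated \<psi> n y"
    using xy by (simp_all add: truncated_def)
  have "truncated \<psi> n (x - \<epsilon>) \<le> truncated \<psi> n z \<and> truncated \<psi> n z \<le> truncated \<psi> n (x + \<epsilon>)"
    if "z \<in> {x, y}" for z
    using that xy by (intro conjI monoD[OF truncated_mono[OF \<psi>]]) auto
  from this[of x] this[of y] show ?thesis unfolding t oscillation_def by simp linarith
qed

context convex_chain_rule begin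

abbreviation \<psi> :: "real \<Rightarrow> real" where "\<psi> x \<equiv> left_deriv f (exp x)"

lemma \<psi>_mono: "mono (\<lambda>x. left_deriv f (exp x))"
  by (intro monoI monoD[OF left_deriv_mono[OF f]]) simp

text \<open>The product is split so that the increment of the left derivative, the only irregular
  one, carries the factor \<open>(T - x) / T\<close> at the same time \<open>x\<close> at which
  \<open>log_average\<close> enters the oscillation. This is what later cancels the singular density
  bound; the two other terms are Hoelder.\<close>

lemma integrand_diff_le:
  assumes n: "N \<le> real n" "2 * C \<le> real n" and sx: "0 < s" "s < x" "x < T"
  shows "\<bar>integrand x - integrand s\<bar> \<le>
    exp N * ((T - x) / T * oscillation (\<lambda>x. left_deriv f (exp x)) n (real n * (x - s) powr \<gamma>) (log_average x)) +
    \<Psi> * exp N * (2 * C + T powr (- \<gamma>)) * (x - s) powr \<gamma>"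
proof -
  let ?X = log_average and ?a = "\<lambda>x. (T - x) / T"
  have x: "x \<in> {0..T}" and s: "s \<in> {0..T}" using sx by auto
  have X: "\<bar>?X x\<bar> \<le> N" "\<bar>?X s\<bar> \<le> N" "\<bar>?X x - ?X s\<bar> \<le> 2 * C * (x - s) powr \<gamma>"
    using log_average_bounded[OF x] log_average_bounded[OF s] log_average_hoelder[OF x s] sx by auto
  have "2 * C * (x - s) powr \<gamma> \<le> real n * (x - s) powr \<gamma>"
    using n by (intro mult_right_mono) auto
  then have osc: "\<bar>\<psi> (?X x) - \<psi> (?X s)\<bar> \<le> oscillation (\<lambda>x. \<psi> x) n (real n * (x - s) powr \<gamma>) (?X x)"
    using X n by (intro abs_diff_le_oscillation \<psi>_mono) auto
  have 1: "\<bar>exp (?X x) * (?a x * (\<psi> (?X x) - \<psi> (?X s)))\<bar> \<le>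
      exp N * (?a x * oscillation (\<lambda>x. \<psi> x) n (real n * (x - s) powr \<gamma>) (?X x))"
    unfolding abs_mult using X x osc T_pos by (intro mult_mono) auto
  have 2: "\<bar>?a x * \<psi> (?X s) * (exp (?X x) - exp (?X s))\<bar> \<le> 1 * \<Psi> * (exp N * (2 * C * (x - s) powr \<gamma>))"
  proof -
    have "\<bar>exp (?X x) - exp (?X s)\<bar> \<le> exp N * \<bar>?X x - ?X s\<bar>"
      by (rule abs_exp_diff_le) (use X in auto)
    also have "\<dots> \<le> exp N * (2 * C * (x - s) powr \<gamma>)" using X by (intro mult_left_mono) auto
    finally show ?thesis
      unfolding abs_mult using x T_pos left_deriv_bounded[OF s] by (intro mult_mono) auto
  qed
  have 3: "\<bar>(x - s) / T * (\<psi> (?X s) * exp (?X s))\<bar> \<le> T powr (- \<gamma>) * (x - s) powr \<gamma> * (\<Psi> * exp N)"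
  proof -
    \<comment> \<open>The ratio is below 1 and \<gamma> is at most 1, so lowering the exponent
      increases the power.\<close>
    have "(x - s) / T = ((x - s) / T) powr 1" using sx by simp
    also have "\<dots> \<le> ((x - s) / T) powr \<gamma>"
      using sx \<gamma> by (intro powr_mono') auto
    also have "\<dots> = T powr (- \<gamma>) * (x - s) powr \<gamma>"
      using sx by (simp add: powr_divide powr_minus_divide)
    finally have "\<bar>(x - s) / T\<bar> \<le> T powr (- \<gamma>) * (x - s) powr \<gamma>" using sx by simp
    then show ?thesis
      unfolding abs_mult[of _ "_ * _"] abs_mult[of "\<psi> _"]
      using left_deriv_bounded[OF s] X by (intro mult_mono) (auto simp: \<Psi>_def)
  qed
  have triangle: "\<bar>p\<bar> \<le> P \<Longrightarrow> \<bar>q\<bar> \<le> Q \<Longrightarrow> \<bar>r\<bar> \<le> R \<Longrightarrow> \<bar>p + q - r\<bar> \<le> P + (Q + R)" for p q r P Q R :: real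
    by linarith
  have eq1: "integrand x - integrand s = exp (?X x) * (?a x * (\<psi> (?X x) - \<psi> (?X s))) +
      ?a x * \<psi> (?X s) * (exp (?X x) - exp (?X s)) - (x - s) / T * (\<psi> (?X s) * exp (?X s))"
  proof -
    have "(x - s) / T = ?a s - ?a x" by (simp add: diff_divide_distrib)
    then show ?thesis
      unfolding integrand_def by (simp only:) (simp add: algebra_simps del: times_divide_eq_left times_divide_eq_right)
  qed
  have eq2: "\<Psi> * exp N * (2 * C + T powr (- \<gamma>)) * (x - s) powr \<gamma> =
     1 * \<Psi> * (exp N * (2 * C * (x - s) powr \<gamma>)) + T powr (- \<gamma>) * (x - s) powr \<gamma> * (\<Psi> * exp N)"
    by (simp add: algebra_simps)
  show ?thesis unfolding eq1 eq2 by (rule triangle[OF 1 2 3])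
qed

text \<open>After division by the singular power the Hoelder terms leave
  \<open>(x - s) powr (\<gamma> - 3/2)\<close>, integrable since \<gamma> exceeds 1/2. Finiteness of
  the crossing integral handles the rest.\<close>

lemma inc_integrable_if_crossing:
  assumes n: "N \<le> real n" "2 * C \<le> real n"
    and fin: "(\<integral>\<^sup>+p. crossing_density T \<gamma> (\<lambda>x. left_deriv f (exp x)) n log_average p \<partial>lborel) < \<infinity>"
  shows "integrable (lborel \<Otimes>\<^sub>M lborel)
    (\<lambda>(x, s). indicator {0<..<T} x * marchaud_inc (\<lambda>x. indicator {0<..<T} x * integrand x) x s)"
proof -
  interpret full: convex_chain_rule T C \<gamma> B f T
    by unfold_locales (use f T_pos in auto)
  define Z where "Z = crossing_density T \<gamma> (\<lambda>x. left_deriv f (exp x)) n log_average"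
  define P where "P = (\<lambda>(x, s). indicator {0<..<T} x * marchaud_inc (\<lambda>x. indicator {0<..<T} x * integrand x) x s)"
  define Q where "Q = (\<lambda>(x, s). indicator {0<..<T} x * (indicator {0<..<x} s * (x - s) powr (\<gamma> - 3/2)))"
  define D where "D = \<Psi> * exp N * (2 * C + T powr (- \<gamma>))"
  have D: "0 \<le> D" using C_nonneg by (simp add: D_def \<Psi>_def)
  have [measurable]: "P \<in> borel_measurable (lborel \<Otimes>\<^sub>M lborel)"
    unfolding P_def by measurable
  \<comment> \<open>\<open>B\<close> is unrestricted outside \<open>[0, T]\<close>, so only the
    cut-off average can be shown to be Borel measurable.\<close>
  have [measurable]: "(\<lambda>x. if 0 < x \<and> x < T then log_average x else 0) \<in> borel_measurable borel"
  proof -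
    have [measurable]: "(\<lambda>x. log_average (full.clip x)) \<in> borel_measurable borel"
      by (intro borel_measurable_continuous_onI full.continuous_on_compose_clip log_average_continuous)
    have "(\<lambda>x. if 0 < x \<and> x < T then log_average x else 0) =
        (\<lambda>x. if 0 < x \<and> x < T then log_average (full.clip x) else 0)"
      using full.clip(4) by auto
    then show ?thesis by simp
  qed
  have [measurable]: "truncated (\<lambda>x. left_deriv f (exp x)) n \<in> borel_measurable borel"
    by (rule truncated_measurable[OF \<psi>_mono])
  have "Z = (\<lambda>(x, s). if 0 < s \<and> s < x \<and> x < T then (T - x) / T *
      oscillation (\<lambda>x. left_deriv f (exp x)) n (real n * (x - s) powr \<gamma>)
        (if 0 < x \<and> x < T then log_average x else 0) * (x - s) powr (-3/2) else 0)"
    by (auto simp: Z_def crossing_density_def fun_eq_iff)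
  also have "\<dots> \<in> borel_measurable (lborel \<Otimes>\<^sub>M lborel)"
    unfolding oscillation_def by measurable
  finally have [measurable]: "Z \<in> borel_measurable (lborel \<Otimes>\<^sub>M lborel)" .
  have Z_nonneg: "0 \<le> Z p" for p
    using T_pos oscillation_nonneg[OF \<psi>_mono]
    by (auto simp: Z_def crossing_density_def split: prod.split)
  have Z_int: "integrable (lborel \<Otimes>\<^sub>M lborel) Z"
  proof (rule integrableI_nonneg)
    show "(\<integral>\<^sup>+p. ennreal (Z p) \<partial>(lborel \<Otimes>\<^sub>M lborel)) < \<infinity>"
      using fin by (simp add: Z_def lborel_prod)
  qed (use Z_nonneg in auto)
  have Q_int: "integrable (lborel \<Otimes>\<^sub>M lborel) Q"
  proof (rule lborel_pair.Fubini_integrable)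
    show "Q \<in> borel_measurable (lborel \<Otimes>\<^sub>M lborel)"
    proof -
      have "Q = (\<lambda>(x, s). if 0 < s \<and> s < x \<and> x < T then (x - s) powr (\<gamma> - 3/2) else 0)"
        by (auto simp: Q_def fun_eq_iff)
      also have "\<dots> \<in> borel_measurable (lborel \<Otimes>\<^sub>M lborel)" by measurable
      finally show ?thesis .
    qed
    have hb: "has_bochner_integral lborel (\<lambda>s. indicator {0<..<x} s * (x - s) powr (\<gamma> - 3/2))
        (max 0 x powr (\<gamma> - 1/2) / (\<gamma> - 1/2))" for x
      using has_bochner_integral_powr_reflect[of "\<gamma> - 3/2" x] \<gamma> by (simp add: algebra_simps)
    have "(LINT s|lborel. norm (Q (x, s))) = indicator {0<..<T} x * (max 0 x powr (\<gamma> - 1/2) / (\<gamma> - 1/2))" for x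
      using hb[of x] by (simp add: Q_def has_bochner_integral_iff abs_mult)
    moreover have "integrable lborel (\<lambda>x. indicator {0<..<T} x * (max 0 x powr (\<gamma> - 1/2) / (\<gamma> - 1/2)))"
    proof (rule Bochner_Integration.integrable_bound)
      show "integrable lborel (\<lambda>x. indicator {0<..<T} x * (T powr (\<gamma> - 1/2) / (\<gamma> - 1/2)))"
        using T_pos by (intro integrable_mult_left integrable_real_indicator) auto
      show "AE x in lborel. norm (indicator {0<..<T} x * (max 0 x powr (\<gamma> - 1/2) / (\<gamma> - 1/2))) \<le>
          norm (indicator {0<..<T} x * (T powr (\<gamma> - 1/2) / (\<gamma> - 1/2)))"
        using \<gamma> by (intro AE_I2) (auto simp: indicator_def intro!: divide_right_mono powr_mono2)
    qed simp
    ultimately show "integrable lborel (\<lambda>x. LINT s|lborel. norm (Q (x, s)))" by simp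
    show "AE x in lborel. integrable lborel (\<lambda>s. Q (x, s))"
      using hb by (auto simp: Q_def has_bochner_integral_iff)
  qed
  have "integrable (lborel \<Otimes>\<^sub>M lborel) P"
  proof (rule Bochner_Integration.integrable_bound)
    show "integrable (lborel \<Otimes>\<^sub>M lborel) (\<lambda>p. exp N * Z p + D * Q p)"
      by (intro Bochner_Integration.integrable_add integrable_mult_right Z_int Q_int)
    have "\<bar>P p\<bar> \<le> exp N * Z p + D * Q p" for p
    proof (cases p)
      case (Pair x s)
      show ?thesis
      proof (cases "0 < s \<and> s < x \<and> x < T")
        case True
        then have "\<bar>integrand x - integrand s\<bar> * (x - s) powr (-3/2) \<le>
          (exp N * ((T - x) / T * oscillation (\<lambda>x. left_deriv f (exp x)) n (real n * (x - s) powr \<gamma>) (log_average x)) +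
             D * (x - s) powr \<gamma>) * (x - s) powr (-3/2)"
          unfolding D_def by (intro mult_right_mono integrand_diff_le n) auto
        moreover have "(x - s) powr \<gamma> * (x - s) powr (-3/2) = (x - s) powr (\<gamma> - 3/2)"
          by (simp flip: powr_add)
        ultimately show ?thesis using True
          by (simp add: Pair P_def Z_def Q_def crossing_density_def marchaud_inc_def abs_mult distrib_right mult.assoc)
      qed (use Z_nonneg[of p] D in \<open>auto simp: Pair P_def Q_def marchaud_inc_def indicator_def\<close>)
    qed
    then show "AE p in lborel \<Otimes>\<^sub>M lborel. norm (P p) \<le> norm (exp N * Z p + D * Q p)"
      by (intro AE_I2) (auto intro: order_trans[OF _ abs_ge_self])
  qed simp
  then show ?thesis unfolding P_def .
qed

text \<open>For \<open>x < t\<close> the increments compare only points below \<open>t\<close>, so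
  both cut-offs give the same values there. It links the \<open>W2\<close> estimate on
  \<open>[0, T]\<close> to the chain rule on \<open>[0, t]\<close>.\<close>

lemma inc_integrable_restrict:
  assumes "integrable (lborel \<Otimes>\<^sub>M lborel)
    (\<lambda>(x, s). indicator {0<..<T} x * marchaud_inc (\<lambda>x. indicator {0<..<T} x * integrand x) x s)"
  shows "integrable (lborel \<Otimes>\<^sub>M lborel)
    (\<lambda>(x, s). indicator {0<..<t} x * marchaud_inc (\<lambda>x. indicator {0<..<t} x * integrand x) x s)"
proof (rule Bochner_Integration.integrable_bound[OF assms])
  show "AE p in lborel \<Otimes>\<^sub>M lborel.
      norm (case p of (x, s) \<Rightarrow> indicator {0<..<t} x * marchaud_inc (\<lambda>x. indicator {0<..<t} x * integrand x) x s) \<le>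
      norm (case p of (x, s) \<Rightarrow> indicator {0<..<T} x * marchaud_inc (\<lambda>x. indicator {0<..<T} x * integrand x) x s)"
    using t by (intro AE_I2) (auto simp: marchaud_inc_def indicator_def)
qed measurable

text \<open>The definition of the integral asks for \<open>W2\<close> on all of
  \<open>[0, T]\<close>, also when \<open>t < T\<close>. The single integral is finite because the
  integrand is bounded and \<open>x powr (-1/2)\<close> is integrable at 0; the end points, where
  the cut-off matters, form a null set.\<close>

lemma integrand_in_W2:
  assumes int: "integrable (lborel \<Otimes>\<^sub>M lborel)
    (\<lambda>(x, s). indicator {0<..<T} x * marchaud_inc (\<lambda>x. indicator {0<..<T} x * integrand x) x s)"
    and hh: "\<And>x. x \<in> {0..T} \<Longrightarrow> hh x = integrand x"
  shows "hh \<in> W2 (1/2) T"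
proof -
  interpret full: convex_chain_rule T C \<gamma> B f T
    by unfold_locales (use f T_pos in auto)
  have [measurable]: "(\<lambda>x. log_average (full.clip x)) \<in> borel_measurable borel"
    by (intro borel_measurable_continuous_onI full.continuous_on_compose_clip log_average_continuous)
  have "(\<lambda>x. (T - x) / T * left_deriv f (exp (log_average (full.clip x))) * exp (log_average (full.clip x)))
      \<in> borel_measurable (lebesgue_on {0..T})"
    by (intro measurable_restrict_space1 measurable_completion) measurable
  then have meas: "hh \<in> borel_measurable (lebesgue_on {0..T})"
    by (rule measurable_cong[THEN iffD1, rotated])
      (use hh full.clip(4) in \<open>auto simp: integrand_def\<close>)
  define \<Phi> where "\<Phi> = (\<lambda>(x, s). indicator {0<..<T} x * marchaud_inc (\<lambda>x. indicator {0<..<T} x * integrand x) x s)"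
  have inner: "(\<integral>\<^sup>+s\<in>{0..x}. ennreal (\<bar>hh x - hh s\<bar> / (x - s) powr (1/2 + 1)) \<partial>lebesgue) =
      (\<integral>\<^sup>+s. ennreal \<bar>\<Phi> (x, s)\<bar> \<partial>lborel)" if x: "x \<in> {0<..<T}" for x
    unfolding nn_integral_completion
  proof (rule nn_integral_cong_AE)
    have "AE s in lborel. s \<notin> {0, x}"
      by (intro AE_not_in finite_imp_null_set_lborel) simp
    then show "AE s in lborel. ennreal (\<bar>hh x - hh s\<bar> / (x - s) powr (1/2 + 1)) * indicator {0..x} s = ennreal \<bar>\<Phi> (x, s)\<bar>"
    proof eventually_elim
      case (elim s)
      show ?case
      proof (cases "0 < s \<and> s < x")
        case True
        then show ?thesis using x hh[of s] hh[of x]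
          by (simp add: \<Phi>_def marchaud_inc_def abs_mult powr_minus_divide)
      qed (use elim in \<open>auto simp: \<Phi>_def marchaud_inc_def indicator_def\<close>)
    qed
  qed
  have "(\<integral>\<^sup>+x\<in>{0..T}. (\<integral>\<^sup>+s\<in>{0..x}. ennreal (\<bar>hh x - hh s\<bar> / (x - s) powr (1/2 + 1)) \<partial>lebesgue) \<partial>lebesgue) =
      (\<integral>\<^sup>+x. (\<integral>\<^sup>+s. ennreal \<bar>\<Phi> (x, s)\<bar> \<partial>lborel) \<partial>lborel)"
    unfolding nn_integral_completion[of lborel "\<lambda>x. _ x * indicator {0..T} x"]
  proof (rule nn_integral_cong_AE)
    have "AE x in lborel. x \<notin> {0, T}"
      by (intro AE_not_in finite_imp_null_set_lborel) simp
    then show "AE x in lborel. (\<integral>\<^sup>+s\<in>{0..x}. ennreal (\<bar>hh x - hh s\<bar> / (x - s) powr (1/2 + 1)) \<partial>lebesgue) * indicator {0..T} x =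
        (\<integral>\<^sup>+s. ennreal \<bar>\<Phi> (x, s)\<bar> \<partial>lborel)"
    proof eventually_elim
      case (elim x)
      then show ?case
        using inner[of x] by (cases "x \<in> {0..T}") (auto simp: \<Phi>_def)
    qed
  qed
  also have "\<dots> = (\<integral>\<^sup>+p. ennreal (norm (\<Phi> p)) \<partial>(lborel \<Otimes>\<^sub>M lborel))"
    using borel_measurable_integrable[OF int] by (subst lborel.nn_integral_fst[symmetric]) (auto simp: \<Phi>_def)
  also have "\<dots> < \<infinity>"
    using int unfolding \<Phi>_def integrable_iff_bounded by simp
  finally have fin2: "(\<integral>\<^sup>+x\<in>{0..T}. (\<integral>\<^sup>+s\<in>{0..x}. ennreal (\<bar>hh x - hh s\<bar> / (x - s) powr (1/2 + 1)) \<partial>lebesgue) \<partial>lebesgue) < \<infinity>" .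
  have hb: "has_bochner_integral lborel (\<lambda>x::real. indicator {0<..<T} x * x powr (-1/2)) (T powr (-1/2 + 1) / (-1/2 + 1))"
    by (rule has_bochner_integral_powr_from_0) (use T_pos in auto)
  have \<Psi>: "0 \<le> \<Psi> * exp N" by (simp add: \<Psi>_def)
  have "(\<integral>\<^sup>+x\<in>{0..T}. ennreal (\<bar>hh x\<bar> / x powr (1/2)) \<partial>lebesgue) \<le>
      (\<integral>\<^sup>+x. ennreal (\<Psi> * exp N * (indicator {0<..<T} x * x powr (-1/2))) \<partial>lborel)"
    unfolding nn_integral_completion
  proof (rule nn_integral_mono_AE)
    have "AE x in lborel. x \<notin> {0, T}"
      by (intro AE_not_in finite_imp_null_set_lborel) simp
    then show "AE x in lborel. ennreal (\<bar>hh x\<bar> / x powr (1/2)) * indicator {0..T} x \<le>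
        ennreal (\<Psi> * exp N * (indicator {0<..<T} x * x powr (-1/2)))"
    proof eventually_elim
      case (elim x)
      show ?case
      proof (cases "x \<in> {0<..<T}")
        case True
        then have "\<bar>hh x\<bar> \<le> \<Psi> * exp N" using hh[of x] integrand_bounded[of x] by simp
        then have "\<bar>hh x\<bar> / x powr (1/2) \<le> \<Psi> * exp N / x powr (1/2)" by (rule divide_right_mono) simp
        then show ?thesis using True by (simp add: powr_minus_divide ennreal_leI)
      qed (use elim in auto)
    qed
  qed
  also have "\<dots> = ennreal (LINT x|lborel. \<Psi> * exp N * (indicator {0<..<T} x * x powr (-1/2)))"
    using hb \<Psi> by (intro nn_integral_eq_integral integrable_mult_right) (auto simp: has_bochner_integral_iff)
  also have "\<dots> < \<infinity>" by simp
  finally show ?thesis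
    using fin2 meas by (simp add: W2_def W2_norm_def)
qed

end

section \<open>Density bounds\<close>

text \<open>The integrals of the two shifted copies cancel except on an interval of length
  \<open>2 * \<epsilon>\<close> at each end, where the truncated function is constant.\<close>

lemma oscillation_nn_integral_le:
  assumes \<psi>: "mono \<psi>" and \<epsilon>: "0 \<le> \<epsilon>"
  shows "(\<integral>\<^sup>+x. ennreal (oscillation \<psi> n \<epsilon> x) \<partial>lborel) \<le> ennreal (2 * \<epsilon> * (\<psi> (real n) - \<psi> (- real n)))"
proof -
  define g where "g = truncated \<psi> n"
  \<comment> \<open>Beyond \<open>R\<close> in either direction both \<open>x + \<epsilon>\<close>
    and \<open>x - \<epsilon>\<close> lie in the same constant piece, so the oscillation is
    0.\<close>
  define R where "R = real n + \<epsilon>"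
  have g_mono: "mono g" unfolding g_def by (rule truncated_mono[OF \<psi>])
  have int: "g integrable_on {a..b}" for a b
    by (rule integrable_on_mono_on) (use g_mono in \<open>auto simp: mono_on_def mono_def\<close>)
  have shift: "((\<lambda>x. g (x + c)) has_integral integral {-R + c..R + c} g) {-R..R}" for c
  proof -
    have "(g has_integral integral {-R + c..R + c} g) (cbox (-R + c) (R + c))"
      using integrable_integral[OF int[of "-R + c" "R + c"]] by simp
    then have "((g \<circ> (+) c) has_integral integral {-R + c..R + c} g) (cbox (-R) R)"
      by (subst has_integral_shift_cbox_iff) (simp add: add.commute)
    then show ?thesis by (simp add: o_def add.commute)
  qed
  have "((\<lambda>x. g (x + \<epsilon>) - g (x + - \<epsilon>)) has_integral
      integral {-R + \<epsilon>..R + \<epsilon>} g - integral {-R + - \<epsilon>..R + - \<epsilon>} g) {-R..R}"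
    by (intro has_integral_diff shift)
  moreover have "integral {-R + \<epsilon>..R + \<epsilon>} g - integral {-R + - \<epsilon>..R + - \<epsilon>} g = 2 * \<epsilon> * (\<psi> (real n) - \<psi> (- real n))"
  proof -
    have comb: "integral {a..b} g + integral {b..c} g = integral {a..c} g" if "a \<le> b" "b \<le> c" for a b c
      by (rule Henstock_Kurzweil_Integration.integral_combine[OF that int])
    have "integral {R - \<epsilon>..R + \<epsilon>} g = integral {R - \<epsilon>..R + \<epsilon>} (\<lambda>x. \<psi> (real n))"
      by (rule Henstock_Kurzweil_Integration.integral_cong) (auto simp: g_def truncated_def R_def min_def max_def)
    then have 1: "integral {R - \<epsilon>..R + \<epsilon>} g = 2 * \<epsilon> * \<psi> (real n)" using \<epsilon> by simp
    have "g x = \<psi> (- real n)" if "x \<le> - real n" for x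
    proof -
      have "min (real n) x = x" "max (- real n) x = - real n" using that by auto
      then show ?thesis by (simp add: g_def truncated_def)
    qed
    then have "integral {-R - \<epsilon>..-R + \<epsilon>} g = integral {-R - \<epsilon>..-R + \<epsilon>} (\<lambda>x. \<psi> (- real n))"
      by (intro Henstock_Kurzweil_Integration.integral_cong) (auto simp: R_def)
    then have 2: "integral {-R - \<epsilon>..-R + \<epsilon>} g = 2 * \<epsilon> * \<psi> (- real n)" using \<epsilon> by simp
    have R: "0 \<le> R" "\<epsilon> \<le> R" using \<epsilon> by (auto simp: R_def)
    have "integral {-R + \<epsilon>..R - \<epsilon>} g + integral {R - \<epsilon>..R + \<epsilon>} g = integral {-R + \<epsilon>..R + \<epsilon>} g"
      by (rule comb) (use R \<epsilon> in auto)
    moreover have "integral {-R - \<epsilon>..-R + \<epsilon>} g + integral {-R + \<epsilon>..R - \<epsilon>} g = integral {-R - \<epsilon>..R - \<epsilon>} g"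
      by (rule comb) (use R \<epsilon> in auto)
    ultimately show ?thesis using 1 2 by (simp add: algebra_simps)
  qed
  ultimately have "((\<lambda>x. oscillation \<psi> n \<epsilon> x) has_integral 2 * \<epsilon> * (\<psi> (real n) - \<psi> (- real n))) {-R..R}"
    by (simp add: oscillation_def g_def)
  then have "((\<lambda>x. if x \<in> {-R..R} then oscillation \<psi> n \<epsilon> x else 0) has_integral 2 * \<epsilon> * (\<psi> (real n) - \<psi> (- real n))) UNIV"
    by (simp only: has_integral_restrict_UNIV)
  moreover have "(\<lambda>x. if x \<in> {-R..R} then oscillation \<psi> n \<epsilon> x else 0) = oscillation \<psi> n \<epsilon>"
    using \<epsilon> by (auto simp: fun_eq_iff oscillation_def truncated_def R_def min_def max_def)
  ultimately have hi: "(oscillation \<psi> n \<epsilon> has_integral 2 * \<epsilon> * (\<psi> (real n) - \<psi> (- real n))) UNIV" by simp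
  have [measurable]: "oscillation \<psi> n \<epsilon> \<in> borel_measurable borel"
    using truncated_measurable[OF \<psi>, of n] unfolding oscillation_def [abs_def] by measurable
  show ?thesis
    using nn_integral_has_integral_lborel[OF _ _ hi] oscillation_nonneg[OF \<psi> \<epsilon>] by simp
qed

text \<open>Time is rounded down to the grid of width \<open>1 / Suc n\<close>. The rounded process
  uses countably many random variables and is jointly measurable; path continuity gives the
  pointwise limit.\<close>

lemma caratheodory_measurable:
  fixes Y :: "real \<Rightarrow> 'a \<Rightarrow> real"
  assumes meas: "\<And>t. Y t \<in> borel_measurable M"
    and cont: "\<And>\<omega>. \<omega> \<in> space M \<Longrightarrow> continuous_on UNIV (\<lambda>t. Y t \<omega>)"
  shows "(\<lambda>(t, \<omega>). Y t \<omega>) \<in> borel_measurable (borel \<Otimes>\<^sub>M M)"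
proof (rule borel_measurable_LIMSEQ_real)
  define u where "u n p = Y (real_of_int \<lfloor>real (Suc n) * fst p\<rfloor> / real (Suc n)) (snd p)" for n and p :: "real \<times> 'a"
  show "(\<lambda>n. u n p) \<longlonglongrightarrow> (case p of (t, \<omega>) \<Rightarrow> Y t \<omega>)" if p: "p \<in> space (borel \<Otimes>\<^sub>M M)" for p
  proof -
    obtain t \<omega> where p_eq: "p = (t, \<omega>)" by (cases p)
    then have \<omega>: "\<omega> \<in> space M" using p by (auto simp: space_pair_measure)
    have "(\<lambda>n. real_of_int \<lfloor>real (Suc n) * t\<rfloor> / real (Suc n)) \<longlonglongrightarrow> t"
    proof (rule LIMSEQ_I)
      fix r :: real assume "0 < r"
      then obtain N where N: "1 / real (Suc N) < r"
        using reals_Archimedean[of r] by (auto simp: inverse_eq_divide)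
      have "norm (real_of_int \<lfloor>real (Suc n) * t\<rfloor> / real (Suc n) - t) < r" if "N \<le> n" for n
      proof -
        have "\<bar>real_of_int \<lfloor>real (Suc n) * t\<rfloor> - real (Suc n) * t\<bar> \<le> 1" by linarith
        then have "\<bar>real_of_int \<lfloor>real (Suc n) * t\<rfloor> - real (Suc n) * t\<bar> / real (Suc n) \<le> 1 / real (Suc n)"
          by (rule divide_right_mono) simp
        moreover have "real_of_int \<lfloor>real (Suc n) * t\<rfloor> / real (Suc n) - t =
            (real_of_int \<lfloor>real (Suc n) * t\<rfloor> - real (Suc n) * t) / real (Suc n)"
          by (simp add: diff_divide_distrib)
        moreover have "1 / real (Suc n) \<le> 1 / real (Suc N)"
          using that by (intro divide_left_mono) auto
        ultimately show ?thesis using N by (simp only: real_norm_def abs_divide abs_of_nat)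
      qed
      then show "\<exists>no. \<forall>n\<ge>no. norm (real_of_int \<lfloor>real (Suc n) * t\<rfloor> / real (Suc n) - t) < r" by blast
    qed
    then have "(\<lambda>n. Y (real_of_int \<lfloor>real (Suc n) * t\<rfloor> / real (Suc n)) \<omega>) \<longlonglongrightarrow> Y t \<omega>"
      using cont[OF \<omega>] by (intro isCont_tendsto_compose[where g="\<lambda>t. Y t \<omega>"]) (auto simp: continuous_on_eq_continuous_at)
    then show ?thesis by (simp add: u_def p_eq)
  qed
  show "u n \<in> borel_measurable (borel \<Otimes>\<^sub>M M)" for n
  proof -
    have "(\<lambda>p. Y (real_of_int \<lfloor>real (Suc n) * fst p\<rfloor> / real (Suc n)) (snd p))
        \<in> borel_measurable (borel \<Otimes>\<^sub>M M)"
    proof (rule measurable_compose_countable[where f="\<lambda>i p. Y (real_of_int i / real (Suc n)) (snd p)"])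
      show "(\<lambda>p. Y (real_of_int i / real (Suc n)) (snd p)) \<in> borel_measurable (borel \<Otimes>\<^sub>M M)" for i
        by (rule measurable_compose[OF measurable_snd meas])
      show "(\<lambda>p. \<lfloor>real (Suc n) * fst p\<rfloor>) \<in> measurable (borel \<Otimes>\<^sub>M M) (count_space UNIV)"
        by measurable
    qed
    then show ?thesis unfolding u_def[abs_def] by simp
  qed
qed

text \<open>Fatou's lemma gives the bound on open sets, outer regularity on Borel sets.\<close>

lemma (in prob_space) emeasure_limit_le:
  fixes Y :: "nat \<Rightarrow> 'a \<Rightarrow> real" and X :: "'a \<Rightarrow> real"
  assumes [measurable]: "\<And>n. Y n \<in> borel_measurable M" "X \<in> borel_measurable M"
    and lim: "AE \<omega> in M. (\<lambda>n. Y n \<omega>) \<longlonglongrightarrow> X \<omega>"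
    and le: "\<And>n A. A \<in> sets borel \<Longrightarrow> emeasure M (Y n -` A \<inter> space M) \<le> ennreal D * emeasure lborel A"
    and A: "A \<in> sets borel" and D: "0 \<le> D"
  shows "emeasure M (X -` A \<inter> space M) \<le> ennreal D * emeasure lborel A"
proof -
  have open_le: "emeasure M (X -` U \<inter> space M) \<le> ennreal D * emeasure lborel U" if U: "open U" for U
  proof -
    have [measurable]: "U \<in> sets borel" using U by simp
    have ind: "(\<integral>\<^sup>+\<omega>. indicator U (Z \<omega>) \<partial>M) = emeasure M (Z -` U \<inter> space M)"
      if [measurable]: "Z \<in> borel_measurable M" for Z
    proof -
      have "(\<integral>\<^sup>+\<omega>. indicator U (Z \<omega>) \<partial>M) = (\<integral>\<^sup>+\<omega>. indicator (Z -` U \<inter> space M) \<omega> \<partial>M)"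
        by (intro nn_integral_cong) (auto simp: indicator_def)
      also have "\<dots> = emeasure M (Z -` U \<inter> space M)" by simp
      finally show ?thesis .
    qed
    have "emeasure M (X -` U \<inter> space M) = (\<integral>\<^sup>+\<omega>. indicator U (X \<omega>) \<partial>M)"
      by (simp add: ind)
    also have "\<dots> \<le> (\<integral>\<^sup>+\<omega>. liminf (\<lambda>n. indicator U (Y n \<omega>)) \<partial>M)"
    proof (rule nn_integral_mono_AE)
      show "AE \<omega> in M. indicator U (X \<omega>) \<le> liminf (\<lambda>n. indicator U (Y n \<omega>) :: ennreal)"
        using lim
      proof eventually_elim
        case (elim \<omega>)
        show ?case
        proof (cases "X \<omega> \<in> U")
          case True
          have "\<forall>\<^sub>F n in sequentially. Y n \<omega> \<in> U"
            using topological_tendstoD[OF elim U True] .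
          then have "\<forall>\<^sub>F n in sequentially. (1::ennreal) \<le> indicator U (Y n \<omega>)"
            by eventually_elim simp
          then have "(1::ennreal) \<le> liminf (\<lambda>n. indicator U (Y n \<omega>))"
            by (rule Liminf_bounded)
          then show ?thesis using True by simp
        qed simp
      qed
    qed
    also have "\<dots> \<le> liminf (\<lambda>n. \<integral>\<^sup>+\<omega>. indicator U (Y n \<omega>) \<partial>M)"
      by (rule nn_integral_liminf) measurable
    also have "\<dots> \<le> ennreal D * emeasure lborel U"
      using le[of U] by (intro Liminf_le) (auto simp: ind intro!: always_eventually)
    finally show ?thesis .
  qed
  show ?thesis
  proof (cases "emeasure lborel A = \<infinity> \<or> D = 0")
    case True
    show ?thesis
    proof (cases "D = 0")
      case True
      \<comment> \<open>This case is contradictory: applied to the whole line it would give total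
        probability 0.\<close>
      then show ?thesis using open_le[of UNIV] by (simp add: emeasure_space_1)
    next
      case False
      then show ?thesis using True D by (simp add: ennreal_mult_top)
    qed
  next
    case False
    show ?thesis
    proof (rule ennreal_le_epsilon)
      fix e :: real assume e: "0 < e"
      have "0 < e / D" using e D False by (auto simp: less_le)
      then obtain U where U: "open U" "A \<subseteq> U" "emeasure lborel (U - A) < ennreal (e / D)"
        using outer_regular_lborel[OF A] by blast
      have [measurable]: "U \<in> sets borel" using U by simp
      have "emeasure M (X -` A \<inter> space M) \<le> emeasure M (X -` U \<inter> space M)"
        using U by (intro emeasure_mono) auto
      also have "\<dots> \<le> ennreal D * emeasure lborel U" using U by (intro open_le)
      also have "emeasure lborel U = emeasure lborel A + emeasure lborel (U - A)"
        using plus_emeasure[of A lborel "U - A"] A U by (auto simp: Un_absorb1)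
      also have "ennreal D * \<dots> \<le> ennreal D * (emeasure lborel A + ennreal (e / D))"
        using U(3) by (intro mult_left_mono add_left_mono) auto
      also have "\<dots> = ennreal D * emeasure lborel A + ennreal e"
        using e D False by (simp add: distrib_left flip: ennreal_mult)
      finally show "emeasure M (X -` A \<inter> space M) \<le> ennreal D * emeasure lborel A + ennreal e" .
    qed
  qed
qed

text \<open>The set-wise hypothesis says that the law of \<open>X\<close> is at most
  \<open>D\<close> times Lebesgue measure in the order of measures, and integrals of nonnegative
  functions respect this order.\<close>

lemma (in prob_space) nn_integral_compose_le:
  fixes X :: "'a \<Rightarrow> real"
  assumes [measurable]: "X \<in> borel_measurable M" "g \<in> borel_measurable borel"
    and le: "\<And>A. A \<in> sets borel \<Longrightarrow> emeasure M (X -` A \<inter> space M) \<le> ennreal D * emeasure lborel A"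
  shows "(\<integral>\<^sup>+\<omega>. g (X \<omega>) \<partial>M) \<le> ennreal D * (\<integral>\<^sup>+x. g x \<partial>lborel)"
proof -
  have "(\<integral>\<^sup>+\<omega>. g (X \<omega>) \<partial>M) = (\<integral>\<^sup>+x. g x \<partial>distr M borel X)"
    by (simp add: nn_integral_distr)
  also have "\<dots> \<le> (\<integral>\<^sup>+x. g x \<partial>scale_measure (ennreal D) lborel)"
  proof (rule nn_integral_mono_measure)
    show "distr M borel X \<le> scale_measure (ennreal D) lborel"
      by (subst le_measure) (auto simp: le_fun_def emeasure_distr intro: le emeasure_notin_sets)
  qed simp
  also have "\<dots> = ennreal D * (\<integral>\<^sup>+x. g x \<partial>lborel)"
    by (rule nn_integral_scale_measure) simp
  finally show ?thesis .
qed

text \<open>Needed to expand the variance of a linear combination into covariances, since the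
  Bochner integral is additive only on integrable functions.\<close>

lemma (in prob_space) gaussian_rv_integrable:
  assumes "gaussian_rv M X"
  shows "integrable M X" "integrable M (\<lambda>\<omega>. (X \<omega> - c)\<^sup>2)"
proof -
  have [measurable]: "X \<in> borel_measurable M" using assms by (simp add: gaussian_rv_def)
  consider \<mu> where "AE \<omega> in M. X \<omega> = \<mu>"
    | \<mu> \<sigma> where "0 < \<sigma>" "distributed M lborel X (normal_density \<mu> \<sigma>)"
    using assms unfolding gaussian_rv_def by blast
  then have "integrable M X \<and> integrable M (\<lambda>\<omega>. (X \<omega> - c)\<^sup>2)"
  proof cases
    case 1
    have "integrable M X \<longleftrightarrow> integrable M (\<lambda>_. \<mu>)"
      by (rule integrable_cong_AE) (use 1 in auto)
    moreover have "integrable M (\<lambda>\<omega>. (X \<omega> - c)\<^sup>2) \<longleftrightarrow> integrable M (\<lambda>_. (\<mu> - c)\<^sup>2)"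
      by (rule integrable_cong_AE) (use 1 in auto)
    ultimately show ?thesis by simp
  next
    case 2
    have X: "integrable M X"
      using distributed_integrable[OF 2(2), of "\<lambda>x. x"] integrable_normal_moment_nz_1[OF 2(1)] by simp
    have sq: "integrable M (\<lambda>\<omega>. (X \<omega> - \<mu>)\<^sup>2)"
      using distributed_integrable[OF 2(2), of "\<lambda>x. (x - \<mu>)\<^sup>2"] integrable_normal_moment[OF 2(1), of \<mu> 2] by simp
    have eq: "(X \<omega> - c)\<^sup>2 = (X \<omega> - \<mu>)\<^sup>2 + 2 * (\<mu> - c) * X \<omega> + (c\<^sup>2 - \<mu>\<^sup>2)" for \<omega>
      by (simp add: power2_eq_square algebra_simps)
    have "integrable M (\<lambda>\<omega>. (X \<omega> - c)\<^sup>2)"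
      unfolding eq by (intro Bochner_Integration.integrable_add integrable_mult_right sq X integrable_const)
    with X show ?thesis by simp
  qed
  then show "integrable M X" "integrable M (\<lambda>\<omega>. (X \<omega> - c)\<^sup>2)" by auto
qed

text \<open>A normal density is at most \<open>1 / (\<sigma> * sqrt (2 * pi))\<close>, hence at most
  \<open>1 / \<sigma>0\<close>. A degenerate variable has variance 0, which the lower bound
  excludes.\<close>

lemma (in prob_space) gaussian_rv_emeasure_le:
  assumes X: "gaussian_rv M X" and \<sigma>0: "0 < \<sigma>0" and var: "\<sigma>0\<^sup>2 \<le> variance X" and A: "A \<in> sets borel"
  shows "emeasure M (X -` A \<inter> space M) \<le> ennreal (1 / \<sigma>0) * emeasure lborel A"
proof -
  have [measurable]: "X \<in> borel_measurable M" using X by (simp add: gaussian_rv_def)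
  consider \<mu> where "AE \<omega> in M. X \<omega> = \<mu>"
    | \<mu> \<sigma> where "0 < \<sigma>" "distributed M lborel X (normal_density \<mu> \<sigma>)"
    using X unfolding gaussian_rv_def by blast
  then show ?thesis
  proof cases
    case 1
    have "expectation X = expectation (\<lambda>_. \<mu>)"
      by (rule integral_cong_AE) (use 1 in auto)
    then have e: "expectation X = \<mu>" by (simp add: prob_space)
    have "variance X = expectation (\<lambda>_. 0)"
      unfolding e by (rule integral_cong_AE) (use 1 in auto)
    then show ?thesis using var \<sigma>0 by simp
  next
    case 2
    have "\<sigma>0\<^sup>2 \<le> \<sigma>\<^sup>2" using var normal_distributed_variance[OF 2] by simp
    then have \<sigma>: "\<sigma>0 \<le> \<sigma>" using 2(1) by (simp add: power2_le_iff_abs_le)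
    have dens: "normal_density \<mu> \<sigma> x \<le> 1 / \<sigma>0" for x
    proof -
      have "\<sigma>0 \<le> sqrt (2 * pi * \<sigma>\<^sup>2)"
      proof (rule real_le_rsqrt)
        have "\<sigma>0\<^sup>2 \<le> 1 * \<sigma>\<^sup>2" using \<open>\<sigma>0\<^sup>2 \<le> \<sigma>\<^sup>2\<close> by simp
        also have "\<dots> \<le> (2 * pi) * \<sigma>\<^sup>2" using pi_ge_two by (intro mult_right_mono) auto
        finally show "\<sigma>0\<^sup>2 \<le> 2 * pi * \<sigma>\<^sup>2" .
      qed
      then have "1 / sqrt (2 * pi * \<sigma>\<^sup>2) * exp (- (x - \<mu>)\<^sup>2 / (2 * \<sigma>\<^sup>2)) \<le> 1 / \<sigma>0 * 1"
        using \<sigma>0 by (intro mult_mono divide_left_mono) (auto intro!: mult_pos_pos simp: 2(1))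
      then show ?thesis by (simp add: normal_density_def)
    qed
    have "emeasure M (X -` A \<inter> space M) = (\<integral>\<^sup>+x. ennreal (normal_density \<mu> \<sigma> x) * indicator A x \<partial>lborel)"
      using distributed_emeasure[OF 2(2)] A by simp
    also have "\<dots> \<le> (\<integral>\<^sup>+x. ennreal (1 / \<sigma>0) * indicator A x \<partial>lborel)"
      using dens by (intro nn_integral_mono mult_right_mono ennreal_leI) auto
    also have "\<dots> = ennreal (1 / \<sigma>0) * emeasure lborel A"
      using A by (simp add: nn_integral_cmult_indicator)
    finally show ?thesis .
  qed
qed

section \<open>Fractional Brownian motion\<close>

context hoelder_path begin

lemma riemann_sum_le:
  assumes "0 \<le> d" "real m * d \<le> T"
  shows "\<bar>integral {0..real m * d} B - d * (\<Sum>i\<in>{1..m}. B (real i * d))\<bar> \<le> real m * (C * d powr (\<gamma> + 1))"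
  using assms(2)
proof (induction m)
  case (Suc m)
  define r where "r = real m * d"
  have r': "real (Suc m) * d = r + d" by (simp add: r_def algebra_simps)
  have r: "0 \<le> r" "r + d \<le> T" using assms Suc.prems unfolding r' by (auto simp: r_def)
  have comb: "integral {0..r} B + integral {r..r + d} B = integral {0..r + d} B"
    by (rule Henstock_Kurzweil_Integration.integral_combine) (use assms r B_integrable in auto)
  have "\<bar>integral {r..r + d} B - (r + d - r) * B (r + d)\<bar> \<le> C * (r + d - r) powr (\<gamma> + 1)"
    by (rule integral_minus_endpoint_le) (use assms r in auto)
  then have 1: "\<bar>integral {r..r + d} B - d * B (r + d)\<bar> \<le> C * d powr (\<gamma> + 1)" by simp
  have 2: "\<bar>integral {0..r} B - d * (\<Sum>i\<in>{1..m}. B (real i * d))\<bar> \<le> real m * (C * d powr (\<gamma> + 1))"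
    using Suc.IH r assms unfolding r_def by auto
  have 3: "d * (\<Sum>i\<in>{1..Suc m}. B (real i * d)) = d * (\<Sum>i\<in>{1..m}. B (real i * d)) + d * B (r + d)"
    by (simp add: distrib_left r_def algebra_simps)
  have 4: "real (Suc m) * (C * d powr (\<gamma> + 1)) = real m * (C * d powr (\<gamma> + 1)) + C * d powr (\<gamma> + 1)"
    by (simp add: algebra_simps)
  have triangle: "\<bar>x - y\<bar> \<le> p \<Longrightarrow> \<bar>z - w\<bar> \<le> q \<Longrightarrow> \<bar>(x + z) - (y + w)\<bar> \<le> p + q" for x y z w p q :: real
    by linarith
  show ?case
    unfolding r' 3 4 comb[symmetric] by (rule triangle[OF 2 1])
qed simp

text \<open>With \<open>m\<close> cells of length \<open>t / m\<close> the cell errors add up to a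
  multiple of \<open>m powr (- \<gamma>)\<close>.\<close>

lemma riemann_sum_tendsto:
  assumes t: "0 < t" "t \<le> T"
  shows "(\<lambda>n. t / real (Suc n) * (\<Sum>i\<in>{1..Suc n}. B (real i * (t / real (Suc n))))) \<longlonglongrightarrow> integral {0..t} B"
proof -
  have "(\<lambda>n. t / real (Suc n) * (\<Sum>i\<in>{1..Suc n}. B (real i * (t / real (Suc n)))) - integral {0..t} B) \<longlonglongrightarrow> 0"
  proof (rule Lim_null_comparison)
    show "\<forall>\<^sub>F n in sequentially. norm (t / real (Suc n) * (\<Sum>i\<in>{1..Suc n}. B (real i * (t / real (Suc n)))) - integral {0..t} B)
        \<le> C * t powr (\<gamma> + 1) * real (Suc n) powr (- \<gamma>)"
    proof (intro always_eventually allI)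
      fix n
      have eq: "real (Suc n) * (t / real (Suc n)) = t" by simp
      have "\<bar>integral {0..real (Suc n) * (t / real (Suc n))} B - t / real (Suc n) * (\<Sum>i\<in>{1..Suc n}. B (real i * (t / real (Suc n))))\<bar>
          \<le> real (Suc n) * (C * (t / real (Suc n)) powr (\<gamma> + 1))"
        by (rule riemann_sum_le) (use t eq in auto)
      also have "\<dots> = C * t powr (\<gamma> + 1) * real (Suc n) powr (- \<gamma>)"
        using t by (simp add: powr_divide powr_add powr_minus_divide)
      finally show "norm (t / real (Suc n) * (\<Sum>i\<in>{1..Suc n}. B (real i * (t / real (Suc n)))) - integral {0..t} B)
        \<le> C * t powr (\<gamma> + 1) * real (Suc n) powr (- \<gamma>)"
        unfolding eq by (simp only: real_norm_def abs_minus_commute)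
    qed
    have "(\<lambda>n. real (Suc n) powr (- \<gamma>)) \<longlonglongrightarrow> 0"
      by (rule tendsto_neg_powr[OF _ filterlim_compose[OF filterlim_real_sequentially filterlim_Suc]])
        (use \<gamma> in auto)
    then show "(\<lambda>n. C * t powr (\<gamma> + 1) * real (Suc n) powr (- \<gamma>)) \<longlonglongrightarrow> 0"
      by (rule tendsto_mult_right_zero)
  qed
  then show ?thesis by (rule LIM_zero_cancel)
qed

end

lemma W1_hoelder:
  assumes "g \<in> W1 \<beta> T"
  obtains C where "\<And>x y. x \<in> {0..T} \<Longrightarrow> y \<in> {0..T} \<Longrightarrow> \<bar>g x - g y\<bar> \<le> C * \<bar>x - y\<bar> powr \<beta>"
proof
  define C where "C = enn2real (W1_norm \<beta> T g)"
  have fin: "W1_norm \<beta> T g = ennreal C"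
    using assms by (simp add: W1_def C_def)
  have C: "0 \<le> C" by (simp add: C_def)
  have lt: "\<bar>g y - g x\<bar> \<le> C * (y - x) powr \<beta>" if "0 \<le> x" "x < y" "y \<le> T" for x y
  proof -
    have "ennreal (\<bar>g y - g x\<bar> / (y - x) powr \<beta>) \<le>
        ennreal (\<bar>g y - g x\<bar> / (y - x) powr \<beta>) +
        (\<integral>\<^sup>+u\<in>{x..y}. ennreal (\<bar>g u - g x\<bar> / (u - x) powr (\<beta> + 1)) \<partial>lebesgue)"
      by (rule add_increasing2) auto
    also have "\<dots> \<le> W1_norm \<beta> T g"
      unfolding W1_norm_def using that by (intro SUP_upper2[of "(x, y)"]) auto
    finally have "\<bar>g y - g x\<bar> / (y - x) powr \<beta> \<le> C"
      by (simp add: fin ennreal_le_iff C)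
    then show ?thesis using that by (simp add: pos_divide_le_eq)
  qed
  fix x y assume "x \<in> {0..T}" "y \<in> {0..T}"
  then show "\<bar>g x - g y\<bar> \<le> C * \<bar>x - y\<bar> powr \<beta>"
    using lt[of x y] lt[of y x] by (cases x y rule: linorder_cases) (auto simp: abs_minus_commute)
qed

section \<open>Gaussian estimates for fractional Brownian motion\<close>

locale fbm = prob_space M for M :: "'a measure" +
  fixes H :: real and B :: "real \<Rightarrow> 'a \<Rightarrow> real"
  assumes fbm: "fractional_brownian_motion M H B" and H: "1/2 < H" "H < 1"
begin

lemma gaussian_sum:
  "finite J \<Longrightarrow> J \<subseteq> {0..} \<Longrightarrow> gaussian_rv M (\<lambda>\<omega>. \<Sum>t\<in>J. a t * B t \<omega>)"
  using fbm unfolding fractional_brownian_motion_def gaussian_process_def by blast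

lemma gaussian: "0 \<le> t \<Longrightarrow> gaussian_rv M (B t)"
  using gaussian_sum[of "{t}" "\<lambda>_. 1"] by simp

lemma B_measurable: "0 \<le> t \<Longrightarrow> B t \<in> borel_measurable M"
  using gaussian by (simp add: gaussian_rv_def)

lemma covariance:
  "0 \<le> t \<Longrightarrow> 0 \<le> s \<Longrightarrow> expectation (\<lambda>\<omega>. (B t \<omega> - expectation (B t)) * (B s \<omega> - expectation (B s))) =
    (t powr (2 * H) + s powr (2 * H) - \<bar>t - s\<bar> powr (2 * H)) / 2"
  using fbm unfolding fractional_brownian_motion_def by blast

lemma covariance_nonneg:
  assumes "0 \<le> t" "0 \<le> s"
  shows "0 \<le> (t powr (2 * H) + s powr (2 * H) - \<bar>t - s\<bar> powr (2 * H)) / 2"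
proof -
  have "\<bar>t - s\<bar> powr (2 * H) \<le> max t s powr (2 * H)"
    using assms H by (intro powr_mono2) auto
  also have "\<dots> \<le> t powr (2 * H) + s powr (2 * H)"
    by (auto simp: max_def)
  finally show ?thesis by simp
qed

lemma AE_W1: "0 < T \<Longrightarrow> 0 < \<beta> \<Longrightarrow> \<beta> < H \<Longrightarrow> AE \<omega> in M. (\<lambda>t. B t \<omega>) \<in> W1 \<beta> T"
  using fbm unfolding fractional_brownian_motion_def by blast

text \<open>Since the covariances are nonnegative, no correlation can reduce the variance contributed
  by a single time.\<close>

lemma variance_sum_ge:
  assumes J: "finite J" "J \<subseteq> {0..}" and a: "\<And>s. s \<in> J \<Longrightarrow> 0 \<le> a s" and t: "t \<in> J"
  shows "(a t * t powr H)\<^sup>2 \<le> variance (\<lambda>\<omega>. \<Sum>s\<in>J. a s * B s \<omega>)"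
proof -
  define Z where "Z s \<omega> = B s \<omega> - expectation (B s)" for s \<omega>
  define c where "c r s = (r powr (2 * H) + s powr (2 * H) - \<bar>r - s\<bar> powr (2 * H)) / 2" for r s
  have int: "integrable M (B s)" if "s \<in> J" for s
    using gaussian_rv_integrable(1)[OF gaussian] that J by auto
  have meas: "B s \<in> borel_measurable M" if "s \<in> J" for s
    using B_measurable that J by auto
  have int2: "integrable M (\<lambda>\<omega>. Z r \<omega> * Z s \<omega>)" if "r \<in> J" "s \<in> J" for r s
  proof (rule Bochner_Integration.integrable_bound)
    show "integrable M (\<lambda>\<omega>. (Z r \<omega>)\<^sup>2 + (Z s \<omega>)\<^sup>2)"
      unfolding Z_def using that J
      by (intro Bochner_Integration.integrable_add gaussian_rv_integrable(2) gaussian) auto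
    show "(\<lambda>\<omega>. Z r \<omega> * Z s \<omega>) \<in> borel_measurable M"
      unfolding Z_def using meas[OF that(1)] meas[OF that(2)] by measurable
    have "\<bar>x * y\<bar> \<le> x\<^sup>2 + y\<^sup>2" for x y :: real
    proof -
      have "2 * (\<bar>x\<bar> * \<bar>y\<bar>) \<le> \<bar>x\<bar>\<^sup>2 + \<bar>y\<bar>\<^sup>2"
        using zero_le_power2[of "\<bar>x\<bar> - \<bar>y\<bar>"] unfolding power2_diff by simp
      moreover have "0 \<le> \<bar>x\<bar> * \<bar>y\<bar>" by simp
      ultimately show ?thesis unfolding abs_mult power2_abs by linarith
    qed
    then show "AE \<omega> in M. norm (Z r \<omega> * Z s \<omega>) \<le> norm ((Z r \<omega>)\<^sup>2 + (Z s \<omega>)\<^sup>2)"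
      by (intro AE_I2) (auto intro: order_trans[OF _ abs_ge_self])
  qed
  have cov: "expectation (\<lambda>\<omega>. Z r \<omega> * Z s \<omega>) = c r s" if "r \<in> J" "s \<in> J" for r s
    using covariance[of r s] that J unfolding Z_def c_def by auto
  have c_nonneg: "0 \<le> c r s" if "r \<in> J" "s \<in> J" for r s
    using covariance_nonneg[of r s] that J unfolding c_def by auto
  have "expectation (\<lambda>\<omega>. \<Sum>s\<in>J. a s * B s \<omega>) = (\<Sum>s\<in>J. a s * expectation (B s))"
    using int by (subst Bochner_Integration.integral_sum) auto
  then have "variance (\<lambda>\<omega>. \<Sum>s\<in>J. a s * B s \<omega>) = expectation (\<lambda>\<omega>. (\<Sum>s\<in>J. a s * Z s \<omega>)\<^sup>2)"
    by (simp add: Z_def right_diff_distrib sum_subtractf)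
  also have "\<dots> = expectation (\<lambda>\<omega>. \<Sum>r\<in>J. \<Sum>s\<in>J. a r * a s * (Z r \<omega> * Z s \<omega>))"
    by (simp add: power2_eq_square sum_product mult_ac)
  also have "\<dots> = (\<Sum>r\<in>J. \<Sum>s\<in>J. a r * a s * c r s)"
    using int2 by (simp add: Bochner_Integration.integral_sum cov)
  also have "\<dots> \<ge> (\<Sum>s\<in>J. a t * a s * c t s)"
    using J t a c_nonneg by (intro member_le_sum[where f="\<lambda>r. \<Sum>s\<in>J. a r * a s * c r s"] sum_nonneg) auto
  also have "(\<Sum>s\<in>J. a t * a s * c t s) \<ge> a t * a t * c t t"
    using J t a c_nonneg by (intro member_le_sum[where f="\<lambda>s. a t * a s * c t s"]) auto
  also have "a t * a t * c t t = (a t * t powr H)\<^sup>2"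
    using H by (simp add: c_def power2_eq_square flip: powr_add)
  finally show ?thesis .
qed

text \<open>Right end points make \<open>t\<close> itself a node, so the term with
  \<open>B t\<close> merges into the last coefficient. All coefficients are then nonnegative and
  that of \<open>t\<close> is at least \<open>(T - t) / T\<close>; \<open>variance_sum_ge\<close>
  yields a density bound independent of \<open>n\<close>.\<close>

lemma riemann_approximation:
  assumes T: "0 < T" and t: "0 < t" "t < T"
  defines "Y \<equiv> \<lambda>n \<omega>. 1 / T * (t / real (Suc n) * (\<Sum>i\<in>{1..Suc n}. B (real i * (t / real (Suc n))) \<omega>)) + (T - t) / T * B t \<omega>"
  shows "Y n \<in> borel_measurable M"
    and "A \<in> sets borel \<Longrightarrow>
      emeasure M (Y n -` A \<inter> space M) \<le> ennreal (1 / ((T - t) / T * t powr H)) * emeasure lborel A"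
proof -
  define d where "d = t / real (Suc n)"
  define J where "J = (\<lambda>i. real i * d) ` {1..Suc n}"
  define a where "a s = d / T + (if s = t then (T - t) / T else 0)" for s
  have d: "0 < d" using t by (simp add: d_def)
  have inj: "inj_on (\<lambda>i. real i * d) {1..Suc n}" using d by (auto simp: inj_on_def)
  have last: "real i * d = t \<longleftrightarrow> i = Suc n" for i
  proof -
    have "real i * d = t \<longleftrightarrow> real i * d = real (Suc n) * d" by (simp add: d_def)
    then show ?thesis using d by (auto simp del: of_nat_Suc)
  qed
  have J: "finite J" "J \<subseteq> {0..}" using d by (auto simp: J_def)
  have tJ: "t \<in> J" unfolding J_def by (rule image_eqI[of _ _ "Suc n"]) (use last[of "Suc n"] in auto)
  have Y: "Y n = (\<lambda>\<omega>. \<Sum>s\<in>J. a s * B s \<omega>)"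
  proof
    fix \<omega>
    have "(\<Sum>s\<in>J. a s * B s \<omega>) = (\<Sum>i\<in>{1..Suc n}. a (real i * d) * B (real i * d) \<omega>)"
      unfolding J_def using inj by (simp add: sum.reindex)
    also have "\<dots> = (\<Sum>i\<in>{1..Suc n}. d / T * B (real i * d) \<omega> + (if i = Suc n then (T - t) / T * B t \<omega> else 0))"
    proof (rule sum.cong[OF refl])
      fix i
      show "a (real i * d) * B (real i * d) \<omega> = d / T * B (real i * d) \<omega> + (if i = Suc n then (T - t) / T * B t \<omega> else 0)"
        using last[of i] by (auto simp: a_def distrib_right simp del: of_nat_Suc)
    qed
    also have "\<dots> = (\<Sum>i\<in>{1..Suc n}. d / T * B (real i * d) \<omega>) + (T - t) / T * B t \<omega>"
      by (simp add: sum.distrib sum.delta del: sum.cl_ivl_Suc)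
    also have "\<dots> = Y n \<omega>"
      unfolding Y_def d_def[symmetric] by (simp only: sum_distrib_left[symmetric]) simp
    finally show "Y n \<omega> = (\<Sum>s\<in>J. a s * B s \<omega>)" ..
  qed
  have g: "gaussian_rv M (Y n)" unfolding Y by (rule gaussian_sum[OF J])
  then show "Y n \<in> borel_measurable M" by (simp add: gaussian_rv_def)
  have pos: "0 < (T - t) / T * t powr H" using t T by simp
  have "((T - t) / T * t powr H)\<^sup>2 \<le> (a t * t powr H)\<^sup>2"
    using t T d by (intro power_mono mult_right_mono) (auto simp: a_def)
  also have "\<dots> \<le> variance (Y n)"
    unfolding Y by (rule variance_sum_ge[OF J _ tJ]) (use t T d in \<open>auto simp: a_def\<close>)
  finally have "((T - t) / T * t powr H)\<^sup>2 \<le> variance (Y n)" .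
  then show "A \<in> sets borel \<Longrightarrow>
      emeasure M (Y n -` A \<inter> space M) \<le> ennreal (1 / ((T - t) / T * t powr H)) * emeasure lborel A"
    by (rule gaussian_rv_emeasure_le[OF g pos])
qed

text \<open>By Tonelli the expected crossing integral is an integral over pairs of times. The
  density bound cancels \<open>(T - x) / T\<close> and leaves
  \<open>x powr (- H) * (x - s) powr (\<gamma> - 3/2)\<close> up to a constant, integrable at 0
  because \<open>H < 1\<close> and at the diagonal because \<gamma> exceeds 1/2.\<close>

theorem AE_crossing_density_finite:
  assumes T: "0 < T" and \<gamma>: "1/2 < \<gamma>" "\<gamma> < H" and \<psi>: "mono \<psi>"
  shows "AE \<omega> in M. \<forall>n. (\<integral>\<^sup>+p. crossing_density T \<gamma> \<psi> n (log_geometric_average T (\<lambda>u. B u \<omega>)) p \<partial>lborel) < \<infinity>"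
proof -
  have "AE \<omega> in M. (\<lambda>t. B t \<omega>) \<in> W1 \<gamma> T"
    using T \<gamma> by (intro AE_W1) auto
  then obtain N where N: "{\<omega> \<in> space M. (\<lambda>t. B t \<omega>) \<notin> W1 \<gamma> T} \<subseteq> N" "emeasure M N = 0" "N \<in> sets M"
    by (rule AE_E)
  define G where "G = space M - N"
  have [measurable]: "G \<in> sets M" using N by (simp add: G_def)
  have AE_G: "AE \<omega> in M. \<omega> \<in> G"
  proof -
    have "N \<in> null_sets M" using N by auto
    from AE_not_in[OF this] AE_space show ?thesis by eventually_elim (auto simp: G_def)
  qed
  have path: "\<exists>C. hoelder_path T C \<gamma> (\<lambda>u. B u \<omega>)" if "\<omega> \<in> G" for \<omega>
  proof -
    have "(\<lambda>t. B t \<omega>) \<in> W1 \<gamma> T" using that N by (auto simp: G_def)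
    then obtain C where "\<And>x y. x \<in> {0..T} \<Longrightarrow> y \<in> {0..T} \<Longrightarrow> \<bar>B x \<omega> - B y \<omega>\<bar> \<le> C * \<bar>x - y\<bar> powr \<gamma>"
      by (rule W1_hoelder) blast
    then show ?thesis using T \<gamma> H by (intro exI[of _ C]) (unfold_locales, auto)
  qed
  define clp where "clp x = max 0 (min T x)" for x
  \<comment> \<open>Set to 0 off the measurable event \<open>G\<close> of good paths and frozen
    outside \<open>[0, T]\<close>, so that every path is continuous on the line and
    \<open>caratheodory_measurable\<close> applies.\<close>
  define X where "X x \<omega> = (if \<omega> \<in> G then log_geometric_average T (\<lambda>u. B u \<omega>) (clp x) else 0)" for x \<omega>
  define Y where "Y t n \<omega> = 1 / T * (t / real (Suc n) * (\<Sum>i\<in>{1..Suc n}. B (real i * (t / real (Suc n))) \<omega>)) + (T - t) / T * B t \<omega>" for t n \<omega>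
  have Y_meas: "Y t n \<in> borel_measurable M" if "0 \<le> t" for t n
    unfolding Y_def using that
    by (intro borel_measurable_add borel_measurable_times borel_measurable_const borel_measurable_sum B_measurable) auto
  have Y_lim: "(\<lambda>n. Y t n \<omega>) \<longlonglongrightarrow> X t \<omega>" if "0 < t" "t \<le> T" "\<omega> \<in> G" for t \<omega>
  proof -
    obtain C where "hoelder_path T C \<gamma> (\<lambda>u. B u \<omega>)" using path \<open>\<omega> \<in> G\<close> by blast
    then interpret hoelder_path T C \<gamma> "\<lambda>u. B u \<omega>" .
    have "clp t = t" using that by (simp add: clp_def)
    then have "X t \<omega> = 1 / T * integral {0..t} (\<lambda>u. B u \<omega>) + (T - t) / T * B t \<omega>"
      using \<open>\<omega> \<in> G\<close> by (simp add: X_def log_geometric_average_def)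
    then show ?thesis
      unfolding Y_def
      by (simp only:) (intro tendsto_add tendsto_mult tendsto_const riemann_sum_tendsto that)
  qed
  have X_meas: "X x \<in> borel_measurable M" for x
  proof -
    have "X t \<in> borel_measurable M" if t: "0 \<le> t" "t \<le> T" for t
    proof (cases "t = 0")
      case True
      have "clp 0 = 0" using T by (simp add: clp_def)
      then have "X t = (\<lambda>\<omega>. if \<omega> \<in> G then B 0 \<omega> else 0)"
        using True T by (auto simp: X_def log_geometric_average_def fun_eq_iff)
      then show ?thesis using B_measurable[of 0] by simp
    next
      case False
      show ?thesis
      proof (rule borel_measurable_LIMSEQ_real)
        show "(\<lambda>n. indicator G \<omega> * Y t n \<omega>) \<longlonglongrightarrow> X t \<omega>" for \<omega>
          using Y_lim[of t \<omega>] t False by (cases "\<omega> \<in> G") (auto simp: X_def)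
        show "(\<lambda>\<omega>. indicator G \<omega> * Y t n \<omega>) \<in> borel_measurable M" for n
          using Y_meas[OF t(1), of n] by measurable
      qed
    qed
    moreover have "X x = X (clp x)" using T by (auto simp: X_def clp_def fun_eq_iff)
    ultimately show ?thesis using T by (auto simp: clp_def)
  qed
  have X_cont: "continuous_on UNIV (\<lambda>t. X t \<omega>)" for \<omega>
  proof (cases "\<omega> \<in> G")
    case True
    then obtain C where "hoelder_path T C \<gamma> (\<lambda>u. B u \<omega>)" using path by blast
    then interpret hoelder_path T C \<gamma> "\<lambda>u. B u \<omega>" .
    have "continuous_on UNIV clp"
      unfolding clp_def by (intro continuous_intros)
    then have "continuous_on UNIV (\<lambda>t. log_average (clp t))"
      by (rule continuous_on_compose2[OF log_average_continuous]) (use T in \<open>auto simp: clp_def\<close>)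
    then show ?thesis using True by (simp add: X_def)
  qed (simp add: X_def)
  have X_joint: "(\<lambda>(t, \<omega>). X t \<omega>) \<in> borel_measurable (borel \<Otimes>\<^sub>M M)"
    by (rule caratheodory_measurable[OF X_meas X_cont])
  have X_le: "emeasure M (X t -` A \<inter> space M) \<le> ennreal (1 / ((T - t) / T * t powr H)) * emeasure lborel A"
    if t: "0 < t" "t < T" and A: "A \<in> sets borel" for t A
  proof (rule emeasure_limit_le[where Y="Y t", OF Y_meas X_meas])
    show "AE \<omega> in M. (\<lambda>n. Y t n \<omega>) \<longlonglongrightarrow> X t \<omega>"
      using AE_G by eventually_elim (use Y_lim t in auto)
    show "emeasure M (Y t n -` A \<inter> space M) \<le> ennreal (1 / ((T - t) / T * t powr H)) * emeasure lborel A"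
      if "A \<in> sets borel" for n A
      using riemann_approximation(2)[OF T t that, of n] unfolding Y_def .
  qed (use t T A in auto)
  have fin: "AE \<omega> in M. (\<integral>\<^sup>+p. crossing_density T \<gamma> \<psi> n (\<lambda>x. X x \<omega>) p \<partial>lborel) < \<infinity>" for n
  proof -
    \<comment> \<open>The constant of \<open>oscillation_nn_integral_le\<close> for
      \<open>\<epsilon> = real n * (x - s) powr \<gamma>\<close>, with the power of
      \<open>x - s\<close> left out.\<close>
    define \<Delta> where "\<Delta> = 2 * real n * (\<psi> (real n) - \<psi> (- real n))"
    have \<Delta>: "0 \<le> \<Delta>" unfolding \<Delta>_def by (intro mult_nonneg_nonneg) (auto intro: monoD[OF \<psi>])
    interpret P: pair_sigma_finite M "lborel :: (real \<times> real) measure" ..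
    have [measurable]: "truncated \<psi> n \<in> borel_measurable borel" by (rule truncated_measurable[OF \<psi>])
    define xx ss :: "'a \<times> real \<times> real \<Rightarrow> real" where "xx q = fst (snd q)" and "ss q = snd (snd q)" for q
    have [measurable]: "xx \<in> borel_measurable (M \<Otimes>\<^sub>M lborel)" "ss \<in> borel_measurable (M \<Otimes>\<^sub>M lborel)"
      unfolding xx_def[abs_def] ss_def[abs_def]
      by (rule measurable_compose[OF measurable_snd];
        simp add: borel_measurable_continuous_onI continuous_on_fst continuous_on_snd)+
    have [measurable]: "(\<lambda>q. X (xx q) (fst q)) \<in> borel_measurable (M \<Otimes>\<^sub>M (lborel :: (real \<times> real) measure))"
    proof -
      have "(\<lambda>q. (xx q, fst q)) \<in> (M \<Otimes>\<^sub>M (lborel :: (real \<times> real) measure)) \<rightarrow>\<^sub>M (borel \<Otimes>\<^sub>M M)"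
        by (rule measurable_Pair) (auto intro: measurable_fst)
      from measurable_compose[OF this X_joint] show ?thesis by simp
    qed
    have joint: "(\<lambda>(\<omega>, p). ennreal (crossing_density T \<gamma> \<psi> n (\<lambda>x. X x \<omega>) p)) \<in> borel_measurable (M \<Otimes>\<^sub>M lborel)"
    proof -
      have eq: "(\<lambda>(\<omega>, p). ennreal (crossing_density T \<gamma> \<psi> n (\<lambda>x. X x \<omega>) p)) =
        (\<lambda>q. ennreal (if 0 < ss q \<and> ss q < xx q \<and> xx q < T
          then (T - xx q) / T * oscillation \<psi> n (real n * (xx q - ss q) powr \<gamma>) (X (xx q) (fst q))
            * (xx q - ss q) powr (-3/2) else 0))"
        by (auto simp: crossing_density_def fun_eq_iff xx_def ss_def)
      show ?thesis unfolding eq oscillation_def by measurable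
    qed
    \<comment> \<open>What is left of the expectation after the factor \<open>(T - x) / T\<close>
      has cancelled against the density bound and the powers of \<open>x - s\<close> have been
      combined.\<close>
    define U where "U = (\<lambda>(x, s). \<Delta> * (indicator {0<..<T} x * x powr (- H)) * (indicator {0<..<x} s * (x - s) powr (\<gamma> - 3/2)))"
    have inner: "(\<integral>\<^sup>+\<omega>. ennreal (crossing_density T \<gamma> \<psi> n (\<lambda>x. X x \<omega>) p) \<partial>M) \<le> ennreal (U p)" for p
    proof (cases p)
      case (Pair x s)
      show ?thesis
      proof (cases "0 < s \<and> s < x \<and> x < T")
        case True
        define \<epsilon> where "\<epsilon> = real n * (x - s) powr \<gamma>"
        define c where "c = (T - x) / T * (x - s) powr (-3/2)"
        have \<epsilon>: "0 \<le> \<epsilon>" by (simp add: \<epsilon>_def)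
        have c: "0 \<le> c" using True T by (simp add: c_def)
        have [measurable]: "oscillation \<psi> n \<epsilon> \<in> borel_measurable borel"
          unfolding oscillation_def [abs_def] by measurable
        have [measurable]: "X x \<in> borel_measurable M" by (rule X_meas)
        have "(\<integral>\<^sup>+\<omega>. ennreal (crossing_density T \<gamma> \<psi> n (\<lambda>x. X x \<omega>) p) \<partial>M) =
            (\<integral>\<^sup>+\<omega>. ennreal c * ennreal (oscillation \<psi> n \<epsilon> (X x \<omega>)) \<partial>M)"
          using True c oscillation_nonneg[OF \<psi> \<epsilon>]
          by (intro nn_integral_cong)
            (simp add: Pair crossing_density_def c_def \<epsilon>_def mult_ac flip: ennreal_mult)
        also have "\<dots> = ennreal c * (\<integral>\<^sup>+\<omega>. ennreal (oscillation \<psi> n \<epsilon> (X x \<omega>)) \<partial>M)"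
          by (rule nn_integral_cmult) measurable
        also have "\<dots> \<le> ennreal c * (ennreal (1 / ((T - x) / T * x powr H)) * (\<integral>\<^sup>+y. ennreal (oscillation \<psi> n \<epsilon> y) \<partial>lborel))"
          using True by (intro mult_left_mono nn_integral_compose_le X_le) auto
        also have "\<dots> \<le> ennreal c * (ennreal (1 / ((T - x) / T * x powr H)) * ennreal (2 * \<epsilon> * (\<psi> (real n) - \<psi> (- real n))))"
          by (intro mult_left_mono oscillation_nn_integral_le \<psi> \<epsilon>) auto
        also have "\<dots> = ennreal (c * (1 / ((T - x) / T * x powr H) * (2 * \<epsilon> * (\<psi> (real n) - \<psi> (- real n)))))"
        proof -
          have 1: "0 \<le> 1 / ((T - x) / T * x powr H)" using True T by simp
          have 2: "0 \<le> 2 * \<epsilon> * (\<psi> (real n) - \<psi> (- real n))"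
            using \<epsilon> monoD[OF \<psi>, of "- real n" "real n"] by simp
          show ?thesis
            by (simp only: ennreal_mult[OF c mult_nonneg_nonneg[OF 1 2]] ennreal_mult[OF 1 2])
        qed
        also have "c * (1 / ((T - x) / T * x powr H) * (2 * \<epsilon> * (\<psi> (real n) - \<psi> (- real n)))) = U p"
        proof -
          define q where "q = (T - x) / T"
          have q: "q \<noteq> 0" using True T by (simp add: q_def)
          have pw: "(x - s) powr (\<gamma> - 3/2) = (x - s) powr (-3/2) * (x - s) powr \<gamma>"
            by (simp flip: powr_add)
          show ?thesis
            using True q unfolding Pair U_def c_def \<epsilon>_def \<Delta>_def q_def[symmetric]
            by (simp add: pw powr_minus_divide)
        qed
        finally show ?thesis .
      qed (auto simp: Pair crossing_density_def)
    qed
    have hb: "has_bochner_integral lborel (\<lambda>s. indicator {0<..<x} s * (x - s) powr (\<gamma> - 3/2))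
        (max 0 x powr (\<gamma> - 1/2) / (\<gamma> - 1/2))" for x
      using has_bochner_integral_powr_reflect[of "\<gamma> - 3/2" x] \<gamma> by (simp add: algebra_simps)
    have hbH: "has_bochner_integral lborel (\<lambda>x::real. indicator {0<..<T} x * x powr (- H)) (T powr (- H + 1) / (- H + 1))"
      by (rule has_bochner_integral_powr_from_0) (use T H in auto)
    have [measurable]: "U \<in> borel_measurable (lborel \<Otimes>\<^sub>M lborel)"
    proof -
      have "U = (\<lambda>(x, s). \<Delta> * (indicator {0<..<T} x * x powr (- H)) * (if 0 < s \<and> s < x then (x - s) powr (\<gamma> - 3/2) else 0))"
        by (auto simp: U_def fun_eq_iff indicator_def)
      also have "\<dots> \<in> borel_measurable (lborel \<Otimes>\<^sub>M lborel)" by measurable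
      finally show ?thesis .
    qed
    define E where "E = \<Delta> * (T powr (\<gamma> - 1/2) / (\<gamma> - 1/2))"
    have E: "0 \<le> E" using \<Delta> \<gamma> by (simp add: E_def)
    have U_int: "(\<integral>\<^sup>+s. ennreal (U (x, s)) \<partial>lborel) \<le> ennreal (E * (indicator {0<..<T} x * x powr (- H)))" for x
    proof -
      have "(\<integral>\<^sup>+s. ennreal (U (x, s)) \<partial>lborel) = ennreal (LINT s|lborel. U (x, s))"
        using hb[of x] \<Delta> by (intro nn_integral_eq_integral) (auto simp: U_def has_bochner_integral_iff intro!: AE_I2)
      also have "(LINT s|lborel. U (x, s)) = \<Delta> * (indicator {0<..<T} x * x powr (- H)) * (max 0 x powr (\<gamma> - 1/2) / (\<gamma> - 1/2))"
        using hb[of x] by (simp add: U_def has_bochner_integral_iff)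
      also have "\<dots> \<le> E * (indicator {0<..<T} x * x powr (- H))"
      proof (cases "x \<in> {0<..<T}")
        case True
        then have "\<Delta> * (x powr (\<gamma> - 1/2) / (\<gamma> - 1/2)) \<le> E"
          unfolding E_def using \<Delta> \<gamma> by (intro mult_left_mono divide_right_mono powr_mono2) auto
        then have "\<Delta> * (x powr (\<gamma> - 1/2) / (\<gamma> - 1/2)) * x powr (- H) \<le> E * x powr (- H)"
          by (rule mult_right_mono) simp
        then show ?thesis using True by (simp add: mult_ac)
      qed simp
      finally show ?thesis by (simp add: ennreal_leI)
    qed
    have "(\<integral>\<^sup>+\<omega>. (\<integral>\<^sup>+p. ennreal (crossing_density T \<gamma> \<psi> n (\<lambda>x. X x \<omega>) p) \<partial>lborel) \<partial>M) =
        (\<integral>\<^sup>+p. (\<integral>\<^sup>+\<omega>. ennreal (crossing_density T \<gamma> \<psi> n (\<lambda>x. X x \<omega>) p) \<partial>M) \<partial>lborel)"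
      by (rule P.Fubini'[symmetric]) (use joint in simp)
    also have "\<dots> \<le> (\<integral>\<^sup>+p. ennreal (U p) \<partial>lborel)"
      by (intro nn_integral_mono inner)
    also have "\<dots> = (\<integral>\<^sup>+x. (\<integral>\<^sup>+s. ennreal (U (x, s)) \<partial>lborel) \<partial>lborel)"
      unfolding lborel_prod[symmetric] by (subst lborel.nn_integral_fst[symmetric]) auto
    also have "\<dots> \<le> (\<integral>\<^sup>+x. ennreal (E * (indicator {0<..<T} x * x powr (- H))) \<partial>lborel)"
      by (intro nn_integral_mono U_int)
    also have "\<dots> = ennreal (LINT x|lborel. E * (indicator {0<..<T} x * x powr (- H)))"
      using hbH E by (intro nn_integral_eq_integral integrable_mult_right) (auto simp: has_bochner_integral_iff)
    also have "\<dots> < \<infinity>" by simp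
    finally have "(\<integral>\<^sup>+\<omega>. (\<integral>\<^sup>+p. ennreal (crossing_density T \<gamma> \<psi> n (\<lambda>x. X x \<omega>) p) \<partial>lborel) \<partial>M) \<noteq> \<infinity>" by simp
    moreover have "(\<lambda>\<omega>. \<integral>\<^sup>+p. ennreal (crossing_density T \<gamma> \<psi> n (\<lambda>x. X x \<omega>) p) \<partial>lborel) \<in> borel_measurable M"
      by (rule lborel.borel_measurable_nn_integral) (use joint in simp)
    ultimately have "AE \<omega> in M. (\<integral>\<^sup>+p. ennreal (crossing_density T \<gamma> \<psi> n (\<lambda>x. X x \<omega>) p) \<partial>lborel) \<noteq> \<infinity>"
      by (intro nn_integral_PInf_AE)
    then show ?thesis by eventually_elim (simp add: less_top)
  qed
  have "AE \<omega> in M. \<forall>n. (\<integral>\<^sup>+p. crossing_density T \<gamma> \<psi> n (\<lambda>x. X x \<omega>) p \<partial>lborel) < \<infinity>"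
    using fin by (simp add: AE_all_countable)
  then show ?thesis
    using AE_G
  proof eventually_elim
    case (elim \<omega>)
    have "crossing_density T \<gamma> \<psi> n (\<lambda>x. X x \<omega>) = crossing_density T \<gamma> \<psi> n (log_geometric_average T (\<lambda>u. B u \<omega>))" for n
      using elim(2) by (auto simp: crossing_density_def X_def clp_def fun_eq_iff)
    then show ?case using elim(1) by simp
  qed
qed

end

theorem theorem2p8:
  fixes M :: "'a measure" and F :: "real \<Rightarrow> 'a measure"
    and B S G :: "real \<Rightarrow> 'a \<Rightarrow> real" and f :: "real \<Rightarrow> real" and H T t :: real
  assumes "complete_filtered_prob_space M F"
    and "0 < T" and "t \<in> {0..T}"
    and "1 / 2 < H" and "H < 1"
    and "fractional_brownian_motion M H B"
    and "S = geometric_process B"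
    and "G = geometric_average T S"
    and "convex_on UNIV f"
  shows "AE \<omega> in M. \<exists>I.
    has_gls_integral T (\<lambda>s. (T - s) / T * left_deriv f (G s \<omega>) * G s \<omega>) (\<lambda>s. B s \<omega>) t I \<and>
    f (exp (1 / T * (LINT s:{0..t}|lebesgue. B s \<omega>)) * S t \<omega> powr ((T - t) / T))
      = f (S 0 \<omega>) + I"
proof -
  note T = \<open>0 < T\<close> and t = \<open>t \<in> {0..T}\<close> and f = \<open>convex_on UNIV f\<close>
  interpret fbm M H B
    using assms by (intro fbm.intro fbm_axioms.intro) (auto simp: complete_filtered_prob_space_def)
  \<comment> \<open>The midpoint of 1/2 and \<open>H\<close>: paths are Hoelder of this order, and
    it still exceeds 1/2.\<close>
  define \<gamma> where "\<gamma> = (1/2 + H) / 2"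
  have \<gamma>: "1/2 < \<gamma>" "\<gamma> < H" "\<gamma> \<le> 1" using assms(4,5) by (auto simp: \<gamma>_def)
  have mono: "mono (\<lambda>x. left_deriv f (exp x))"
    by (intro monoI monoD[OF left_deriv_mono[OF f]]) simp
  \<comment> \<open>The membership that the definition of the integral demands of the integrator
    when \<beta> is 1/2.\<close>
  have half: "AE \<omega> in M. (\<lambda>t. B t \<omega>) \<in> W1 (1/2) T"
    using T assms(4) by (intro AE_W1) auto
  have hoelder: "AE \<omega> in M. (\<lambda>t. B t \<omega>) \<in> W1 \<gamma> T"
    using T \<gamma> by (intro AE_W1) auto
  have crossing: "AE \<omega> in M. \<forall>n. (\<integral>\<^sup>+p. crossing_density T \<gamma> (\<lambda>x. left_deriv f (exp x)) n
      (log_geometric_average T (\<lambda>u. B u \<omega>)) p \<partial>lborel) < \<infinity>"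
    by (rule AE_crossing_density_finite[OF T \<gamma>(1,2) mono])
  show ?thesis
    using half hoelder crossing
  proof eventually_elim
    case (elim \<omega>)
    let ?b = "\<lambda>u. B u \<omega>"
    define X where "X = log_geometric_average T ?b"
    obtain C where C: "\<And>x y. x \<in> {0..T} \<Longrightarrow> y \<in> {0..T} \<Longrightarrow> \<bar>B x \<omega> - B y \<omega>\<bar> \<le> C * \<bar>x - y\<bar> powr \<gamma>"
      using elim(2) by (rule W1_hoelder) blast
    interpret hoelder_path T C \<gamma> ?b
      by unfold_locales (use T \<gamma> C in auto)
    interpret full: convex_chain_rule T C \<gamma> ?b f T
      by unfold_locales (use f T in auto)
    have int: "(LINT u:{0..s}|lebesgue. B u \<omega>) = integral {0..s} ?b" if "s \<in> {0..T}" for s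
    proof (rule set_lebesgue_integral_eq_integral(2))
      show "set_integrable lebesgue {0..s} ?b"
        by (rule absolutely_integrable_continuous_real)
          (rule continuous_on_subset[OF B_continuous], use that in auto)
    qed
    have average: "exp (1 / T * (LINT u:{0..s}|lebesgue. B u \<omega>)) * S s \<omega> powr ((T - s) / T) = exp (X s)"
      if "s \<in> {0..T}" for s
      using int[OF that]
      by (simp add: assms(7) geometric_process_def X_def log_geometric_average_def powr_def exp_add)
    have G: "G s \<omega> = exp (X s)" if "s \<in> {0..T}" for s
      using average[OF that] by (simp add: assms(7,8) geometric_average_def geometric_process_def)
    have integrand: "(T - s) / T * left_deriv f (G s \<omega>) * G s \<omega> = full.integrand s" if "s \<in> {0..T}" for s
      using G[OF that] by (simp add: full.integrand_def X_def)
    \<comment> \<open>The choice may depend on the path, because \<open>elim(3)\<close> covers every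
      \<open>n\<close> outside a null set fixed beforehand.\<close>
    obtain n where n: "N \<le> real n" "2 * C \<le> real n"
      using real_arch_simple[of "max N (2 * C)"] by auto
    have inc: "integrable (lborel \<Otimes>\<^sub>M lborel)
        (\<lambda>(x, s). indicator {0<..<T} x * marchaud_inc (\<lambda>x. indicator {0<..<T} x * full.integrand x) x s)"
      by (rule full.inc_integrable_if_crossing[OF n]) (use elim(3) in blast)
    have W2: "(\<lambda>s. (T - s) / T * left_deriv f (G s \<omega>) * G s \<omega>) \<in> W2 (1/2) T"
      by (rule full.integrand_in_W2[OF inc integrand])
    have start: "exp (X 0) = S 0 \<omega>"
      using T by (simp add: X_def log_geometric_average_def assms(7) geometric_process_def)
    have "has_gls_integral T (\<lambda>s. (T - s) / T * left_deriv f (G s \<omega>) * G s \<omega>) ?b t (f (exp (X t)) - f (exp (X 0)))"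
    proof (cases "t = 0")
      \<comment> \<open>The integral over the empty range is 0 by definition; the chain rule needs a
        positive \<open>t\<close>.\<close>
      case True
      then show ?thesis
        unfolding has_gls_integral_def using elim(1) W2 by (intro exI[of _ "1/2"]) auto
    next
      case False
      interpret convex_chain_rule T C \<gamma> ?b f t
        by unfold_locales (use f t False in auto)
      have "set_integrable lebesgue {0..t} (gls_integrand (1/2) (\<lambda>s. (T - s) / T * left_deriv f (G s \<omega>) * G s \<omega>) ?b t)"
        "(LINT x:{0..t}|lebesgue. gls_integrand (1/2) (\<lambda>s. (T - s) / T * left_deriv f (G s \<omega>) * G s \<omega>) ?b t x) =
          f (exp (X t)) - f (exp (X 0))"
        unfolding X_def
        by (rule chain_rule[OF inc_integrable_restrict[OF inc]]; use t integrand in auto)+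
      then show ?thesis
        unfolding has_gls_integral_def using elim(1) W2 False by (intro exI[of _ "1/2"]) auto
    qed
    then show ?case
      using average[OF t] by (intro exI[of _ "f (exp (X t)) - f (exp (X 0))"]) (simp add: start)
  qed
qed

end
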